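(* Assume that $(\boldsymbol\xi_t)_{t\in[T]}$ is a sequence of independent, finitely supported random variables. Then, for all cost distributions such that $(\boldsymbol c_t,\boldsymbol\xi_t)_{2\le t\le T}$ is a sequence of independent random variables (over $t$) with each $\boldsymbol\xi_t=(\boldsymbol A_t,\boldsymbol B_t,\boldsymbol b_t)$ finitely supported and each $\boldsymbol c_t\in L^1(\Omega,\mathcal A,\mathbb P;\mathbb R^{n_t})$ satisfying $\boldsymbol c_t\in-\operatorname{Cone}(\boldsymbol A_t^\top)$ almost surely, for all $t\in\{2,\dots,T\}$, all $x_{t-1}\in\mathbb R^{n_{t-1}}$ and all $\xi=(A,B,b)\in\operatorname{supp}(\boldsymbol\xi_t)$, $$\tilde V_t(x_{t-1}|\xi)=\sum_{N\in\mathcal N_{t,\xi}}\check p_{t,N|\xi}\ \min_{x_t\in\mathbb R^{n_t}}\Big\{\check c_{t,N|\xi}^\top x_t+V_{t+1}(x_t)+\mathbb I_{Ax_t+Bx_{t-1}\le b}\Big\},$$ where $\mathcal N_{t,\xi}:=\bigwedge_{\sigma\in\mathcal P_{t,\xi}}-\mathcal N_{t,\xi,\sigma}$ and, for $N\in\mathcal N_{t,\xi}$, $$\check p_{t,N|\xi}:=\mathbb P[(\boldsymbol c_t,1)\in\operatorname{ri}N\mid\boldsymbol\xi_t=\xi],\qquad \check c_{t,N|\xi}:=\mathbb E[\boldsymbol c_t\mid(\boldsymbol c_t,1)\in\operatorname{ri}N,\ \boldsymbol\xi_t=\xi]$$ if $\mathbb P[\boldsymbol\xi_t=\xi,(\boldsymbol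 c_t,1)\in\operatorname{ri}N]\ne0$, and $\check c_{t,N|\xi}:=0$ otherwise.
   Context: Multistage setting: $(\Omega,\mathcal A,\mathbb P)$ is a probability space, $[T]=\{1,\dots,T\}$, $\boldsymbol\xi_t=(\boldsymbol A_t,\boldsymbol B_t,\boldsymbol b_t)$ takes values in $\mathbb R^{q_t\times n_t}\times\mathbb R^{q_t\times n_{t-1}}\times\mathbb R^{q_t}$, $\boldsymbol c_t$ takes values in $\mathbb R^{n_t}$ ($\boldsymbol c_t$ and $\boldsymbol\xi_t$ may be correlated). Define $V_{T+1}\equiv0$ on $\mathbb R^{n_T}$ and for $t\in\{2,\dots,T\}$, $V_t(x_{t-1}):=\mathbb E\big[\min_{x_t\in\mathbb R^{n_t}}\{\boldsymbol c_t^\top x_t+V_{t+1}(x_t):\boldsymbol A_tx_t+\boldsymbol B_tx_{t-1}\le\boldsymbol b_t\}\big]$, and for $\xi=(A,B,b)\in\operatorname{supp}(\boldsymbol\xi_t)$, $$\tilde V_t(x_{t-1}|\xi):=\mathbb E\Big[\min_{x_t\in\mathbb R^{n_t}}\boldsymbol c_t^\top x_t+V_{t+1}(x_t)+\mathbb I_{Ax_t+Bx_{t-1}\le b}\ \Big|\ \boldsymbol\xi_t=\xi\Big],$$ so that $V_t(x_{t-1})=\sum_{\xi\in\operatorname{supp}(\boldsymbol\xi_t)}\mathbb P[\boldsymbol\xi_t=\xi]\,\tilde V_t(x_{t-1}|\xi)$. $\mathbb I_{\mathtt p}$ equals $0$ if $\mathtt p$ is true, $+\infty$ otherwise. $\operatorname{Cone}(A^\top)$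 is the cone generated by the columns of $A^\top$; $\operatorname{ri}$ is the relative interior. In weighted sums, terms of weight $0$ are counted as $0$. A polyhedral complex is a finite collection of polyhedra closed under taking non-empty faces and such that the intersection of two elements is a (possibly empty) face of each; support = union of its elements. $\mathcal C\wedge\mathcal C':=\{C\cap C':C\in\mathcal C,C'\in\mathcal C'\}$ ($\bigwedge$ for a finite family). $\mathcal F(P)$: complex of non-empty faces of $P$ (including $P$); $\mathbb R^k\times\mathcal P:=\{\mathbb R^k\times\sigma:\sigma\in\mathcal P\}$. Chamber complex of a polyhedral complex $\mathcal P$ along a linear projection $\pi$: $\mathcal C(\mathcal P,\pi):=\{\sigma_{\mathcal P,\pi}(x):x\in\pi(\operatorname{supp}\mathcal P)\}$, $\sigma_{\mathcal P,\pi}(x):=\bigcap_{F\in\mathcal P,\,x\in\pi(F)}\pi(F)$. With $P_t(\xi):=\{(x_{t-1},x_t):Ax_t+Bx_{t-1}\le b\}$ define $\mathcal P_{T+1}:=\{\mathbb R^{n_T}\}$ and, for $t=T,\dots,2$, $\mathcal P_{t,\xi}:=\mathcal C\big((\mathbb R^{n_{t-1}}\times\mathcal P_{t+1})\wedge\mathcal F(P_t(\xi)),\ (x_{t-1},x_t)\mapsto x_{t-1}\big)$ and $\mathcal P_t:=\bigwedge_{\xi\in\operatorname{supp}(\boldsymbol\xi_t)}\mathcal P_{t,\xi}$. Let $Q_t^\xi(x_{t-1},x_t):=V_{t+1}(x_t)+\mathbb I_{Ax_t+Bx_{t-1}\le b}$ and let $\operatorname{epi}(Q_t^\xi)_{x_{t-1}}:=\{(x_t,z)\in\mathbb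 R^{n_t}\times\mathbb R:(x_{t-1},x_t,z)\in\operatorname{epi}(Q_t^\xi)\}$. The normal fan of a convex set $C$ is $\mathcal N(C)=\{N_C(x):x\in C\}$, $N_C(x)=\{\alpha:\alpha^\top(y-x)\le0\ \forall y\in C\}$. For $\sigma\in\mathcal P_{t,\xi}$, all the fibers $\operatorname{epi}(Q_t^\xi)_{x_{t-1}}$ with $x_{t-1}\in\operatorname{ri}(\sigma)$ have the same normal fan, denoted $\mathcal N_{t,\xi,\sigma}$ (a fan of cones in $\mathbb R^{n_t}\times\mathbb R$), and $-\mathcal N_{t,\xi,\sigma}:=\{-N:N\in\mathcal N_{t,\xi,\sigma}\}$.
   Formalization: It is additionally assumed that, for 2 ≤ t < T and every x_{t-1}, the minimum defining V_t almost surely exists (attained, or +∞ if infeasible); the cone condition on c_t does not ensure this for t < T, and the formula fails without it. *)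

theory Defs
  imports "HOL-Probability.Probability"
begin

text \<open>
  The dimensions vary with the stage, so \<open>\<real>\<^sup>I\<close>, for a set \<open>I\<close> of coordinates, is represented as the
  coordinate subspace of a sufficiently large \<open>\<real>\<^sup>n\<close> whose members vanish off \<open>I\<close>. Stage \<open>t\<close> has
  the decision space \<open>coord_space (I t)\<close> of dimension \<open>card (I t)\<close>, and its \<open>card (J t)\<close>
  constraints are indexed by \<open>J t\<close>; rows outside \<open>J t\<close> read \<open>0 \<le> 0\<close>.
\<close>

definition coord_space :: "'n set \<Rightarrow> (real^'n) set" where
  "coord_space I = {x. \<forall>i. i \<notin> I \<longrightarrow> x $ i = 0}"

definition coord_matrices :: "'q set \<Rightarrow> 'n set \<Rightarrow> (real^'n^'q) set" where
  "coord_matrices J I = {A. \<forall>j i. j \<notin> J \<or> i \<notin> I \<longrightarrow> A $ j $ i = 0}"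

text \<open>A triple \<open>(A, B, b)\<close> stands for the constraint \<open>A y + B x \<le> b\<close>, where \<open>x\<close> is the previous
  decision and \<open>y\<close> the current one.\<close>

type_synonym ('n, 'q) constr = "(real^'n^'q) \<times> (real^'n^'q) \<times> (real^'q)"

definition coord_constrs :: "'q set \<Rightarrow> 'n set \<Rightarrow> 'n set \<Rightarrow> ('n::finite, 'q::finite) constr set" where
  "coord_constrs J I I' = coord_matrices J I \<times> coord_matrices J I' \<times> coord_space J"

fun satisfies :: "('n::finite, 'q::finite) constr \<Rightarrow> real^'n \<Rightarrow> real^'n \<Rightarrow> bool" where
  "satisfies (A, B, b) x y \<longleftrightarrow> A *v y + B *v x \<le> b"

definition convex_ind :: "bool \<Rightarrow> ereal" where
  "convex_ind p = (if p then 0 else \<infinity>)"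


subsection \<open>Random variables\<close>

text \<open>Expectation of a quantity with values in the extended reals. Since \<open>\<infinity> - \<infinity> = \<infinity>\<close> for
  \<^typ>\<open>ereal\<close>, the value is \<open>\<infinity>\<close> when neither part is integrable.\<close>

definition ereal_expectation :: "'w measure \<Rightarrow> ('w \<Rightarrow> ereal) \<Rightarrow> ereal" where
  "ereal_expectation M f =
     enn2ereal (\<integral>\<^sup>+ \<omega>. e2ennreal (f \<omega>) \<partial>M) - enn2ereal (\<integral>\<^sup>+ \<omega>. e2ennreal (- f \<omega>) \<partial>M)"

definition finitely_supported :: "'w measure \<Rightarrow> ('w \<Rightarrow> 'a) \<Rightarrow> bool" where
  "finitely_supported M X \<longleftrightarrow> (\<exists>S. finite S \<and> (AE \<omega> in M. X \<omega> \<in> S))"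

text \<open>The support of a finitely supported variable is its set of atoms.\<close>

definition atoms :: "'w measure \<Rightarrow> ('w \<Rightarrow> 'a) \<Rightarrow> 'a set" where
  "atoms M X = {s. measure M {\<omega> \<in> space M. X \<omega> = s} > 0}"

definition cond_on :: "'w measure \<Rightarrow> ('w \<Rightarrow> 'a) \<Rightarrow> 'a \<Rightarrow> 'w measure" where
  "cond_on M X s = uniform_measure M {\<omega> \<in> space M. X \<omega> = s}"


subsection \<open>Value functions\<close>

text \<open>In \<^typ>\<open>ereal\<close> the infimum over the empty set is \<open>\<infinity>\<close>, and \<open>- \<infinity> + \<infinity> = \<infinity>\<close>, so that
  infeasibility always yields \<open>\<infinity>\<close>.\<close>

function value_fn :: "'w measure \<Rightarrow> nat \<Rightarrow> (nat \<Rightarrow> 'n set) \<Rightarrow> (nat \<Rightarrow> 'w \<Rightarrow> real^'n)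
    \<Rightarrow> (nat \<Rightarrow> 'w \<Rightarrow> ('n::finite, 'q::finite) constr) \<Rightarrow> nat \<Rightarrow> real^'n \<Rightarrow> ereal" where
  "value_fn M T I c \<xi> t x =
     (if T < t then 0
      else ereal_expectation M
        (\<lambda>\<omega>. INF y \<in> {y \<in> coord_space (I t). satisfies (\<xi> t \<omega>) x y}.
                ereal (c t \<omega> \<bullet> y) + value_fn M T I c \<xi> (Suc t) y))"
  by pat_completeness auto
termination
  by (relation "Wellfounded.measure (\<lambda>(M, T, I, c, \<xi>, t, x). Suc T - t)") auto

declare value_fn.simps [simp del]

definition stage_Q :: "'w measure \<Rightarrow> nat \<Rightarrow> (nat \<Rightarrow> 'n set) \<Rightarrow> (nat \<Rightarrow> 'w \<Rightarrow> real^'n)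
    \<Rightarrow> (nat \<Rightarrow> 'w \<Rightarrow> ('n::finite, 'q::finite) constr) \<Rightarrow> nat \<Rightarrow> ('n, 'q) constr
    \<Rightarrow> real^'n \<Rightarrow> real^'n \<Rightarrow> ereal" where
  "stage_Q M T I c \<xi> t s x y = value_fn M T I c \<xi> (Suc t) y + convex_ind (satisfies s x y)"

definition cond_value :: "'w measure \<Rightarrow> nat \<Rightarrow> (nat \<Rightarrow> 'n set) \<Rightarrow> (nat \<Rightarrow> 'w \<Rightarrow> real^'n)
    \<Rightarrow> (nat \<Rightarrow> 'w \<Rightarrow> ('n::finite, 'q::finite) constr) \<Rightarrow> nat \<Rightarrow> real^'n \<Rightarrow> ('n, 'q) constr
    \<Rightarrow> ereal" where
  "cond_value M T I c \<xi> t x s =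
     ereal_expectation (cond_on M (\<xi> t) s)
       (\<lambda>\<omega>. INF y \<in> coord_space (I t). ereal (c t \<omega> \<bullet> y) + stage_Q M T I c \<xi> t s x y)"


subsection \<open>Polyhedral complexes\<close>

definition meet :: "'a set set \<Rightarrow> 'a set set \<Rightarrow> 'a set set" where
  "meet C D = {X \<inter> Y | X Y. X \<in> C \<and> Y \<in> D}"

text \<open>Common refinement of a family of collections of subsets of the ambient space \<open>E\<close>. For an
  empty family it is \<open>{E}\<close>, the neutral element of \<^const>\<open>meet\<close>.\<close>

definition big_meet :: "'a set \<Rightarrow> 'k set \<Rightarrow> ('k \<Rightarrow> 'a set set) \<Rightarrow> 'a set set" where
  "big_meet E K C = {E \<inter> (\<Inter>k\<in>K. f k) | f. \<forall>k\<in>K. f k \<in> C k}"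

definition face_complex :: "'a::real_vector set \<Rightarrow> 'a set set" where
  "face_complex P = {F. F face_of P \<and> F \<noteq> {}}"

definition chamber :: "'a set set \<Rightarrow> ('a \<Rightarrow> 'b) \<Rightarrow> 'b \<Rightarrow> 'b set" where
  "chamber \<P> \<pi> x = \<Inter> {\<pi> ` F | F. F \<in> \<P> \<and> x \<in> \<pi> ` F}"

definition chamber_complex :: "'a set set \<Rightarrow> ('a \<Rightarrow> 'b) \<Rightarrow> 'b set set" where
  "chamber_complex \<P> \<pi> = chamber \<P> \<pi> ` (\<pi> ` (\<Union> \<P>))"

text \<open>The pairs (previous decision, current decision) allowed by the constraint \<open>s\<close> at stage \<open>t\<close>.\<close>

definition coupling_polyhedron ::
    "(nat \<Rightarrow> 'n set) \<Rightarrow> nat \<Rightarrow> ('n::finite, 'q::finite) constr \<Rightarrow> ((real^'n) \<times> (real^'n)) set" where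
  "coupling_polyhedron I t s =
     {(x, y). x \<in> coord_space (I (t - 1)) \<and> y \<in> coord_space (I t) \<and> satisfies s x y}"

text \<open>One backward step, from the complex \<open>\<P>\<close> of stage \<open>t + 1\<close> to that of stage \<open>t\<close> given \<open>s\<close>.\<close>

definition cell_step :: "(nat \<Rightarrow> 'n set) \<Rightarrow> nat \<Rightarrow> (real^'n) set set
    \<Rightarrow> ('n::finite, 'q::finite) constr \<Rightarrow> (real^'n) set set" where
  "cell_step I t \<P> s =
     chamber_complex
       (meet {coord_space (I (t - 1)) \<times> \<sigma> | \<sigma>. \<sigma> \<in> \<P>} (face_complex (coupling_polyhedron I t s)))
       fst"

function cells :: "'w measure \<Rightarrow> nat \<Rightarrow> (nat \<Rightarrow> 'n set)
    \<Rightarrow> (nat \<Rightarrow> 'w \<Rightarrow> ('n::finite, 'q::finite) constr) \<Rightarrow> nat \<Rightarrow> (real^'n) set set" where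
  "cells M T I \<xi> t =
     (if T < t then {coord_space (I T)}
      else big_meet (coord_space (I (t - 1))) (atoms M (\<xi> t))
             (cell_step I t (cells M T I \<xi> (Suc t))))"
  by pat_completeness auto
termination
  by (relation "Wellfounded.measure (\<lambda>(M, T, I, \<xi>, t). Suc T - t)") auto

declare cells.simps [simp del]

definition cond_cells :: "'w measure \<Rightarrow> nat \<Rightarrow> (nat \<Rightarrow> 'n set)
    \<Rightarrow> (nat \<Rightarrow> 'w \<Rightarrow> ('n::finite, 'q::finite) constr) \<Rightarrow> nat \<Rightarrow> ('n, 'q) constr
    \<Rightarrow> (real^'n) set set" where
  "cond_cells M T I \<xi> t s = cell_step I t (cells M T I \<xi> (Suc t)) s"


subsection \<open>Normal fans\<close>

text \<open>Normal cones are taken inside the subspace \<open>E\<close> in which \<open>C\<close> lives.\<close>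

definition normal_cone :: "'a::real_inner set \<Rightarrow> 'a set \<Rightarrow> 'a \<Rightarrow> 'a set" where
  "normal_cone E C x = {\<alpha> \<in> E. \<forall>y\<in>C. \<alpha> \<bullet> (y - x) \<le> 0}"

definition normal_fan :: "'a::real_inner set \<Rightarrow> 'a set \<Rightarrow> 'a set set" where
  "normal_fan E C = normal_cone E C ` C"

abbreviation epi_space :: "'n set \<Rightarrow> ((real^'n) \<times> real) set" where
  "epi_space I \<equiv> coord_space I \<times> UNIV"

definition epi_fiber :: "'w measure \<Rightarrow> nat \<Rightarrow> (nat \<Rightarrow> 'n set) \<Rightarrow> (nat \<Rightarrow> 'w \<Rightarrow> real^'n)
    \<Rightarrow> (nat \<Rightarrow> 'w \<Rightarrow> ('n::finite, 'q::finite) constr) \<Rightarrow> nat \<Rightarrow> ('n, 'q) constr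
    \<Rightarrow> real^'n \<Rightarrow> ((real^'n) \<times> real) set" where
  "epi_fiber M T I c \<xi> t s x =
     {(y, z). y \<in> coord_space (I t) \<and> stage_Q M T I c \<xi> t s x y \<le> ereal z}"

text \<open>The common normal fan of all the fibers over the relative interior of the cell \<open>\<sigma>\<close>.\<close>

definition cell_fan :: "'w measure \<Rightarrow> nat \<Rightarrow> (nat \<Rightarrow> 'n set) \<Rightarrow> (nat \<Rightarrow> 'w \<Rightarrow> real^'n)
    \<Rightarrow> (nat \<Rightarrow> 'w \<Rightarrow> ('n::finite, 'q::finite) constr) \<Rightarrow> nat \<Rightarrow> ('n, 'q) constr
    \<Rightarrow> (real^'n) set \<Rightarrow> ((real^'n) \<times> real) set set" where
  "cell_fan M T I c \<xi> t s \<sigma> =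
     (THE \<N>. \<forall>x \<in> rel_interior \<sigma>. normal_fan (epi_space (I t)) (epi_fiber M T I c \<xi> t s x) = \<N>)"

definition quant_fan :: "'w measure \<Rightarrow> nat \<Rightarrow> (nat \<Rightarrow> 'n set) \<Rightarrow> (nat \<Rightarrow> 'w \<Rightarrow> real^'n)
    \<Rightarrow> (nat \<Rightarrow> 'w \<Rightarrow> ('n::finite, 'q::finite) constr) \<Rightarrow> nat \<Rightarrow> ('n, 'q) constr
    \<Rightarrow> ((real^'n) \<times> real) set set" where
  "quant_fan M T I c \<xi> t s =
     big_meet (epi_space (I t)) (cond_cells M T I \<xi> t s)
       (\<lambda>\<sigma>. {uminus ` N | N. N \<in> cell_fan M T I c \<xi> t s \<sigma>})"


subsection \<open>Quantized costs\<close>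

definition quant_prob :: "'w measure \<Rightarrow> (nat \<Rightarrow> 'w \<Rightarrow> real^'n)
    \<Rightarrow> (nat \<Rightarrow> 'w \<Rightarrow> ('n::finite, 'q::finite) constr) \<Rightarrow> nat \<Rightarrow> ('n, 'q) constr
    \<Rightarrow> ((real^'n) \<times> real) set \<Rightarrow> real" where
  "quant_prob M c \<xi> t s N =
     measure (cond_on M (\<xi> t) s) {\<omega> \<in> space M. (c t \<omega>, 1) \<in> rel_interior N}"

definition quant_cost :: "'w measure \<Rightarrow> (nat \<Rightarrow> 'w \<Rightarrow> real^'n)
    \<Rightarrow> (nat \<Rightarrow> 'w \<Rightarrow> ('n::finite, 'q::finite) constr) \<Rightarrow> nat \<Rightarrow> ('n, 'q) constr
    \<Rightarrow> ((real^'n) \<times> real) set \<Rightarrow> real^'n" where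
  "quant_cost M c \<xi> t s N =
     (let U = {\<omega> \<in> space M. \<xi> t \<omega> = s \<and> (c t \<omega>, 1) \<in> rel_interior N}
      in if measure M U \<noteq> 0 then integral\<^sup>L (uniform_measure M U) (c t) else 0)"

text \<open>
  The minimum of \<open>f\<close> over \<open>S\<close> exists (it is \<open>\<infinity>\<close> if \<open>f\<close> is identically \<open>\<infinity>\<close>).
\<close>

definition has_min_on :: "('a \<Rightarrow> ereal) \<Rightarrow> 'a set \<Rightarrow> bool" where
  "has_min_on f S \<longleftrightarrow> (\<exists>y\<in>S. \<forall>y'\<in>S. f y \<le> f y')"

end

theory Submission
  imports Defs
begin

text \<open>
  Fix a stage \<open>t\<close> and an atom \<open>s\<close> of \<open>\<xi> t\<close>. Minimizing \<open>c \<bullet> y + V (Suc t) y\<close> over the feasible \<open>y\<close> means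
  minimizing the linear functional \<open>(c, 1)\<close> over the fiber \<open>C x\<close> of the epigraph above \<open>x\<close>, and a
  point of \<open>C x\<close> is a minimizer iff \<open>- (c, 1)\<close> lies in its normal cone. So one point is optimal for
  all costs whose reflection lies in one normal cone; on this set of costs the optimal value is
  affine in the cost, and the random cost may be replaced by its conditional mean
  (\<open>optimal_mean\<close>, \<open>quantization\<close>). The relative interiors of the cones of a fan partition its
  support, so that the contributions of the cones add up to the whole expectation. This property
  survives common refinement (\<open>face_stratified_big_meet\<close>).

  One fan serves all \<open>x\<close> because the normal fan of \<open>C x\<close> is the same for all \<open>x\<close> in the relative
  interior of a chamber (\<open>normal_fan_constant_on_chamber\<close>), and there are finitely many chambers. Since
  \<open>V (Suc t)\<close> is convex, and affine on each cell, a normal cone depends only on the cell in whose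
  relative interior the point lies and on whether the point is above the graph
  (\<open>normal_cone_cell_mono\<close>). Each cell with a relative interior point over \<open>x0\<close> has one over every
  \<open>x\<close> in the relative interior of the chamber of \<open>x0\<close>; hence the fan at \<open>x0\<close> is contained in the
  fan at \<open>x\<close>. The supports agree: a functional bounded on \<open>C x\<close> is bounded on \<open>C x0\<close> by convexity,
  and on a polyhedron it then attains its bound. A fan contained in a fan with the same support is
  equal to it.

  The hypothesis on \<open>V (Suc t)\<close>, that its epigraph is a polyhedron and that it is affine on the cells
  of its complex, is established backwards from the last stage. By the quantization itself, \<open>V t\<close> is
  a weighted sum of the optimal values for finitely many deterministic costs. Each of these has a
  polyhedral epigraph, being a projection of a polyhedron (\<open>polyhedron_linear_image\<close>,
  \<open>polyhedral_val\<close>), and is affine on the chambers (\<open>affine_val_chamber\<close>).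

  The vector \<open>- (c t \<omega>, 1)\<close> lies in the support of the normal fan of \<open>C x\<close> exactly when the minimum
  over \<open>C x\<close> is attained. At the last stage attainment follows from the cone condition by weak duality (\<open>row_cone_bounded_above\<close>). At
  earlier stages \<open>V (Suc t)\<close> may decrease faster than the cost grows, and the existence of the minimum
  is a hypothesis.
\<close>

section \<open>Polyhedra\<close>

lemma polyhedron_inequalities:
  fixes P :: "'a::euclidean_space set"
  shows "polyhedron P \<longleftrightarrow>
    (\<exists>S::('a \<times> real) set. finite S \<and> P = {x. \<forall>(a, b) \<in> S. a \<bullet> x \<le> b})"
proof
  assume "polyhedron P"
  then obtain F where F: "finite F" "P = \<Inter>F"
      "\<forall>h\<in>F. \<exists>a b. a \<noteq> 0 \<and> h = {x. a \<bullet> x \<le> b}"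
    unfolding polyhedron_def by blast
  then obtain a b where ab: "\<And>h. h \<in> F \<Longrightarrow> h = {x. a h \<bullet> x \<le> b h}" by metis
  have "P = {x. \<forall>(a, b) \<in> (\<lambda>h. (a h, b h)) ` F. a \<bullet> x \<le> b}"
    using F(2) ab by auto
  then show "\<exists>S::('a \<times> real) set. finite S \<and> P = {x. \<forall>(a, b) \<in> S. a \<bullet> x \<le> b}"
    using F(1) by blast
next
  assume "\<exists>S::('a \<times> real) set. finite S \<and> P = {x. \<forall>(a, b) \<in> S. a \<bullet> x \<le> b}"
  then obtain S :: "('a \<times> real) set"
    where S: "finite S" "P = {x. \<forall>(a, b) \<in> S. a \<bullet> x \<le> b}" by blast
  have "P = \<Inter>((\<lambda>(a, b). {x. a \<bullet> x \<le> b}) ` S)" using S(2) by auto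
  then show "polyhedron P" using S(1) by (auto simp: polyhedron_halfspace_le)
qed

lemma polyhedronE_inequalities:
  fixes P :: "'a::euclidean_space set"
  assumes "polyhedron P"
  obtains S :: "('a \<times> real) set" where "finite S" "P = {x. \<forall>(a, b) \<in> S. a \<bullet> x \<le> b}"
  using assms unfolding polyhedron_inequalities by auto

lemma polyhedronI_inequalities:
  fixes S :: "('a::euclidean_space \<times> real) set"
  assumes "finite S" "P = {x. \<forall>(a, b) \<in> S. a \<bullet> x \<le> b}"
  shows "polyhedron P"
  using assms unfolding polyhedron_inequalities by auto

lemma polyhedron_affine_preimage:
  fixes f :: "'a::euclidean_space \<Rightarrow> 'b::euclidean_space"
  assumes "linear f" "polyhedron P"
  shows "polyhedron {x. c + f x \<in> P}"
proof -
  obtain S :: "('b \<times> real) set"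
    where S: "finite S" "P = {x. \<forall>(a, b) \<in> S. a \<bullet> x \<le> b}"
    by (rule polyhedronE_inequalities[OF assms(2)])
  have "{x. c + f x \<in> P} =
      {x. \<forall>(a, b) \<in> (\<lambda>(a, b). (adjoint f a, b - a \<bullet> c)) ` S. a \<bullet> x \<le> b}"
    using S(2) adjoint_clauses[OF assms(1)] by (auto simp: inner_add_right algebra_simps)
  then show ?thesis by (rule polyhedronI_inequalities[rotated]) (use S(1) in simp)
qed

corollary polyhedron_linear_preimage:
  fixes f :: "'a::euclidean_space \<Rightarrow> 'b::euclidean_space"
  assumes "linear f" "polyhedron P"
  shows "polyhedron {x. f x \<in> P}"
  using polyhedron_affine_preimage[OF assms, of 0] by simp

text \<open>Fourier-Motzkin elimination: a scalar \<open>t\<close> with \<open>x + t v\<close> in the polyhedron exists iff every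
  lower bound that the inequalities put on \<open>t\<close> is at most every upper bound, and each of these
  finitely many comparisons is again a linear inequality in \<open>x\<close>.\<close>

lemma polyhedron_plus_line:
  fixes P :: "'a::euclidean_space set" and v :: 'a
  assumes "polyhedron P"
  shows "polyhedron {x. \<exists>t. x + t *\<^sub>R v \<in> P}"
proof -
  obtain S :: "('a \<times> real) set"
    where S: "finite S" "P = {x. \<forall>(a, b) \<in> S. a \<bullet> x \<le> b}"
    by (rule polyhedronE_inequalities[OF assms])
  define Z where "Z = {r\<in>S. fst r \<bullet> v = 0}"
  define U where "U = {r\<in>S. fst r \<bullet> v > 0}"
  define L where "L = {r\<in>S. fst r \<bullet> v < 0}"
  define bound where "bound r x = (snd r - fst r \<bullet> x) / (fst r \<bullet> v)" for r :: "'a \<times> real" and x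
  define W where "W = (\<lambda>(r, s). ((1 / (fst s \<bullet> v)) *\<^sub>R fst s - (1 / (fst r \<bullet> v)) *\<^sub>R fst r,
      snd s / (fst s \<bullet> v) - snd r / (fst r \<bullet> v))) ` (L \<times> U)"
  have fin: "finite Z" "finite U" "finite L" using S(1) by (auto simp: Z_def U_def L_def)
  have mem: "x + t *\<^sub>R v \<in> P \<longleftrightarrow>
     (\<forall>r\<in>Z. fst r \<bullet> x \<le> snd r) \<and> (\<forall>r\<in>U. t \<le> bound r x) \<and> (\<forall>r\<in>L. bound r x \<le> t)" for x t
  proof -
    have "x + t *\<^sub>R v \<in> P \<longleftrightarrow> (\<forall>r\<in>S. fst r \<bullet> x + t * (fst r \<bullet> v) \<le> snd r)"
      using S(2) by (auto simp: inner_add_right case_prod_beta)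
    also have "S = Z \<union> U \<union> L" by (auto simp: Z_def U_def L_def)
    also have "(\<forall>r\<in>Z \<union> U \<union> L. fst r \<bullet> x + t * (fst r \<bullet> v) \<le> snd r) \<longleftrightarrow>
        (\<forall>r\<in>Z. fst r \<bullet> x \<le> snd r) \<and> (\<forall>r\<in>U. t \<le> bound r x) \<and> (\<forall>r\<in>L. bound r x \<le> t)"
    proof -
      have "(\<forall>r\<in>U. fst r \<bullet> x + t * (fst r \<bullet> v) \<le> snd r) \<longleftrightarrow> (\<forall>r\<in>U. t \<le> bound r x)"
        by (auto simp: U_def bound_def field_simps)
      moreover have "(\<forall>r\<in>L. fst r \<bullet> x + t * (fst r \<bullet> v) \<le> snd r) \<longleftrightarrow> (\<forall>r\<in>L. bound r x \<le> t)"
        by (auto simp: L_def bound_def field_simps)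
      moreover have "(\<forall>r\<in>Z. fst r \<bullet> x + t * (fst r \<bullet> v) \<le> snd r) \<longleftrightarrow> (\<forall>r\<in>Z. fst r \<bullet> x \<le> snd r)"
        by (auto simp: Z_def)
      ultimately show ?thesis by blast
    qed
    finally show ?thesis .
  qed
  have ex: "(\<exists>t. (\<forall>r\<in>U. t \<le> bound r x) \<and> (\<forall>r\<in>L. bound r x \<le> t)) \<longleftrightarrow>
      (\<forall>r\<in>L. \<forall>s\<in>U. bound r x \<le> bound s x)" for x
  proof
    assume all: "\<forall>r\<in>L. \<forall>s\<in>U. bound r x \<le> bound s x"
    show "\<exists>t. (\<forall>r\<in>U. t \<le> bound r x) \<and> (\<forall>r\<in>L. bound r x \<le> t)"
    proof (cases "L = {}")
      case True
      show ?thesis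
      proof (cases "U = {}")
        case False
        then show ?thesis using True fin
          by (intro exI[of _ "Min ((\<lambda>r. bound r x) ` U)"]) auto
      qed (use True in auto)
    next
      case False
      then show ?thesis using all fin
        by (intro exI[of _ "Max ((\<lambda>r. bound r x) ` L)"]) (auto intro!: Max.boundedI)
    qed
  qed (meson order_trans)
  have W: "(\<forall>r\<in>L. \<forall>s\<in>U. bound r x \<le> bound s x) \<longleftrightarrow> (\<forall>r\<in>W. fst r \<bullet> x \<le> snd r)" for x
  proof -
    have "bound r x \<le> bound s x \<longleftrightarrow>
        ((1 / (fst s \<bullet> v)) *\<^sub>R fst s - (1 / (fst r \<bullet> v)) *\<^sub>R fst r) \<bullet> x
          \<le> snd s / (fst s \<bullet> v) - snd r / (fst r \<bullet> v)" for r s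
      unfolding bound_def by (simp add: inner_diff_left diff_divide_distrib) linarith
    then show ?thesis unfolding W_def by simp
  qed
  have "x \<in> {x. \<exists>t. x + t *\<^sub>R v \<in> P} \<longleftrightarrow> (\<forall>r\<in>Z. fst r \<bullet> x \<le> snd r) \<and> (\<forall>r\<in>W. fst r \<bullet> x \<le> snd r)" for x
    unfolding mem_Collect_eq mem W[symmetric] ex[symmetric] by blast
  then have "{x. \<exists>t. x + t *\<^sub>R v \<in> P} = {x. \<forall>(a, b) \<in> Z \<union> W. a \<bullet> x \<le> b}"
    by (auto simp: case_prod_beta)
  moreover have "finite (Z \<union> W)" using fin by (auto simp: W_def)
  ultimately show ?thesis using polyhedronI_inequalities by blast
qed

text \<open>Eliminating all coordinates of the kernel of a projection, one line at a time, gives images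
  under linear maps.\<close>

lemma polyhedron_plus_span:
  fixes P :: "'a::euclidean_space set"
  assumes "finite B" "polyhedron P"
  shows "polyhedron {x. \<exists>s\<in>span B. x + s \<in> P}"
  using assms(1)
proof (induction B)
  case empty
  then show ?case using assms(2) by simp
next
  case (insert v B)
  have "{x. \<exists>s\<in>span (insert v B). x + s \<in> P} =
      {x. \<exists>t. x + t *\<^sub>R v \<in> {x. \<exists>s\<in>span B. x + s \<in> P}}" (is "?A = ?B")
  proof
  show "?A \<subseteq> ?B"
    proof
      fix x assume "x \<in> ?A"
      then obtain s where s: "s \<in> span (insert v B)" "x + s \<in> P" by blast
      then obtain k where k: "s - k *\<^sub>R v \<in> span B" by (auto simp: span_breakdown_eq)
      have "x + k *\<^sub>R v + (s - k *\<^sub>R v) \<in> P" using s(2) by simp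
      then show "x \<in> ?B" using k by blast
    qed
    show "?B \<subseteq> ?A"
    proof
      fix x assume "x \<in> ?B"
      then obtain t s where s: "s \<in> span B" "x + t *\<^sub>R v + s \<in> P" by blast
      then have "t *\<^sub>R v + s \<in> span (insert v B)"
        by (meson insertI1 span_add span_base span_mono span_scale subset_iff subset_insertI)
      moreover have "x + (t *\<^sub>R v + s) \<in> P" using s(2) by (simp add: add.assoc)
      ultimately show "x \<in> ?A" by blast
    qed
  qed
  then show ?case using polyhedron_plus_line[OF insert.IH] by simp
qed

lemma polyhedron_linear_image:
  fixes f :: "'a::euclidean_space \<Rightarrow> 'b::euclidean_space"
  assumes f: "linear f" and P: "polyhedron P"
  shows "polyhedron (f ` P)"
proof -
  interpret f: linear f by fact
  define G where "G = {p. fst p \<in> P} \<inter> {p. snd p - f (fst p) \<in> {0}}"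
  have lin: "linear (\<lambda>p. snd p - f (fst p))"
    by (rule linearI) (auto simp: f.add f.scale algebra_simps)
  have G: "polyhedron G"
    unfolding G_def
    by (intro polyhedron_Int polyhedron_linear_preimage linear_fst lin P
        affine_imp_polyhedron affine_sing)
  have span: "span ((\<lambda>i. (i, 0::'b)) ` (Basis::'a set)) = UNIV \<times> {0}"
  proof -
    have "linear (\<lambda>i::'a. (i, 0::'b))" by (rule linearI) auto
    then have "span ((\<lambda>i. (i, 0::'b)) ` (Basis::'a set)) = (\<lambda>i. (i, 0)) ` span Basis"
      by (metis span_linear_image)
    then show ?thesis by auto
  qed
  have "polyhedron {p. \<exists>s\<in>span ((\<lambda>i. (i, 0::'b)) ` (Basis::'a set)). p + s \<in> G}"
    by (rule polyhedron_plus_span[OF _ G]) simp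
  then have "polyhedron {p. \<exists>s\<in>UNIV \<times> {0}. p + s \<in> G}" by (simp add: span)
  moreover have "linear (\<lambda>y::'b. (0::'a, y))" by (rule linearI) auto
  ultimately have "polyhedron {y. (0, y) \<in> {p. \<exists>s\<in>UNIV \<times> {0}. p + s \<in> G}}"
    by (rule polyhedron_linear_preimage[rotated])
  moreover have "{y. (0, y) \<in> {p. \<exists>s\<in>UNIV \<times> {0}. p + s \<in> G}} = f ` P"
    by (auto simp: G_def)
  ultimately show ?thesis by simp
qed

lemma polyhedron_Times:
  fixes P :: "'a::euclidean_space set" and Q :: "'b::euclidean_space set"
  assumes "polyhedron P" "polyhedron Q"
  shows "polyhedron (P \<times> Q)"
proof -
  have "P \<times> Q = {p. fst p \<in> P} \<inter> {p. snd p \<in> Q}" by auto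
  then show ?thesis
    using assms by (simp add: polyhedron_linear_preimage linear_fst linear_snd)
qed

text \<open>The values of a linear functional on a polyhedron form a polyhedron of the line, hence a
  closed set, so a finite supremum is attained.\<close>

lemma polyhedron_attains_sup:
  fixes P :: "'a::euclidean_space set"
  assumes P: "polyhedron P" "P \<noteq> {}" and bdd: "\<And>p. p \<in> P \<Longrightarrow> v \<bullet> p \<le> K"
  shows "\<exists>p\<in>P. \<forall>q\<in>P. v \<bullet> q \<le> v \<bullet> p"
proof -
  let ?A = "(\<lambda>p. v \<bullet> p) ` P"
  have "linear (\<lambda>p. v \<bullet> p)" by (rule linearI) (auto simp: inner_add_right)
  then have "closed ?A" using P(1) polyhedron_linear_image polyhedron_imp_closed by blast
  moreover have "bdd_above ?A" using bdd by (intro bdd_aboveI[of _ K]) auto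
  ultimately have "Sup ?A \<in> ?A" using P(2) by (intro closed_contains_Sup) auto
  then obtain p where "p \<in> P" "Sup ?A = v \<bullet> p" by auto
  then show ?thesis using \<open>bdd_above ?A\<close> by (metis cSUP_upper)
qed

lemma polyhedron_feasible_direction:
  fixes S :: "('a::euclidean_space \<times> real) set"
  assumes "finite S" and y: "\<forall>(a, b)\<in>S. a \<bullet> y \<le> b"
    and act: "\<And>a b. (a, b) \<in> S \<Longrightarrow> a \<bullet> y = b \<Longrightarrow> a \<bullet> d \<le> 0"
  shows "\<exists>\<epsilon>>0. \<forall>(a, b)\<in>S. a \<bullet> (y + \<epsilon> *\<^sub>R d) \<le> b"
  using assms
proof (induction S)
  case empty
  then show ?case by (auto intro: exI[of _ 1])
next
  case (insert r S)
  obtain a b where r: "r = (a, b)" by fastforce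
  obtain \<epsilon> where \<epsilon>: "\<epsilon> > 0" "\<forall>(a, b)\<in>S. a \<bullet> (y + \<epsilon> *\<^sub>R d) \<le> b"
    using insert by auto
  have small: "\<forall>(a, b)\<in>S. a \<bullet> (y + \<delta> *\<^sub>R d) \<le> b" if "0 < \<delta>" "\<delta> \<le> \<epsilon>" for \<delta>
  proof clarify
    fix a b assume ab: "(a, b) \<in> S"
    show "a \<bullet> (y + \<delta> *\<^sub>R d) \<le> b"
    proof (cases "a \<bullet> d \<le> 0")
      case True
      have "a \<bullet> y \<le> b" using insert.prems(1) ab by auto
      moreover have "\<delta> * (a \<bullet> d) \<le> 0" using True that by (simp add: mult_nonneg_nonpos)
      ultimately show ?thesis by (simp add: inner_add_right)
    next
      case False
      then have "\<delta> * (a \<bullet> d) \<le> \<epsilon> * (a \<bullet> d)" using that by (simp add: mult_right_mono)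
      moreover have "a \<bullet> (y + \<epsilon> *\<^sub>R d) \<le> b" using \<epsilon>(2) ab by blast
      ultimately show ?thesis by (simp add: inner_add_right)
    qed
  qed
  have ayb: "a \<bullet> y \<le> b" using insert.prems(1) r by auto
  show ?case
  proof (cases "a \<bullet> d \<le> 0")
    case True
    then have "a \<bullet> (y + \<epsilon> *\<^sub>R d) \<le> b"
      using ayb \<epsilon>(1) by (simp add: inner_add_right mult_nonneg_nonpos add_decreasing2)
    then show ?thesis using \<epsilon> r by (intro exI[of _ \<epsilon>]) auto
  next
    case False
    then have slack: "b - a \<bullet> y > 0" using insert.prems(2)[of a b] r ayb by fastforce
    define \<delta> where "\<delta> = min \<epsilon> ((b - a \<bullet> y) / (a \<bullet> d))"
    have \<delta>: "0 < \<delta>" "\<delta> \<le> \<epsilon>" "\<delta> \<le> (b - a \<bullet> y) / (a \<bullet> d)"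
      using slack False \<epsilon>(1) by (auto simp: \<delta>_def)
    then have "a \<bullet> (y + \<delta> *\<^sub>R d) \<le> b"
      using False by (simp add: inner_add_right field_simps)
    then show ?thesis using small[OF \<delta>(1,2)] \<delta>(1) r by (intro exI[of _ \<delta>]) auto
  qed
qed

section \<open>Stratified families of convex sets\<close>

lemma rel_interior_finite_INT:
  fixes C :: "'k \<Rightarrow> 'a::euclidean_space set"
  assumes "finite K" "convex E" "v \<in> rel_interior E"
    and "\<And>k. k \<in> K \<Longrightarrow> convex (C k)" "\<And>k. k \<in> K \<Longrightarrow> v \<in> rel_interior (C k)"
  shows "v \<in> rel_interior (E \<inter> (\<Inter>k\<in>K. C k))"
proof -
  let ?F = "insert E (C ` K)"
  have v: "v \<in> \<Inter>(rel_interior ` ?F)" using assms by auto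
  have "rel_interior (\<Inter>?F) = \<Inter>(rel_interior ` ?F)"
    by (rule convex_rel_interior_finite_Inter) (use assms v in auto)
  then show ?thesis using v by simp
qed

lemma rel_interior_Int_mem:
  fixes A B :: "'a::euclidean_space set"
  assumes "convex A" "convex B" "v \<in> rel_interior A" "v \<in> rel_interior B"
  shows "v \<in> rel_interior (A \<inter> B)"
  using rel_interior_finite_INT[of "{()}" A v "\<lambda>_. B"] assms by simp

lemma rel_interior_prolong:
  fixes S :: "'a::euclidean_space set"
  assumes "convex S" "p \<in> rel_interior S" "q \<in> S"
  obtains r \<mu> where "r \<in> S" "0 < \<mu>" "\<mu> < 1" "p = \<mu> *\<^sub>R q + (1 - \<mu>) *\<^sub>R r"
proof -
  have "S \<noteq> {}" using assms(3) by auto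
  then obtain e where e: "e > 1" "(1 - e) *\<^sub>R q + e *\<^sub>R p \<in> S"
    using convex_rel_interior_iff[OF assms(1), of p] assms(2,3) by blast
  have "p = (1 - 1 / e) *\<^sub>R q + (1 - (1 - 1 / e)) *\<^sub>R ((1 - e) *\<^sub>R q + e *\<^sub>R p)"
    using e(1) by (simp add: scaleR_add_right scaleR_left_diff_distrib scaleR_right_diff_distrib)
  then show thesis using that[of "(1 - e) *\<^sub>R q + e *\<^sub>R p" "1 - 1 / e"] e by auto
qed

text \<open>From a point of \<open>A\<close> in the relative interior of \<open>B\<close>, a segment through \<open>x\<close> can be prolonged
  inside \<open>A\<close>; so \<open>x\<close> is a proper convex combination of that point and a point of \<open>B\<close>.\<close>

lemma rel_interior_mono_meeting:
  fixes A B :: "'a::euclidean_space set"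
  assumes "convex A" "convex B" "A \<subseteq> B" "p \<in> A" "p \<in> rel_interior B" "x \<in> rel_interior A"
  shows "x \<in> rel_interior B"
proof -
  obtain r \<mu> where r: "r \<in> A" "0 < \<mu>" "\<mu> < 1" "x = \<mu> *\<^sub>R p + (1 - \<mu>) *\<^sub>R r"
    using rel_interior_prolong[OF assms(1,6,4)] .
  have "r - \<mu> *\<^sub>R (r - p) \<in> rel_interior B"
    by (rule rel_interior_convex_shrink) (use assms r in auto)
  moreover have "r - \<mu> *\<^sub>R (r - p) = x" using r(4) by (simp add: algebra_simps)
  ultimately show ?thesis by simp
qed

text \<open>The substitute for a polyhedral complex in the backward recursion: taking faces, intersections
  and chambers preserves this property, by the calculus of relative interiors.\<close>

definition stratified :: "'a::euclidean_space set set \<Rightarrow> bool" where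
  "stratified \<P> \<longleftrightarrow> finite \<P> \<and> (\<forall>S\<in>\<P>. convex S) \<and>
     (\<forall>S\<in>\<P>. \<forall>p\<in>S. \<exists>S'\<in>\<P>. S' \<subseteq> S \<and> p \<in> rel_interior S')"

lemma stratifiedD:
  assumes "stratified \<P>"
  shows "finite \<P>" "\<And>S. S \<in> \<P> \<Longrightarrow> convex S"
    "\<And>S p. S \<in> \<P> \<Longrightarrow> p \<in> S \<Longrightarrow> \<exists>S'\<in>\<P>. S' \<subseteq> S \<and> p \<in> rel_interior S'"
  using assms unfolding stratified_def by blast+

text \<open>A point outside the relative interior lies on a proper face, which has smaller dimension.\<close>

lemma polyhedron_point_in_rel_interior_of_face:
  fixes P :: "'a::euclidean_space set"
  assumes "polyhedron P" "p \<in> P"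
  shows "\<exists>F. F face_of P \<and> p \<in> rel_interior F"
  using assms
proof (induction "nat (aff_dim P + 1)" arbitrary: P rule: less_induct)
  case less
  show ?case
  proof (cases "p \<in> rel_interior P")
    case True
    then show ?thesis using face_of_refl less.prems(1) polyhedron_imp_convex by blast
  next
    case False
    then have "p \<in> rel_frontier P"
      using less.prems by (simp add: rel_frontier_def polyhedron_imp_closed)
    then obtain F where F: "F face_of P" "F \<noteq> P" "p \<in> F"
      using rel_frontier_of_polyhedron_alt[OF less.prems(1)] by auto
    have "aff_dim F < aff_dim P"
      using F less.prems(1) by (intro face_of_aff_dim_lt) (auto simp: polyhedron_imp_convex)
    moreover have "aff_dim F \<ge> -1" by (rule aff_dim_geq)
    ultimately have "nat (aff_dim F + 1) < nat (aff_dim P + 1)" by linarith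
    moreover have "polyhedron F" using F less.prems(1) face_of_polyhedron_polyhedron by blast
    ultimately obtain G where "G face_of F" "p \<in> rel_interior G"
      using less.hyps F(3) by blast
    then show ?thesis using F(1) face_of_trans by blast
  qed
qed

lemma stratified_face_complex:
  fixes P :: "'a::euclidean_space set"
  assumes P: "polyhedron P"
  shows "stratified (face_complex P)"
  unfolding stratified_def face_complex_def
proof (intro conjI ballI)
  show "finite {F. F face_of P \<and> F \<noteq> {}}"
    by (rule finite_subset[OF _ finite_polyhedron_faces[OF P]]) auto
next
  fix S assume S: "S \<in> {F. F face_of P \<and> F \<noteq> {}}"
  then show "convex S" using face_of_imp_convex by blast
  fix p assume "p \<in> S"
  moreover have "polyhedron S" using S P face_of_polyhedron_polyhedron by blast
  ultimately obtain F where F: "F face_of S" "p \<in> rel_interior F"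
    using polyhedron_point_in_rel_interior_of_face by blast
  moreover have "F face_of P" using F(1) S face_of_trans by blast
  moreover have "F \<noteq> {}" using F(2) rel_interior_subset by blast
  ultimately show "\<exists>S'\<in>{F. F face_of P \<and> F \<noteq> {}}. S' \<subseteq> S \<and> p \<in> rel_interior S'"
    using face_of_imp_subset by blast
qed

lemma stratified_Times_subspace:
  fixes \<P> :: "'b::euclidean_space set set" and E :: "'a::euclidean_space set"
  assumes \<P>: "stratified \<P>" and E: "subspace E"
  shows "stratified {E \<times> \<sigma> | \<sigma>. \<sigma> \<in> \<P>}"
proof -
  have cE: "convex E" "rel_interior E = E"
    using E subspace_imp_convex subspace_imp_affine rel_interior_affine by auto
  have "{E \<times> \<sigma> | \<sigma>. \<sigma> \<in> \<P>} = (\<lambda>\<sigma>. E \<times> \<sigma>) ` \<P>" by auto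
  moreover have "stratified ((\<lambda>\<sigma>. E \<times> \<sigma>) ` \<P>)"
    unfolding stratified_def
  proof (intro conjI ballI)
    show "finite ((\<lambda>\<sigma>. E \<times> \<sigma>) ` \<P>)" using stratifiedD(1)[OF \<P>] by simp
    fix S assume "S \<in> (\<lambda>\<sigma>. E \<times> \<sigma>) ` \<P>"
    then obtain \<sigma> where \<sigma>: "\<sigma> \<in> \<P>" "S = E \<times> \<sigma>" by blast
    show "convex S" using \<sigma> cE stratifiedD(2)[OF \<P>] by (simp add: convex_Times)
    fix p assume p: "p \<in> S"
    then obtain \<sigma>' where \<sigma>': "\<sigma>' \<in> \<P>" "\<sigma>' \<subseteq> \<sigma>" "snd p \<in> rel_interior \<sigma>'"
      using stratifiedD(3)[OF \<P> \<sigma>(1), of "snd p"] \<sigma>(2) by auto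
    have "p \<in> rel_interior (E \<times> \<sigma>')"
      using \<sigma>' p \<sigma>(2) cE stratifiedD(2)[OF \<P>] by (auto simp: rel_interior_Times)
    then show "\<exists>S'\<in>(\<lambda>\<sigma>. E \<times> \<sigma>) ` \<P>. S' \<subseteq> S \<and> p \<in> rel_interior S'"
      using \<sigma>' \<sigma>(2) by (intro bexI[of _ "E \<times> \<sigma>'"]) auto
  qed
  ultimately show ?thesis by simp
qed

lemma stratified_meet:
  fixes \<P> \<R> :: "'a::euclidean_space set set"
  assumes "stratified \<P>" "stratified \<R>"
  shows "stratified (meet \<P> \<R>)"
  unfolding stratified_def
proof (intro conjI ballI)
  have "meet \<P> \<R> = (\<lambda>(X, Y). X \<inter> Y) ` (\<P> \<times> \<R>)" by (auto simp: meet_def)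
  then show "finite (meet \<P> \<R>)" using assms by (simp add: stratified_def)
  fix S assume "S \<in> meet \<P> \<R>"
  then obtain X Y where XY: "X \<in> \<P>" "Y \<in> \<R>" "S = X \<inter> Y" by (auto simp: meet_def)
  show "convex S" using XY assms by (simp add: stratified_def convex_Int)
  fix p assume "p \<in> S"
  then have p: "p \<in> X" "p \<in> Y" using XY(3) by auto
  obtain X' where X': "X' \<in> \<P>" "X' \<subseteq> X" "p \<in> rel_interior X'"
    using stratifiedD(3)[OF assms(1) XY(1) p(1)] by blast
  obtain Y' where Y': "Y' \<in> \<R>" "Y' \<subseteq> Y" "p \<in> rel_interior Y'"
    using stratifiedD(3)[OF assms(2) XY(2) p(2)] by blast
  have "p \<in> rel_interior (X' \<inter> Y')"
    using X' Y' stratifiedD(2)[OF assms(1)] stratifiedD(2)[OF assms(2)]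
    by (intro rel_interior_Int_mem) auto
  moreover have "X' \<inter> Y' \<in> meet \<P> \<R>" using X' Y' by (auto simp: meet_def)
  ultimately show "\<exists>S'\<in>meet \<P> \<R>. S' \<subseteq> S \<and> p \<in> rel_interior S'"
    using X'(2) Y'(2) XY(3) by (intro bexI[of _ "X' \<inter> Y'"]) auto
qed

lemma finite_big_meet:
  assumes "finite K" "\<And>k. k \<in> K \<Longrightarrow> finite (C k)"
  shows "finite (big_meet E K C)"
proof -
  have "big_meet E K C \<subseteq> (\<lambda>f. E \<inter> (\<Inter>k\<in>K. f k)) ` (Pi\<^sub>E K C)"
  proof
    fix X assume "X \<in> big_meet E K C"
    then obtain f where f: "X = E \<inter> (\<Inter>k\<in>K. f k)" "\<forall>k\<in>K. f k \<in> C k"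
      by (auto simp: big_meet_def)
    have "X = E \<inter> (\<Inter>k\<in>K. restrict f K k)" using f(1) by simp
    moreover have "restrict f K \<in> Pi\<^sub>E K C" using f(2) by auto
    ultimately show "X \<in> (\<lambda>f. E \<inter> (\<Inter>k\<in>K. f k)) ` (Pi\<^sub>E K C)" by blast
  qed
  moreover have "finite (Pi\<^sub>E K C)" using assms by (intro finite_PiE) auto
  ultimately show ?thesis by (rule finite_surj[rotated])
qed

lemma Union_big_meet: "\<Union>(big_meet E K C) = E \<inter> (\<Inter>k\<in>K. \<Union>(C k))"
proof
  show "E \<inter> (\<Inter>k\<in>K. \<Union>(C k)) \<subseteq> \<Union>(big_meet E K C)"
  proof
    fix x assume x: "x \<in> E \<inter> (\<Inter>k\<in>K. \<Union>(C k))"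
    then have "\<forall>k\<in>K. \<exists>X. X \<in> C k \<and> x \<in> X" by auto
    then obtain f where "\<forall>k\<in>K. f k \<in> C k \<and> x \<in> f k" by (metis bchoice)
    then have "E \<inter> (\<Inter>k\<in>K. f k) \<in> big_meet E K C" "x \<in> E \<inter> (\<Inter>k\<in>K. f k)"
      using x by (auto simp: big_meet_def)
    then show "x \<in> \<Union>(big_meet E K C)" by (rule UnionI)
  qed
  show "\<Union>(big_meet E K C) \<subseteq> E \<inter> (\<Inter>k\<in>K. \<Union>(C k))"
  proof
    fix x assume "x \<in> \<Union>(big_meet E K C)"
    then obtain f where "x \<in> E" "\<forall>k\<in>K. x \<in> f k" "\<forall>k\<in>K. f k \<in> C k"
      by (auto simp: big_meet_def)
    then show "x \<in> E \<inter> (\<Inter>k\<in>K. \<Union>(C k))" by auto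
  qed
qed

lemma stratified_big_meet:
  fixes C :: "'k \<Rightarrow> 'a::euclidean_space set set"
  assumes K: "finite K" and E: "subspace E" and C: "\<And>k. k \<in> K \<Longrightarrow> stratified (C k)"
  shows "stratified (big_meet E K C)"
  unfolding stratified_def
proof (intro conjI ballI)
  have cE: "convex E" "rel_interior E = E"
    using E subspace_imp_convex subspace_imp_affine rel_interior_affine by auto
  show "finite (big_meet E K C)"
    using K C by (intro finite_big_meet) (auto simp: stratified_def)
  fix S assume "S \<in> big_meet E K C"
  then obtain f where f: "S = E \<inter> (\<Inter>k\<in>K. f k)" "\<forall>k\<in>K. f k \<in> C k"
    by (auto simp: big_meet_def)
  have cf: "convex (f k)" if "k \<in> K" for k
    using f(2) that stratifiedD(2)[OF C[OF that]] by blast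
  show "convex S" unfolding f(1) using cE cf by (intro convex_Int convex_INT) auto
  fix p assume p: "p \<in> S"
  have "\<forall>k\<in>K. \<exists>X. X \<in> C k \<and> X \<subseteq> f k \<and> p \<in> rel_interior X"
  proof
    fix k assume k: "k \<in> K"
    then have "f k \<in> C k" "p \<in> f k" using f p by auto
    then show "\<exists>X. X \<in> C k \<and> X \<subseteq> f k \<and> p \<in> rel_interior X"
      using stratifiedD(3)[OF C[OF k], of "f k" p] by blast
  qed
  then obtain g where g: "\<forall>k\<in>K. g k \<in> C k \<and> g k \<subseteq> f k \<and> p \<in> rel_interior (g k)"
    by (metis bchoice)
  have "p \<in> rel_interior (E \<inter> (\<Inter>k\<in>K. g k))"
  proof (rule rel_interior_finite_INT[OF K cE(1)])
    show "p \<in> rel_interior E" using p f(1) cE(2) by simp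
    show "convex (g k)" "p \<in> rel_interior (g k)" if "k \<in> K" for k
      using g that stratifiedD(2)[OF C[OF that]] by auto
  qed
  moreover have "E \<inter> (\<Inter>k\<in>K. g k) \<in> big_meet E K C" using g by (auto simp: big_meet_def)
  moreover have "E \<inter> (\<Inter>k\<in>K. g k) \<subseteq> S" using g f(1) by blast
  ultimately show "\<exists>S'\<in>big_meet E K C. S' \<subseteq> S \<and> p \<in> rel_interior S'" by blast
qed

text \<open>Every cell over \<open>x\<close> contains a cell whose relative interior meets the fiber over \<open>x\<close>, so that
  the chamber of \<open>x\<close> is an intersection of projections that all have \<open>x\<close> in their relative
  interior.\<close>

lemma stratified_chamber_complex:
  fixes \<Q> :: "'a::euclidean_space set set" and \<pi> :: "'a \<Rightarrow> 'b::euclidean_space"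
  assumes \<Q>: "stratified \<Q>" and \<pi>: "linear \<pi>"
  shows "stratified (chamber_complex \<Q> \<pi>)"
  unfolding stratified_def
proof (intro conjI ballI)
  have fin: "finite {\<pi> ` F | F. F \<in> \<Q> \<and> R F}" for R :: "'a set \<Rightarrow> bool"
    using stratifiedD(1)[OF \<Q>] by simp
  have "chamber_complex \<Q> \<pi> \<subseteq> Inter ` Pow ((`) \<pi> ` \<Q>)"
    unfolding chamber_complex_def chamber_def by blast
  then show "finite (chamber_complex \<Q> \<pi>)"
    using stratifiedD(1)[OF \<Q>] by (meson finite_Pow_iff finite_imageI finite_subset)
  fix S assume "S \<in> chamber_complex \<Q> \<pi>"
  then obtain x0 where x0: "x0 \<in> \<pi> ` \<Union>\<Q>" "S = chamber \<Q> \<pi> x0"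
    by (auto simp: chamber_complex_def)
  have cvx: "convex (\<pi> ` F)" if "F \<in> \<Q>" for F
    using that \<pi> stratifiedD(2)[OF \<Q>] convex_linear_image by blast
  show "convex S" unfolding x0(2) chamber_def using cvx by (intro convex_Inter) auto
  fix x assume x: "x \<in> S"
  obtain F0 where F0: "F0 \<in> \<Q>" "x0 \<in> \<pi> ` F0" using x0(1) by auto
  have xF0: "x \<in> \<pi> ` F0" using x F0 unfolding x0(2) chamber_def by blast
  have "chamber \<Q> \<pi> x \<subseteq> S" using x unfolding x0(2) chamber_def by blast
  moreover have "chamber \<Q> \<pi> x \<in> chamber_complex \<Q> \<pi>"
    using xF0 F0(1) unfolding chamber_complex_def by blast
  moreover have "x \<in> rel_interior (chamber \<Q> \<pi> x)"
  proof -
    define \<A> where "\<A> = {\<pi> ` F | F. F \<in> \<Q> \<and> x \<in> \<pi> ` rel_interior F}"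
    have ri: "\<pi> ` rel_interior F = rel_interior (\<pi> ` F)" if "F \<in> \<Q>" for F
      using that \<pi> stratifiedD(2)[OF \<Q>] by (simp add: rel_interior_convex_linear_image)
    have "chamber \<Q> \<pi> x = \<Inter>\<A>"
    proof
      show "chamber \<Q> \<pi> x \<subseteq> \<Inter>\<A>"
        unfolding chamber_def \<A>_def using rel_interior_subset by blast
      show "\<Inter>\<A> \<subseteq> chamber \<Q> \<pi> x"
        unfolding chamber_def
      proof (intro Inter_greatest)
        fix X assume "X \<in> {\<pi> ` F | F. F \<in> \<Q> \<and> x \<in> \<pi> ` F}"
        then obtain F p where F: "X = \<pi> ` F" "F \<in> \<Q>" "p \<in> F" "x = \<pi> p" by blast
        then obtain F' where "F' \<in> \<Q>" "F' \<subseteq> F" "p \<in> rel_interior F'"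
          using stratifiedD(3)[OF \<Q>] by blast
        then have "\<pi> ` F' \<in> \<A>" "\<pi> ` F' \<subseteq> X" unfolding \<A>_def using F by blast+
        then show "\<Inter>\<A> \<subseteq> X" by blast
      qed
    qed
    moreover have "x \<in> rel_interior (UNIV \<inter> (\<Inter>X\<in>\<A>. X))"
    proof (rule rel_interior_finite_INT)
      show "finite \<A>" unfolding \<A>_def by (rule fin)
    qed (use ri cvx in \<open>auto simp: \<A>_def\<close>)
    ultimately show ?thesis by simp
  qed
  ultimately show "\<exists>S'\<in>chamber_complex \<Q> \<pi>. S' \<subseteq> S \<and> x \<in> rel_interior S'" by blast
qed

lemma Union_chamber_complex: "\<Union>(chamber_complex \<Q> \<pi>) = \<pi> ` \<Union>\<Q>"
proof
  show "\<Union>(chamber_complex \<Q> \<pi>) \<subseteq> \<pi> ` \<Union>\<Q>"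
  proof
    fix x assume "x \<in> \<Union>(chamber_complex \<Q> \<pi>)"
    then obtain x0 where x0: "x0 \<in> \<pi> ` \<Union>\<Q>" "x \<in> chamber \<Q> \<pi> x0"
      by (auto simp: chamber_complex_def)
    then obtain F where F: "F \<in> \<Q>" "x0 \<in> \<pi> ` F" by blast
    then have "x \<in> \<pi> ` F" using x0(2) unfolding chamber_def by blast
    then show "x \<in> \<pi> ` \<Union>\<Q>" using F(1) by blast
  qed
  show "\<pi> ` \<Union>\<Q> \<subseteq> \<Union>(chamber_complex \<Q> \<pi>)"
    unfolding chamber_complex_def chamber_def by blast
qed

section \<open>Fans\<close>

text \<open>For a fan, each vector of the support lies in the relative interior of a cone that is a face
  of every cone containing the vector; so the relative interiors partition the support.\<close>

definition face_stratified :: "'a::euclidean_space set set \<Rightarrow> bool" where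
  "face_stratified \<N> \<longleftrightarrow> finite \<N> \<and> (\<forall>N\<in>\<N>. convex N) \<and>
     (\<forall>v\<in>\<Union>\<N>. \<exists>G\<in>\<N>. v \<in> rel_interior G \<and> (\<forall>H\<in>\<N>. v \<in> H \<longrightarrow> G face_of H))"

lemma face_stratifiedD:
  assumes "face_stratified \<N>"
  shows "finite \<N>" "\<And>N. N \<in> \<N> \<Longrightarrow> convex N"
    "\<And>v. v \<in> \<Union>\<N> \<Longrightarrow> \<exists>G\<in>\<N>. v \<in> rel_interior G \<and> (\<forall>H\<in>\<N>. v \<in> H \<longrightarrow> G face_of H)"
  using assms unfolding face_stratified_def by blast+

text \<open>A face that contains a relative interior point is the whole set; so two cones with a common
  relative interior point both coincide with their distinguished common face.\<close>

lemma face_stratified_unique: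
  assumes \<N>: "face_stratified \<N>" and "A \<in> \<N>" "B \<in> \<N>" "v \<in> rel_interior A" "v \<in> rel_interior B"
  shows "A = B"
proof -
  have "v \<in> A" "v \<in> B" using assms rel_interior_subset by blast+
  then obtain G where "G \<in> \<N>" "v \<in> rel_interior G" "G face_of A" "G face_of B"
    using face_stratifiedD(3)[OF \<N>, of v] assms(2,3) by blast
  then show ?thesis
    using face_of_disjoint_rel_interior[of G] assms(4,5) rel_interior_subset by blast
qed

text \<open>A fan that contains another one with the same support has no further cones: a further cone
  would have its relative interior covered by those of the smaller fan.\<close>

lemma face_stratified_eqI:
  assumes A: "face_stratified \<A>" and B: "face_stratified \<B>" and sub: "\<A> \<subseteq> \<B>"
    and supp: "\<Union>\<B> \<subseteq> \<Union>\<A>" and ne: "{} \<notin> \<B>"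
  shows "\<A> = \<B>"
proof
  show "\<B> \<subseteq> \<A>"
  proof
    fix N assume N: "N \<in> \<B>"
    then obtain v where v: "v \<in> rel_interior N"
      using ne face_stratifiedD(2)[OF B] rel_interior_eq_empty by (metis ex_in_conv)
    then have "v \<in> \<Union>\<A>" using N supp rel_interior_subset by blast
    then obtain G where "G \<in> \<A>" "v \<in> rel_interior G" using face_stratifiedD(3)[OF A] by blast
    then show "N \<in> \<A>" using face_stratified_unique[OF B N _ v] sub by blast
  qed
qed fact

lemma face_of_INT_INT:
  assumes "\<And>k. k \<in> K \<Longrightarrow> (G k) face_of (H k)" "convex E"
  shows "(E \<inter> (\<Inter>k\<in>K. G k)) face_of (E \<inter> (\<Inter>k\<in>K. H k))"
proof -
  define A where "A = E \<inter> (\<Inter>k\<in>K. G k)"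
  define B where "B = E \<inter> (\<Inter>k\<in>K. H k)"
  have "convex A"
    unfolding A_def using assms by (intro convex_Int convex_INT) (auto dest: face_of_imp_convex)
  moreover have "A \<subseteq> B"
    unfolding A_def B_def using face_of_imp_subset[OF assms(1)] by blast
  moreover have "a \<in> A \<and> b \<in> A"
    if "a \<in> B" "b \<in> B" "x \<in> A" "x \<in> open_segment a b" for a b x
  proof -
    have "a \<in> G k \<and> b \<in> G k" if k: "k \<in> K" for k
      using \<open>a \<in> B\<close> \<open>b \<in> B\<close> \<open>x \<in> A\<close> k unfolding A_def B_def
      by (intro face_ofD[OF assms(1)[OF k] \<open>x \<in> open_segment a b\<close>]) auto
    then show ?thesis using that unfolding A_def B_def by blast
  qed
  ultimately have "A face_of B" unfolding face_of_def by blast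
  then show ?thesis unfolding A_def B_def .
qed

text \<open>The distinguished cones of the single fans intersect in the distinguished cone of the common
  refinement, because relative interiors and faces are compatible with intersections.\<close>

lemma face_stratified_big_meet:
  fixes C :: "'k \<Rightarrow> 'a::euclidean_space set set"
  assumes K: "finite K" and E: "subspace E" and C: "\<And>k. k \<in> K \<Longrightarrow> face_stratified (C k)"
  shows "face_stratified (big_meet E K C)"
  unfolding face_stratified_def
proof (intro conjI ballI)
  have cE: "convex E" "rel_interior E = E"
    using E subspace_imp_convex subspace_imp_affine rel_interior_affine by auto
  show "finite (big_meet E K C)"
    using K C by (intro finite_big_meet) (auto simp: face_stratified_def)
  show "convex N" if N: "N \<in> big_meet E K C" for N
  proof -
    obtain f where f: "N = E \<inter> (\<Inter>k\<in>K. f k)" "\<forall>k\<in>K. f k \<in> C k"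
      using N unfolding big_meet_def by blast
    have "convex (f k)" if "k \<in> K" for k using f(2) that face_stratifiedD(2)[OF C[OF that]] by blast
    then show ?thesis unfolding f(1) using cE by (intro convex_Int convex_INT) auto
  qed
  fix v assume "v \<in> \<Union>(big_meet E K C)"
  then have v: "v \<in> E" "\<And>k. k \<in> K \<Longrightarrow> v \<in> \<Union>(C k)" by (auto simp: Union_big_meet)
  have "\<forall>k\<in>K. \<exists>G. G \<in> C k \<and> v \<in> rel_interior G \<and> (\<forall>H\<in>C k. v \<in> H \<longrightarrow> G face_of H)"
    using v(2) face_stratifiedD(3)[OF C] by blast
  then obtain G where G: "\<forall>k\<in>K. G k \<in> C k \<and> v \<in> rel_interior (G k) \<and>
      (\<forall>H\<in>C k. v \<in> H \<longrightarrow> G k face_of H)"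
    by (metis bchoice)
  show "\<exists>G\<in>big_meet E K C. v \<in> rel_interior G \<and>
      (\<forall>H\<in>big_meet E K C. v \<in> H \<longrightarrow> G face_of H)"
  proof (intro bexI conjI ballI impI)
    show "v \<in> rel_interior (E \<inter> (\<Inter>k\<in>K. G k))"
    proof (rule rel_interior_finite_INT[OF K cE(1)])
      show "v \<in> rel_interior E" using v(1) cE(2) by simp
      show "convex (G k)" "v \<in> rel_interior (G k)" if "k \<in> K" for k
        using G that face_stratifiedD(2)[OF C[OF that]] by auto
    qed
    show "E \<inter> (\<Inter>k\<in>K. G k) \<in> big_meet E K C" using G by (auto simp: big_meet_def)
    fix H assume H: "H \<in> big_meet E K C" "v \<in> H"
    then obtain f where f: "H = E \<inter> (\<Inter>k\<in>K. f k)" "\<forall>k\<in>K. f k \<in> C k"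
      by (auto simp: big_meet_def)
    show "(E \<inter> (\<Inter>k\<in>K. G k)) face_of H"
      unfolding f(1)
    proof (rule face_of_INT_INT)
      fix k assume k: "k \<in> K"
      then have "v \<in> f k" using H(2) f(1) by blast
      then show "G k face_of f k" using G f(2) k by blast
    qed (rule cE)
  qed
qed

lemma face_stratified_negations:
  fixes \<N> :: "'a::euclidean_space set set"
  assumes \<N>: "face_stratified \<N>"
  shows "face_stratified {uminus ` N | N. N \<in> \<N>}"
proof -
  have lin: "linear (uminus :: 'a \<Rightarrow> 'a)" "inj (uminus :: 'a \<Rightarrow> 'a)"
    by (auto simp: linear_iff)
  have ri: "rel_interior (uminus ` N) = uminus ` rel_interior N" for N :: "'a set"
    by (rule rel_interior_injective_linear_image)
       (use lin in \<open>auto simp: linear_conv_bounded_linear\<close>)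
  have "{uminus ` N | N. N \<in> \<N>} = (`) uminus ` \<N>" by blast
  moreover have "face_stratified ((`) uminus ` \<N>)"
    unfolding face_stratified_def
  proof (intro conjI ballI)
    show "finite ((`) uminus ` \<N>)" using face_stratifiedD(1)[OF \<N>] by simp
    show "convex N" if "N \<in> (`) uminus ` \<N>" for N
      using that face_stratifiedD(2)[OF \<N>] convex_linear_image[OF lin(1)] by blast
    fix v assume "v \<in> \<Union>((`) uminus ` \<N>)"
    then have "- v \<in> \<Union>\<N>" by auto
    then obtain G where G: "G \<in> \<N>" "- v \<in> rel_interior G"
        "\<forall>H\<in>\<N>. - v \<in> H \<longrightarrow> G face_of H"
      using face_stratifiedD(3)[OF \<N>] by blast
    have "v \<in> rel_interior (uminus ` G)" unfolding ri using G(2) by (metis image_eqI minus_minus)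
    moreover have "uminus ` G face_of uminus ` H" if "H \<in> \<N>" "v \<in> uminus ` H" for H
      using that G(3) face_of_linear_image[OF lin] by auto
    ultimately show "\<exists>G\<in>(`) uminus ` \<N>. v \<in> rel_interior G \<and>
        (\<forall>H\<in>(`) uminus ` \<N>. v \<in> H \<longrightarrow> G face_of H)"
      using G(1) by (intro bexI[of _ "uminus ` G"]) auto
  qed
  ultimately show ?thesis by simp
qed

lemma convex_normal_cone:
  fixes C :: "'a::euclidean_space set"
  assumes "subspace E"
  shows "convex (normal_cone E C y)"
proof -
  have "normal_cone E C y = E \<inter> (\<Inter>w\<in>C. {\<alpha>. (w - y) \<bullet> \<alpha> \<le> 0})"
    by (auto simp: normal_cone_def inner_commute)
  then show ?thesis
    using assms by (simp add: convex_Int convex_INT convex_halfspace_le subspace_imp_convex)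
qed

text \<open>Each constraint active at \<open>y\<close> is a normal there. So a direction that supports the normal cone
  at \<open>v\<close> is feasible at \<open>y\<close>; it stays in the face on which \<open>v\<close> is maximal, and since \<open>y\<close> is in the
  relative interior of this face, the opposite direction is feasible too. So it is orthogonal to
  the whole cone, whereas at a relative boundary point some supporting direction is not.\<close>

lemma mem_rel_interior_normal_cone:
  fixes C :: "'a::euclidean_space set"
  assumes C: "polyhedron C" and E: "subspace E" and v: "v \<in> normal_cone E C y"
    and y: "y \<in> rel_interior {p\<in>C. v \<bullet> p = v \<bullet> y}"
  shows "v \<in> rel_interior (normal_cone E C y)"
proof -
  let ?F = "{p\<in>C. v \<bullet> p = v \<bullet> y}"
  let ?N = "normal_cone UNIV C y"
  obtain S :: "('a \<times> real) set" where S: "finite S" "C = {x. \<forall>(a, b) \<in> S. a \<bullet> x \<le> b}"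
    by (rule polyhedronE_inequalities[OF C])
  have yC: "y \<in> C" using y rel_interior_subset by blast
  have cvxN: "convex ?N" by (simp add: convex_normal_cone)
  have vN: "v \<in> ?N" using v by (simp add: normal_cone_def)
  have cone: "r *\<^sub>R u \<in> ?N" if "u \<in> ?N" "r \<ge> 0" for u r
    using that by (auto simp: normal_cone_def mult_nonneg_nonpos)
  have F: "convex ?F"
  proof -
    have "?F = C \<inter> {p. v \<bullet> p = v \<bullet> y}" by auto
    then show ?thesis using C by (simp add: convex_Int polyhedron_imp_convex convex_hyperplane)
  qed
  have "v \<in> rel_interior ?N"
  proof (rule ccontr)
    assume "v \<notin> rel_interior ?N"
    then obtain a where a: "\<And>u. u \<in> ?N \<Longrightarrow> a \<bullet> v \<le> a \<bullet> u"
        "\<And>u. u \<in> rel_interior ?N \<Longrightarrow> a \<bullet> v < a \<bullet> u"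
      using supporting_hyperplane_rel_boundary[OF cvxN vN] by metis
    have av: "a \<bullet> v = 0"
    proof -
      have "a \<bullet> v \<le> a \<bullet> (0 *\<^sub>R v)" "a \<bullet> v \<le> a \<bullet> (2 *\<^sub>R v)"
        using a(1)[OF cone[OF vN, of 0]] a(1)[OF cone[OF vN, of 2]] by simp_all
      then show ?thesis by simp
    qed
    have "\<exists>\<epsilon>>0. \<forall>(a', b)\<in>S. a' \<bullet> (y + \<epsilon> *\<^sub>R (- a)) \<le> b"
    proof (rule polyhedron_feasible_direction[OF S(1)])
      show "\<forall>(a, b)\<in>S. a \<bullet> y \<le> b" using yC S(2) by blast
      fix a' b assume ab: "(a', b) \<in> S" "a' \<bullet> y = b"
      then have "a' \<in> ?N" using S(2) by (auto simp: normal_cone_def inner_diff_right)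
      then show "a' \<bullet> (- a) \<le> 0" using a(1) av by (fastforce simp: inner_commute)
    qed
    then obtain \<epsilon> where \<epsilon>: "\<epsilon> > 0" "y + \<epsilon> *\<^sub>R (- a) \<in> C" using S(2) by auto
    then have "y + \<epsilon> *\<^sub>R (- a) \<in> ?F"
      using av by (simp add: inner_diff_right inner_commute)
    then obtain r \<mu> where r: "r \<in> ?F" "0 < \<mu>" "\<mu> < 1"
        "y = \<mu> *\<^sub>R (y + \<epsilon> *\<^sub>R (- a)) + (1 - \<mu>) *\<^sub>R r"
      using rel_interior_prolong[OF F y] by blast
    have "(1 - \<mu>) *\<^sub>R (r - y) = (\<mu> * \<epsilon>) *\<^sub>R a"
    proof -
      have "(1 - \<mu>) *\<^sub>R (r - y) = (1 - \<mu>) *\<^sub>R r - y + \<mu> *\<^sub>R y" by (simp add: algebra_simps)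
      also have "\<dots> = (1 - \<mu>) *\<^sub>R r - (\<mu> *\<^sub>R (y + \<epsilon> *\<^sub>R (- a)) + (1 - \<mu>) *\<^sub>R r) + \<mu> *\<^sub>R y"
        using r(4) by simp
      also have "\<dots> = (\<mu> * \<epsilon>) *\<^sub>R a" by (simp add: algebra_simps)
      finally show ?thesis .
    qed
    then have eq: "(1 - \<mu>) * (u \<bullet> (r - y)) = (\<mu> * \<epsilon>) * (u \<bullet> a)" for u
      by (metis inner_scaleR_right)
    obtain u where u: "u \<in> rel_interior ?N"
      using vN cvxN rel_interior_eq_empty by blast
    have "u \<bullet> (r - y) \<le> 0" using u r(1) rel_interior_subset by (fastforce simp: normal_cone_def)
    then have "(\<mu> * \<epsilon>) * (u \<bullet> a) \<le> 0" using eq[of u] r(3) by (metis diff_gt_0_iff_gt less_eq_real_def mult_nonneg_nonpos)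
    moreover have "u \<bullet> a > 0" using a(2)[OF u] av by (simp add: inner_commute)
    ultimately show False using r(2) \<epsilon>(1) by (simp add: mult_le_0_iff)
  qed
  moreover have "v \<in> rel_interior E"
    using v E subspace_imp_affine rel_interior_affine by (fastforce simp: normal_cone_def)
  moreover have "normal_cone E C y = E \<inter> ?N" by (auto simp: normal_cone_def)
  ultimately show ?thesis
    using rel_interior_Int_mem[OF subspace_imp_convex[OF E] cvxN] by simp
qed

text \<open>A normal cone depends only on the set of active constraints, which leaves finitely many.\<close>

lemma finite_normal_fan:
  fixes C :: "'a::euclidean_space set"
  assumes C: "polyhedron C"
  shows "finite (normal_fan E C)"
proof -
  obtain S :: "('a \<times> real) set" where S: "finite S" "C = {x. \<forall>(a, b) \<in> S. a \<bullet> x \<le> b}"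
    by (rule polyhedronE_inequalities[OF C])
  define act where "act y = {(a, b)\<in>S. a \<bullet> y = b}" for y
  have sub: "normal_cone E C y \<subseteq> normal_cone E C y'"
    if "y \<in> C" "y' \<in> C" "act y = act y'" for y y'
  proof
    fix \<alpha> assume \<alpha>: "\<alpha> \<in> normal_cone E C y"
    have "\<alpha> \<bullet> (w - y') \<le> 0" if w: "w \<in> C" for w
    proof -
      have "\<exists>\<epsilon>>0. \<forall>(a, b)\<in>S. a \<bullet> (y + \<epsilon> *\<^sub>R (w - y')) \<le> b"
      proof (rule polyhedron_feasible_direction[OF S(1)])
        show "\<forall>(a, b)\<in>S. a \<bullet> y \<le> b" using \<open>y \<in> C\<close> S(2) by blast
        fix a b assume "(a, b) \<in> S" "a \<bullet> y = b"
        then have "a \<bullet> y' = b" using \<open>act y = act y'\<close> by (auto simp: act_def)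
        then show "a \<bullet> (w - y') \<le> 0"
          using w \<open>(a, b) \<in> S\<close> S(2) by (auto simp: inner_diff_right)
      qed
      then obtain \<epsilon> where \<epsilon>: "\<epsilon> > 0" "y + \<epsilon> *\<^sub>R (w - y') \<in> C" using S(2) by auto
      then have "\<alpha> \<bullet> (y + \<epsilon> *\<^sub>R (w - y') - y) \<le> 0" using \<alpha> by (auto simp: normal_cone_def)
      then show ?thesis using \<epsilon>(1) by (simp add: mult_le_0_iff)
    qed
    then show "\<alpha> \<in> normal_cone E C y'" using \<alpha> by (simp add: normal_cone_def)
  qed
  then have eq: "normal_cone E C y = normal_cone E C y'"
    if "y \<in> C" "y' \<in> C" "act y = act y'" for y y' using that by (metis subset_antisym)
  define rep where "rep A = normal_cone E C (SOME y. y \<in> C \<and> act y = A)" for A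
  have "normal_fan E C \<subseteq> rep ` Pow S"
  proof
    fix N assume "N \<in> normal_fan E C"
    then obtain y where y: "y \<in> C" "N = normal_cone E C y" by (auto simp: normal_fan_def)
    let ?y = "SOME y'. y' \<in> C \<and> act y' = act y"
    have "?y \<in> C \<and> act ?y = act y" by (rule someI[of _ y]) (use y in simp)
    then have "N = rep (act y)" using y eq unfolding rep_def by blast
    moreover have "act y \<in> Pow S" by (auto simp: act_def)
    ultimately show "N \<in> rep ` Pow S" by blast
  qed
  then show ?thesis using S(1) by (meson finite_Pow_iff finite_imageI finite_subset)
qed

text \<open>The distinguished cone of \<open>v\<close> is the normal cone at a relative interior point \<open>y0\<close> of the face
  on which \<open>v\<close> is maximal. In the normal cone at any other point \<open>y1\<close> of that face it is cut out by
  the supporting hyperplane orthogonal to \<open>y0 - y1\<close>.\<close>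

lemma face_stratified_normal_fan:
  fixes C :: "'a::euclidean_space set"
  assumes C: "polyhedron C" and E: "subspace E"
  shows "face_stratified (normal_fan E C)"
  unfolding face_stratified_def
proof (intro conjI ballI)
  show "finite (normal_fan E C)" using C by (rule finite_normal_fan)
  show "convex N" if "N \<in> normal_fan E C" for N
    using that convex_normal_cone[OF E] by (auto simp: normal_fan_def)
  fix v assume "v \<in> \<Union>(normal_fan E C)"
  then obtain y where y: "y \<in> C" "v \<in> normal_cone E C y" by (auto simp: normal_fan_def)
  define F where "F = {p\<in>C. v \<bullet> p = v \<bullet> y}"
  have F: "convex F"
  proof -
    have "F = C \<inter> {p. v \<bullet> p = v \<bullet> y}" by (auto simp: F_def)
    then show ?thesis using C by (simp add: convex_Int polyhedron_imp_convex convex_hyperplane)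
  qed
  moreover have "y \<in> F" using y by (simp add: F_def)
  ultimately obtain y0 where y0: "y0 \<in> rel_interior F" using rel_interior_eq_empty by blast
  have y0F: "y0 \<in> C" "v \<bullet> y0 = v \<bullet> y" using y0 rel_interior_subset by (fastforce simp: F_def)+
  have vy0: "v \<in> normal_cone E C y0"
    using y(2) y0F(2) by (auto simp: normal_cone_def inner_diff_right)
  let ?G = "normal_cone E C y0"
  show "\<exists>G\<in>normal_fan E C. v \<in> rel_interior G \<and> (\<forall>H\<in>normal_fan E C. v \<in> H \<longrightarrow> G face_of H)"
  proof (intro bexI conjI ballI impI)
    show "?G \<in> normal_fan E C" using y0F by (simp add: normal_fan_def)
    show "v \<in> rel_interior ?G"
      by (rule mem_rel_interior_normal_cone[OF C E vy0]) (use y0 y0F(2) F_def in simp)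
    fix H assume H: "H \<in> normal_fan E C" "v \<in> H"
    then obtain y1 where y1: "y1 \<in> C" "H = normal_cone E C y1" by (auto simp: normal_fan_def)
    have "v \<bullet> (y1 - y) \<le> 0" "v \<bullet> (y - y1) \<le> 0"
      using y1 y H(2) by (auto simp: normal_cone_def)
    then have y1F: "y1 \<in> F" using y1 by (simp add: F_def inner_diff_right)
    have "?G = H \<inter> {\<alpha>. (y0 - y1) \<bullet> \<alpha> = 0}"
    proof (intro equalityI subsetI)
      fix \<alpha> assume \<alpha>: "\<alpha> \<in> ?G"
      \<comment> \<open>A functional maximal at the relative interior point \<open>y0\<close> is constant on the segment from
        \<open>y1\<close> through \<open>y0\<close>.\<close>
      obtain r \<mu> where r: "r \<in> F" "0 < \<mu>" "\<mu> < 1" "y0 = \<mu> *\<^sub>R y1 + (1 - \<mu>) *\<^sub>R r"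
        using rel_interior_prolong[OF F y0 y1F] by blast
      have le: "\<alpha> \<bullet> y1 \<le> \<alpha> \<bullet> y0" "\<alpha> \<bullet> r \<le> \<alpha> \<bullet> y0"
        using \<alpha> y1(1) r(1) by (auto simp: normal_cone_def F_def inner_diff_right)
      have "\<alpha> \<bullet> y0 = \<mu> * (\<alpha> \<bullet> y1) + (1 - \<mu>) * (\<alpha> \<bullet> r)"
        using r(4) by (metis inner_add_right inner_scaleR_right)
      also have "\<dots> \<le> \<mu> * (\<alpha> \<bullet> y1) + (1 - \<mu>) * (\<alpha> \<bullet> y0)"
        using le(2) r(3) by (simp add: mult_left_mono)
      finally have "\<mu> * (\<alpha> \<bullet> y0) \<le> \<mu> * (\<alpha> \<bullet> y1)" by (simp add: algebra_simps)
      then have eq: "\<alpha> \<bullet> y0 = \<alpha> \<bullet> y1" using le(1) r(2) by simp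
      then show "\<alpha> \<in> H \<inter> {\<alpha>. (y0 - y1) \<bullet> \<alpha> = 0}"
        using \<alpha> y1(2) by (auto simp: normal_cone_def inner_diff_right inner_diff_left inner_commute)
    next
      fix \<alpha> assume "\<alpha> \<in> H \<inter> {\<alpha>. (y0 - y1) \<bullet> \<alpha> = 0}"
      then show "\<alpha> \<in> ?G"
        using y1(2) by (auto simp: normal_cone_def inner_diff_right inner_diff_left inner_commute)
    qed
    moreover have "(y0 - y1) \<bullet> \<alpha> \<le> 0" if "\<alpha> \<in> H" for \<alpha>
      using that y1(2) y0F(1) by (auto simp: normal_cone_def inner_commute)
    moreover have "convex H" using y1(2) convex_normal_cone[OF E] by simp
    ultimately show "?G face_of H" by (simp add: face_of_Int_supporting_hyperplane_le)
  qed
qed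

lemma empty_notin_normal_fan:
  assumes "subspace E"
  shows "{} \<notin> normal_fan E C"
proof -
  have "0 \<in> normal_cone E C y" for y using assms by (simp add: normal_cone_def subspace_0)
  then show ?thesis by (force simp: normal_fan_def)
qed

section \<open>Polyhedral and piecewise affine functions\<close>

definition polyhedral_on :: "'a::euclidean_space set \<Rightarrow> ('a \<Rightarrow> ereal) \<Rightarrow> bool" where
  "polyhedral_on E g \<longleftrightarrow> (\<forall>x\<in>E. g x \<noteq> -\<infinity>) \<and> polyhedron {(x, z). x \<in> E \<and> g x \<le> ereal z}"

text \<open>Affinity asks for finite values, and \<open>ereal\<close> is no vector space; hence the real-valued
  representative.\<close>

definition affine_along :: "'a::real_vector set \<Rightarrow> ('a \<Rightarrow> ereal) \<Rightarrow> bool" where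
  "affine_along S g \<longleftrightarrow> (\<exists>h::'a \<Rightarrow> real. (\<forall>x\<in>S. g x = ereal (h x)) \<and>
     (\<forall>x\<in>S. \<forall>x'\<in>S. \<forall>u\<in>{0..1}. h (u *\<^sub>R x + (1 - u) *\<^sub>R x') = u * h x + (1 - u) * h x'))"

definition piecewise_affine :: "'a::euclidean_space set \<Rightarrow> ('a \<Rightarrow> ereal) \<Rightarrow> 'a set set \<Rightarrow> bool" where
  "piecewise_affine E g \<P> \<longleftrightarrow> polyhedral_on E g \<and> stratified \<P> \<and>
     \<Union>\<P> = {x\<in>E. g x \<noteq> \<infinity>} \<and> (\<forall>S\<in>\<P>. affine_along S g)"

lemma affine_along_cong:
  assumes "\<And>x. x \<in> S \<Longrightarrow> f x = g x"
  shows "affine_along S f \<longleftrightarrow> affine_along S g"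
  using assms unfolding affine_along_def by auto

lemma affine_along_subset:
  assumes "affine_along S g" "S' \<subseteq> S"
  shows "affine_along S' g"
  using assms unfolding affine_along_def by (meson subsetD)

lemma affine_along_zero: "affine_along S (\<lambda>_. 0)"
  unfolding affine_along_def by (rule exI[of _ "\<lambda>_. 0"]) simp

lemma affine_along_add:
  assumes "affine_along S f" "affine_along S g"
  shows "affine_along S (\<lambda>x. f x + g x)"
proof -
  obtain h k where "\<forall>x\<in>S. f x = ereal (h x)" "\<forall>x\<in>S. g x = ereal (k x)"
    "\<forall>x\<in>S. \<forall>x'\<in>S. \<forall>u\<in>{0..1}. h (u *\<^sub>R x + (1 - u) *\<^sub>R x') = u * h x + (1 - u) * h x'"
    "\<forall>x\<in>S. \<forall>x'\<in>S. \<forall>u\<in>{0..1}. k (u *\<^sub>R x + (1 - u) *\<^sub>R x') = u * k x + (1 - u) * k x'"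
    using assms unfolding affine_along_def by blast
  then show ?thesis
    unfolding affine_along_def by (intro exI[of _ "\<lambda>x. h x + k x"]) (auto simp: distrib_left)
qed

lemma affine_along_cmult:
  assumes "affine_along S f"
  shows "affine_along S (\<lambda>x. ereal p * f x)"
proof -
  obtain h where "\<forall>x\<in>S. f x = ereal (h x)"
    "\<forall>x\<in>S. \<forall>x'\<in>S. \<forall>u\<in>{0..1}. h (u *\<^sub>R x + (1 - u) *\<^sub>R x') = u * h x + (1 - u) * h x'"
    using assms unfolding affine_along_def by blast
  then show ?thesis
    unfolding affine_along_def by (intro exI[of _ "\<lambda>x. p * h x"]) (auto simp: distrib_left)
qed

lemma affine_along_sum:
  assumes "finite K" "\<And>k. k \<in> K \<Longrightarrow> affine_along S (f k)"
  shows "affine_along S (\<lambda>x. \<Sum>k\<in>K. f k x)"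
  using assms by (induction K) (auto simp: affine_along_zero affine_along_add)

lemma polyhedral_on_cong:
  assumes "\<And>x. x \<in> E \<Longrightarrow> f x = g x"
  shows "polyhedral_on E f \<longleftrightarrow> polyhedral_on E g"
proof -
  have "{(x, z). x \<in> E \<and> f x \<le> ereal z} = {(x, z). x \<in> E \<and> g x \<le> ereal z}"
    using assms by auto
  then show ?thesis using assms unfolding polyhedral_on_def by auto
qed

lemma polyhedral_on_zero:
  fixes E :: "'a::euclidean_space set"
  assumes "subspace E"
  shows "polyhedral_on E (\<lambda>_. 0)"
proof -
  have "{(x, z). x \<in> E \<and> (0::ereal) \<le> ereal z} = E \<times> {z::real. 1 \<bullet> z \<ge> 0}" by auto
  moreover have "polyhedron E" using assms by (intro affine_imp_polyhedron subspace_imp_affine)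
  then have "polyhedron (E \<times> {z::real. 1 \<bullet> z \<ge> 0})"
    by (intro polyhedron_Times polyhedron_halfspace_ge)
  ultimately show ?thesis by (simp add: polyhedral_on_def)
qed

lemma polyhedral_on_cmult:
  assumes f: "polyhedral_on E f" and p: "p > 0"
  shows "polyhedral_on E (\<lambda>x. ereal p * f x)"
  unfolding polyhedral_on_def
proof
  show "\<forall>x\<in>E. ereal p * f x \<noteq> -\<infinity>"
  proof
    fix x assume "x \<in> E"
    then show "ereal p * f x \<noteq> -\<infinity>"
      using f p by (cases "f x") (auto simp: polyhedral_on_def)
  qed
  have le: "ereal p * f x \<le> ereal z \<longleftrightarrow> f x \<le> ereal (z / p)" for x z
    using p by (cases "f x") (auto simp: field_simps)
  have "linear (\<lambda>(x, z). (x, z / p))"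
    by (rule linearI) (auto simp: add_divide_distrib)
  then have "polyhedron {q. (\<lambda>(x, z). (x, z / p)) q \<in> {(x, z). x \<in> E \<and> f x \<le> ereal z}}"
    using f unfolding polyhedral_on_def by (intro polyhedron_linear_preimage) auto
  moreover have "{q. (\<lambda>(x, z). (x, z / p)) q \<in> {(x, z). x \<in> E \<and> f x \<le> ereal z}} =
      {(x, z). x \<in> E \<and> ereal p * f x \<le> ereal z}"
    using le by auto
  ultimately show "polyhedron {(x, z). x \<in> E \<and> ereal p * f x \<le> ereal z}" by simp
qed

text \<open>The epigraph of a sum is a linear image of the part of the product of the epigraphs with equal
  base points.\<close>

lemma polyhedral_on_add:
  assumes f: "polyhedral_on E f" and g: "polyhedral_on E g"
  shows "polyhedral_on E (\<lambda>x. f x + g x)"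
  unfolding polyhedral_on_def
proof
  have ninf: "f x \<noteq> -\<infinity>" "g x \<noteq> -\<infinity>" if "x \<in> E" for x
    using f g that by (auto simp: polyhedral_on_def)
  then show "\<forall>x\<in>E. f x + g x \<noteq> -\<infinity>" by (simp add: ereal_plus_eq_MInfty)
  define F where "F = {(x, z). x \<in> E \<and> f x \<le> ereal z}"
  define G where "G = {(x, z). x \<in> E \<and> g x \<le> ereal z}"
  define W where "W = {((x, z), (x', z')) | x z x' z'. (x, z) \<in> F \<and> (x', z') \<in> G \<and> x = x'}"
  have "linear (\<lambda>q::('a \<times> real) \<times> ('a \<times> real). fst (fst q) - fst (snd q))"
    by (rule linearI) (auto simp: algebra_simps)
  moreover have "polyhedron {0::'a}" by (intro affine_imp_polyhedron affine_sing)
  ultimately have "polyhedron {q::('a \<times> real) \<times> ('a \<times> real). fst (fst q) - fst (snd q) \<in> {0}}"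
    by (rule polyhedron_linear_preimage)
  moreover have "W = (F \<times> G) \<inter> {q. fst (fst q) - fst (snd q) \<in> {0}}"
    by (auto simp: W_def)
  moreover have "polyhedron F" "polyhedron G"
    using f g by (auto simp: polyhedral_on_def F_def G_def)
  then have "polyhedron (F \<times> G)" by (rule polyhedron_Times)
  ultimately have "polyhedron W" by (simp only: polyhedron_Int)
  moreover have "linear (\<lambda>q::('a \<times> real) \<times> ('a \<times> real). (fst (fst q), snd (fst q) + snd (snd q)))"
    by (rule linearI) (auto simp: algebra_simps)
  ultimately have "polyhedron ((\<lambda>q. (fst (fst q), snd (fst q) + snd (snd q))) ` W)"
    by (intro polyhedron_linear_image)
  moreover have "(\<lambda>q. (fst (fst q), snd (fst q) + snd (snd q))) ` W =
      {(x, z). x \<in> E \<and> f x + g x \<le> ereal z}" (is "?L = ?R")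
  proof (intro equalityI subsetI)
    fix q assume "q \<in> ?L"
    then obtain x z z' where q: "q = (x, z + z')" "x \<in> E" "f x \<le> ereal z" "g x \<le> ereal z'"
      by (auto simp: W_def F_def G_def)
    then have "f x + g x \<le> ereal z + ereal z'" by (intro add_mono)
    then show "q \<in> ?R" using q by simp
  next
    fix q assume "q \<in> ?R"
    then obtain x z where q: "q = (x, z)" "x \<in> E" "f x + g x \<le> ereal z" by auto
    obtain a b where ab: "f x = ereal a" "g x = ereal b"
      using q ninf[OF q(2)] by (cases "f x"; cases "g x") auto
    have "((x, a), (x, z - a)) \<in> W" using q ab by (auto simp: W_def F_def G_def)
    then show "q \<in> ?L" using q(1) by (force intro: rev_image_eqI)
  qed
  ultimately show "polyhedron {(x, z). x \<in> E \<and> f x + g x \<le> ereal z}" by simp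
qed

lemma polyhedral_on_sum:
  assumes "finite K" "subspace E" "\<And>k. k \<in> K \<Longrightarrow> polyhedral_on E (f k)"
  shows "polyhedral_on E (\<lambda>x. \<Sum>k\<in>K. f k x)"
  using assms by (induction K) (auto simp: polyhedral_on_zero polyhedral_on_add)

lemma piecewise_affine_weighted_sum:
  fixes g :: "'k \<Rightarrow> 'a::euclidean_space \<Rightarrow> ereal"
  assumes K: "finite K" and E: "subspace E"
    and g: "\<And>k. k \<in> K \<Longrightarrow> piecewise_affine E (g k) (C k)" and p: "\<And>k. k \<in> K \<Longrightarrow> p k > 0"
  shows "piecewise_affine E (\<lambda>x. \<Sum>k\<in>K. ereal (p k) * g k x) (big_meet E K C)"
  unfolding piecewise_affine_def
proof (intro conjI ballI)
  show "polyhedral_on E (\<lambda>x. \<Sum>k\<in>K. ereal (p k) * g k x)"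
    using g p by (intro polyhedral_on_sum K E polyhedral_on_cmult) (auto simp: piecewise_affine_def)
  show "stratified (big_meet E K C)"
    using g by (intro stratified_big_meet K E) (auto simp: piecewise_affine_def)
  have "(\<Sum>k\<in>K. ereal (p k) * g k x) = \<infinity> \<longleftrightarrow> (\<exists>k\<in>K. g k x = \<infinity>)" if x: "x \<in> E" for x
  proof -
    have "ereal (p k) * g k x = \<infinity> \<longleftrightarrow> g k x = \<infinity>" if "k \<in> K" for k
      using p[OF that] g[OF that] x
      by (cases "g k x") (auto simp: piecewise_affine_def polyhedral_on_def)
    then show ?thesis using K by (auto simp: sum_Pinfty)
  qed
  moreover have "\<Union>(big_meet E K C) = E \<inter> (\<Inter>k\<in>K. {x\<in>E. g k x \<noteq> \<infinity>})"
    unfolding Union_big_meet using g by (auto simp: piecewise_affine_def)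
  ultimately show "\<Union>(big_meet E K C) = {x\<in>E. (\<Sum>k\<in>K. ereal (p k) * g k x) \<noteq> \<infinity>}"
    by auto
  fix S assume "S \<in> big_meet E K C"
  then obtain f where f: "S = E \<inter> (\<Inter>k\<in>K. f k)" "\<forall>k\<in>K. f k \<in> C k"
    unfolding big_meet_def by blast
  have "affine_along S (g k)" if "k \<in> K" for k
  proof (rule affine_along_subset)
    show "affine_along (f k) (g k)" using g[OF that] f(2) that by (auto simp: piecewise_affine_def)
    show "S \<subseteq> f k" using f(1) that by blast
  qed
  then show "affine_along S (\<lambda>x. \<Sum>k\<in>K. ereal (p k) * g k x)"
    by (intro affine_along_sum K affine_along_cmult) auto
qed

lemma piecewise_affine_cong:
  assumes eq: "\<And>x. x \<in> E \<Longrightarrow> f x = g x" and f: "piecewise_affine E f \<P>"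
  shows "piecewise_affine E g \<P>"
proof -
  have "S \<subseteq> E" if "S \<in> \<P>" for S using that f unfolding piecewise_affine_def by blast
  then have "affine_along S g" if "S \<in> \<P>" for S
    using that f affine_along_cong[of S f g] eq by (auto simp: piecewise_affine_def subset_iff)
  moreover have "polyhedral_on E g" using f polyhedral_on_cong[of E f g] eq by (simp add: piecewise_affine_def)
  moreover have "{x\<in>E. f x \<noteq> \<infinity>} = {x\<in>E. g x \<noteq> \<infinity>}" using eq by auto
  ultimately show ?thesis using f by (simp add: piecewise_affine_def)
qed

section \<open>One stage of the recursion\<close>

text \<open>The problem of a single stage for a fixed constraint: \<open>x\<close> ranges over \<open>E'\<close>, the decision \<open>y\<close>
  over \<open>E\<close>, the coupling constraint is \<open>(x, y) \<in> P\<close> and the value function \<open>V\<close> of the next stage is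
  affine on the cells of \<open>\<P>\<close>.\<close>

locale stage =
  fixes E' :: "'a::euclidean_space set" and E :: "'b::euclidean_space set"
    and P :: "('a \<times> 'b) set" and V :: "'b \<Rightarrow> ereal" and \<P> :: "'b set set"
  assumes subspace_E': "subspace E'" and subspace_E: "subspace E"
    and polyhedron_P: "polyhedron P" and P_subset: "P \<subseteq> E' \<times> E"
    and V: "piecewise_affine E V \<P>"
begin

definition Q :: "'a \<Rightarrow> 'b \<Rightarrow> ereal" where
  "Q x y = V y + convex_ind ((x, y) \<in> P)"

definition fiber :: "'a \<Rightarrow> ('b \<times> real) set" where
  "fiber x = {(y, z). y \<in> E \<and> Q x y \<le> ereal z}"

text \<open>The union of the fibers, in a form that shows it to be a polyhedron.\<close>

definition epi :: "('a \<times> 'b \<times> real) set" where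
  "epi = {(x, y, z). (x, y) \<in> P \<and> y \<in> E \<and> V y \<le> ereal z}"

definition \<Q> :: "('a \<times> 'b) set set" where
  "\<Q> = meet {E' \<times> \<sigma> | \<sigma>. \<sigma> \<in> \<P>} (face_complex P)"

abbreviation \<C> :: "'a set set" where
  "\<C> \<equiv> chamber_complex \<Q> fst"

definition dom :: "'a set" where
  "dom = fst ` \<Union>\<Q>"

abbreviation EE :: "('b \<times> real) set" where
  "EE \<equiv> E \<times> UNIV"

definition optimal :: "'b \<Rightarrow> 'a \<Rightarrow> 'b \<Rightarrow> real \<Rightarrow> bool" where
  "optimal c x y z \<longleftrightarrow> (y, z) \<in> fiber x \<and> (\<forall>(w, \<zeta>) \<in> fiber x. c \<bullet> y + z \<le> c \<bullet> w + \<zeta>)"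

definition val :: "'b \<Rightarrow> 'a \<Rightarrow> ereal" where
  "val c x = (INF y\<in>E. ereal (c \<bullet> y) + Q x y)"

lemma V_not_minf: "y \<in> E \<Longrightarrow> V y \<noteq> -\<infinity>"
  using V by (simp add: piecewise_affine_def polyhedral_on_def)

lemma stratified_\<P>: "stratified \<P>"
  using V by (simp add: piecewise_affine_def)

lemma Union_\<P>: "\<Union>\<P> = {y\<in>E. V y \<noteq> \<infinity>}"
  using V by (simp add: piecewise_affine_def)

lemma subspace_EE: "subspace EE"
  using subspace_E by (intro subspace_Times) auto

lemma mem_fiber: "(y, z) \<in> fiber x \<longleftrightarrow> (x, y, z) \<in> epi"
  using P_subset V_not_minf[of y] unfolding fiber_def epi_def Q_def convex_ind_def
  by (cases "V y") auto

lemma polyhedron_epi: "polyhedron epi"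
proof -
  have "polyhedron {(y, z). y \<in> E \<and> V y \<le> ereal z}"
    using V by (simp add: piecewise_affine_def polyhedral_on_def)
  then have "polyhedron {p::'a \<times> 'b \<times> real. snd p \<in> {(y, z). y \<in> E \<and> V y \<le> ereal z}}"
    by (intro polyhedron_linear_preimage linear_snd)
  moreover have "linear (\<lambda>p::'a \<times> 'b \<times> real. (fst p, fst (snd p)))"
    by (rule linearI) auto
  then have "polyhedron {p::'a \<times> 'b \<times> real. (fst p, fst (snd p)) \<in> P}"
    by (intro polyhedron_linear_preimage polyhedron_P)
  moreover have "epi = {p. (fst p, fst (snd p)) \<in> P} \<inter>
      {p. snd p \<in> {(y, z). y \<in> E \<and> V y \<le> ereal z}}"
    by (auto simp: epi_def)
  ultimately show ?thesis by simp
qed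

lemma convex_epi: "convex epi"
  using polyhedron_epi by (rule polyhedron_imp_convex)

lemma fiber_convex_comb:
  assumes "q \<in> fiber x" "q' \<in> fiber x'" "0 \<le> u" "u \<le> 1"
  shows "u *\<^sub>R q + (1 - u) *\<^sub>R q' \<in> fiber (u *\<^sub>R x + (1 - u) *\<^sub>R x')"
proof -
  have m: "r \<in> fiber s \<longleftrightarrow> (s, r) \<in> epi" for r s
    using mem_fiber[of "fst r" "snd r" s] by simp
  have "u *\<^sub>R (x, q) + (1 - u) *\<^sub>R (x', q') \<in> epi"
    using assms convex_epi m unfolding convex_def by (smt (verit))
  then show ?thesis unfolding m by simp
qed

lemma polyhedron_fiber: "polyhedron (fiber x)"
proof -
  have "linear (\<lambda>q::'b \<times> real. (0::'a, q))" by (rule linearI) auto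
  then have "polyhedron {q. (x, 0) + (0, q) \<in> epi}"
    by (intro polyhedron_affine_preimage polyhedron_epi)
  moreover have "{q. (x, 0) + (0, q) \<in> epi} = fiber x"
    by (auto simp: mem_fiber)
  ultimately show ?thesis by simp
qed

lemma face_stratified_fiber: "face_stratified (normal_fan EE (fiber x))"
  using polyhedron_fiber subspace_EE by (rule face_stratified_normal_fan)

lemma stratified_\<Q>: "stratified \<Q>"
  unfolding \<Q>_def
  by (intro stratified_meet stratified_Times_subspace stratified_face_complex
      stratified_\<P> subspace_E' polyhedron_P)

lemma stratified_\<C>: "stratified \<C>"
  by (intro stratified_chamber_complex stratified_\<Q> linear_fst)

lemma Union_\<Q>: "\<Union>\<Q> = {(x, y) \<in> P. V y \<noteq> \<infinity>}"
proof -
  have "\<Union>\<Q> = \<Union>{E' \<times> \<sigma> | \<sigma>. \<sigma> \<in> \<P>} \<inter> \<Union>(face_complex P)"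
    unfolding \<Q>_def meet_def by blast
  also have "\<Union>{E' \<times> \<sigma> | \<sigma>. \<sigma> \<in> \<P>} = E' \<times> \<Union>\<P>" by blast
  also have "\<Union>(face_complex P) = P"
  proof
    show "\<Union>(face_complex P) \<subseteq> P" using face_of_imp_subset by (auto simp: face_complex_def)
    show "P \<subseteq> \<Union>(face_complex P)"
      using face_of_refl[OF polyhedron_imp_convex[OF polyhedron_P]]
      by (auto simp: face_complex_def)
  qed
  finally show ?thesis using P_subset by (auto simp: Union_\<P>)
qed

lemma cellE:
  assumes "F \<in> \<Q>"
  obtains \<sigma> h where "\<sigma> \<in> \<P>" "F \<subseteq> P" "\<And>x y. (x, y) \<in> F \<Longrightarrow> y \<in> \<sigma>" "\<And>y. y \<in> \<sigma> \<Longrightarrow> V y = ereal (h y)"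
    "\<And>y y' u. y \<in> \<sigma> \<Longrightarrow> y' \<in> \<sigma> \<Longrightarrow> 0 \<le> u \<Longrightarrow> u \<le> 1 \<Longrightarrow>
        h (u *\<^sub>R y + (1 - u) *\<^sub>R y') = u * h y + (1 - u) * h y'"
proof -
  obtain \<sigma> G where \<sigma>: "\<sigma> \<in> \<P>" "G \<in> face_complex P" "F = (E' \<times> \<sigma>) \<inter> G"
    using assms unfolding \<Q>_def meet_def by blast
  have "affine_along \<sigma> V" using \<sigma>(1) V by (simp add: piecewise_affine_def)
  then obtain h where h: "\<forall>y\<in>\<sigma>. V y = ereal (h y)"
    "\<forall>y\<in>\<sigma>. \<forall>y'\<in>\<sigma>. \<forall>u\<in>{0..1}. h (u *\<^sub>R y + (1 - u) *\<^sub>R y') = u * h y + (1 - u) * h y'"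
    unfolding affine_along_def by blast
  have "F \<subseteq> P" using \<sigma>(2,3) face_of_imp_subset by (auto simp: face_complex_def)
  then show thesis using that[OF \<sigma>(1) _ _, of h] \<sigma>(3) h by auto
qed

lemma dom_iff_fiber: "x \<in> dom \<longleftrightarrow> fiber x \<noteq> {}"
proof
  assume "x \<in> dom"
  then obtain y where y: "(x, y) \<in> P" "V y \<noteq> \<infinity>" unfolding dom_def Union_\<Q> by auto
  then have "V y \<noteq> -\<infinity>" using P_subset V_not_minf by blast
  then obtain z where "V y = ereal z" using y(2) by (cases "V y") auto
  then have "(y, z) \<in> fiber x" using y P_subset by (auto simp: mem_fiber epi_def)
  then show "fiber x \<noteq> {}" by blast
next
  assume "fiber x \<noteq> {}"
  then obtain y z where "(x, y, z) \<in> epi" using mem_fiber by fast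
  then have "(x, y) \<in> \<Union>\<Q>" unfolding Union_\<Q> by (auto simp: epi_def)
  then show "x \<in> dom" unfolding dom_def by force
qed

lemma Union_\<C>: "\<Union>\<C> = dom"
  unfolding dom_def by (rule Union_chamber_complex)

lemma dom_subset: "dom \<subseteq> E'"
  unfolding dom_def Union_\<Q> using P_subset by auto

text \<open>Points of the relative interior of a cell have the smallest normal cones. A point of the fiber
  over \<open>x'\<close>, averaged with a point above the cell, gives a point of the fiber over \<open>x\<close>, because \<open>V\<close>
  is convex, and the average of the base points has the right height, because \<open>V\<close> is affine on the
  cell.\<close>

lemma normal_cone_cell_mono:
  assumes F: "F \<in> \<Q>" and p: "(x, y) \<in> rel_interior F" and p': "(x', y') \<in> F"
    and z: "(y, z) \<in> fiber x"
    and z': "z' = real_of_ereal (V y') + (z - real_of_ereal (V y))"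
  shows "(y', z') \<in> fiber x'"
    and "normal_cone W (fiber x) (y, z) \<subseteq> normal_cone W (fiber x') (y', z')"
proof -
  obtain \<sigma> h where \<sigma>: "F \<subseteq> P" "\<And>x y. (x, y) \<in> F \<Longrightarrow> y \<in> \<sigma>"
    "\<And>y. y \<in> \<sigma> \<Longrightarrow> V y = ereal (h y)"
    "\<And>y y' u. y \<in> \<sigma> \<Longrightarrow> y' \<in> \<sigma> \<Longrightarrow> 0 \<le> u \<Longrightarrow> u \<le> 1 \<Longrightarrow>
        h (u *\<^sub>R y + (1 - u) *\<^sub>R y') = u * h y + (1 - u) * h y'"
    by (rule cellE[OF F]) blast
  have pF: "(x, y) \<in> F" using p rel_interior_subset by blast
  have hy: "V y = ereal (h y)" "V y' = ereal (h y')" using \<sigma> pF p' by blast+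
  have zh: "h y \<le> z" using z hy by (simp add: mem_fiber epi_def)
  have above: "(w, h w + (z - h y)) \<in> fiber v" if "(v, w) \<in> F" for v w
  proof -
    have "(v, w) \<in> P" "V w = ereal (h w)" "w \<in> E" using that \<sigma> P_subset by blast+
    then show ?thesis using zh by (simp add: mem_fiber epi_def)
  qed
  show "(y', z') \<in> fiber x'" using above[OF p'] z' hy by simp
  obtain r \<mu> where r: "r \<in> F" "0 < \<mu>" "\<mu> < 1" "(x, y) = \<mu> *\<^sub>R (x', y') + (1 - \<mu>) *\<^sub>R r"
    using rel_interior_prolong[OF stratifiedD(2)[OF stratified_\<Q> F] p p'] .
  obtain v w where vw: "r = (v, w)" by (cases r)
  define s where "s = (w, h w + (z - h y))"
  have x: "x = \<mu> *\<^sub>R x' + (1 - \<mu>) *\<^sub>R v" and y: "y = \<mu> *\<^sub>R y' + (1 - \<mu>) *\<^sub>R w"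
    using r(4) vw by auto
  have "h y = \<mu> * h y' + (1 - \<mu>) * h w"
    unfolding y by (rule \<sigma>(4)) (use \<sigma>(2) p' r vw in auto)
  then have "z = \<mu> * (h y' + (z - h y)) + (1 - \<mu>) * (h w + (z - h y))"
    by (simp add: algebra_simps)
  then have base: "(y, z) = \<mu> *\<^sub>R (y', z') + (1 - \<mu>) *\<^sub>R s"
    using y z' hy unfolding s_def by simp
  show "normal_cone W (fiber x) (y, z) \<subseteq> normal_cone W (fiber x') (y', z')"
  proof
    fix \<alpha> assume \<alpha>: "\<alpha> \<in> normal_cone W (fiber x) (y, z)"
    have "\<alpha> \<bullet> (q - (y', z')) \<le> 0" if q: "q \<in> fiber x'" for q
    proof -
      have "s \<in> fiber v" using above r(1) vw by (simp add: s_def)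
      then have "\<mu> *\<^sub>R q + (1 - \<mu>) *\<^sub>R s \<in> fiber x"
        unfolding x using r(2,3) by (intro fiber_convex_comb q) auto
      then have "\<alpha> \<bullet> (\<mu> *\<^sub>R q + (1 - \<mu>) *\<^sub>R s - (y, z)) \<le> 0"
        using \<alpha> by (auto simp: normal_cone_def)
      also have "\<mu> *\<^sub>R q + (1 - \<mu>) *\<^sub>R s - (y, z) = \<mu> *\<^sub>R (q - (y', z'))"
        unfolding base by (simp add: algebra_simps)
      finally show ?thesis using r(2) by (simp add: mult_le_0_iff)
    qed
    then show "\<alpha> \<in> normal_cone W (fiber x') (y', z')"
      using \<alpha> by (simp add: normal_cone_def)
  qed
qed

lemma cell_at:
  assumes "(y, z) \<in> fiber x"
  obtains F where "F \<in> \<Q>" "(x, y) \<in> rel_interior F"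
proof -
  have "(x, y) \<in> \<Union>\<Q>" using assms unfolding mem_fiber epi_def Union_\<Q> by auto
  then show thesis using that stratifiedD(3)[OF stratified_\<Q>] by blast
qed

lemma chamber_subset:
  assumes "F \<in> \<Q>" "(x0, y) \<in> F"
  shows "chamber \<Q> fst x0 \<subseteq> fst ` F"
proof -
  have "x0 \<in> fst ` F" using assms(2) by force
  then show ?thesis unfolding chamber_def using assms(1) by blast
qed

lemma convex_chamber: "convex (chamber \<Q> fst x0)"
  unfolding chamber_def
  using stratifiedD(2)[OF stratified_\<Q>] by (intro convex_Inter) (auto intro: convex_linear_image linear_fst)

lemma mem_chamber: "x0 \<in> dom \<Longrightarrow> x0 \<in> chamber \<Q> fst x0"
  unfolding chamber_def by blast

text \<open>The chamber of \<open>x0\<close> lies in the projection of the cell and meets its relative interior at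
  \<open>x0\<close>.\<close>

lemma chamber_lift:
  assumes "F \<in> \<Q>" "(x0, y) \<in> rel_interior F" "x \<in> rel_interior (chamber \<Q> fst x0)"
  obtains y' where "(x, y') \<in> rel_interior F"
proof -
  have cF: "convex F" using assms(1) stratifiedD(2)[OF stratified_\<Q>] by blast
  have ri: "fst ` rel_interior F = rel_interior (fst ` F)"
    by (rule rel_interior_convex_linear_image[OF linear_fst cF])
  have yF: "(x0, y) \<in> F" using assms(2) rel_interior_subset by blast
  have "x0 \<in> dom" unfolding dom_def using yF assms(1) by force
  moreover have "x0 \<in> rel_interior (fst ` F)" unfolding ri[symmetric] using assms(2) by force
  ultimately have "x \<in> rel_interior (fst ` F)"
    by (intro rel_interior_mono_meeting[OF convex_chamber _ chamber_subset[OF assms(1) yF]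
          mem_chamber _ assms(3)] convex_linear_image[OF linear_fst cF]) auto
  then show thesis using that unfolding ri[symmetric] by force
qed

text \<open>A cell over \<open>x0\<close> has points of its relative interior over \<open>x\<close> as well, and points of the same
  relative interior at the same height above the graph have equal normal cones.\<close>

lemma normal_fan_chamber_subset:
  assumes x: "x \<in> rel_interior (chamber \<Q> fst x0)"
  shows "normal_fan EE (fiber x0) \<subseteq> normal_fan EE (fiber x)"
proof
  fix N assume "N \<in> normal_fan EE (fiber x0)"
  then obtain y z where yz: "(y, z) \<in> fiber x0" "N = normal_cone EE (fiber x0) (y, z)"
    by (auto simp: normal_fan_def)
  obtain F where F: "F \<in> \<Q>" "(x0, y) \<in> rel_interior F" by (rule cell_at[OF yz(1)])
  obtain y' where y': "(x, y') \<in> rel_interior F" by (rule chamber_lift[OF F x])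
  define z' where "z' = real_of_ereal (V y') + (z - real_of_ereal (V y))"
  have inF: "(x0, y) \<in> F" "(x, y') \<in> F" using F(2) y' rel_interior_subset by blast+
  note 1 = normal_cone_cell_mono[OF F inF(2) yz(1) z'_def]
  have "z = real_of_ereal (V y) + (z' - real_of_ereal (V y'))" by (simp add: z'_def)
  note 2 = normal_cone_cell_mono(2)[OF F(1) y' inF(1) 1(1) this]
  have "N = normal_cone EE (fiber x) (y', z')" using 1(2) 2 yz(2) by blast
  then show "N \<in> normal_fan EE (fiber x)" using 1(1) by (auto simp: normal_fan_def)
qed

text \<open>A functional bounded on the fiber over \<open>x\<close> is bounded on the fiber over \<open>x0\<close>, as \<open>x\<close> lies
  strictly between \<open>x0\<close> and another point of the chamber and the epigraph is convex. On a polyhedron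
  a bounded functional attains its supremum, so the two normal fans have the same support.\<close>

lemma normal_fan_support_subset:
  assumes x0: "x0 \<in> dom" and x: "x \<in> rel_interior (chamber \<Q> fst x0)"
  shows "\<Union>(normal_fan EE (fiber x)) \<subseteq> \<Union>(normal_fan EE (fiber x0))"
proof
  fix \<alpha> assume "\<alpha> \<in> \<Union>(normal_fan EE (fiber x))"
  then obtain p where p: "p \<in> fiber x" "\<alpha> \<in> normal_cone EE (fiber x) p"
    by (auto simp: normal_fan_def)
  then have \<alpha>: "\<alpha> \<in> EE" "\<And>q. q \<in> fiber x \<Longrightarrow> \<alpha> \<bullet> q \<le> \<alpha> \<bullet> p"
    by (auto simp: normal_cone_def inner_diff_right)
  obtain r \<mu> where r: "r \<in> chamber \<Q> fst x0" "0 < \<mu>" "\<mu> < 1" "x = \<mu> *\<^sub>R x0 + (1 - \<mu>) *\<^sub>R r"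
    using rel_interior_prolong[OF convex_chamber x mem_chamber[OF x0]] .
  obtain F where "F \<in> \<Q>" "x0 \<in> fst ` F" using x0 unfolding dom_def by blast
  then have "r \<in> dom" using r(1) unfolding dom_def chamber_def by blast
  then obtain s where s: "s \<in> fiber r" using dom_iff_fiber by blast
  have "\<alpha> \<bullet> q \<le> (\<alpha> \<bullet> p - (1 - \<mu>) * (\<alpha> \<bullet> s)) / \<mu>" if q: "q \<in> fiber x0" for q
  proof -
    have "\<mu> *\<^sub>R q + (1 - \<mu>) *\<^sub>R s \<in> fiber x"
      unfolding r(4) using r(2,3) by (intro fiber_convex_comb q s) auto
    then have "\<alpha> \<bullet> (\<mu> *\<^sub>R q + (1 - \<mu>) *\<^sub>R s) \<le> \<alpha> \<bullet> p" by (rule \<alpha>(2))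
    then have "\<mu> * (\<alpha> \<bullet> q) \<le> \<alpha> \<bullet> p - (1 - \<mu>) * (\<alpha> \<bullet> s)" by (simp add: inner_add_right)
    then show ?thesis using r(2) by (simp add: pos_le_divide_eq mult.commute)
  qed
  then obtain q where "q \<in> fiber x0" "\<forall>q'\<in>fiber x0. \<alpha> \<bullet> q' \<le> \<alpha> \<bullet> q"
    using polyhedron_attains_sup[OF polyhedron_fiber] x0 dom_iff_fiber by blast
  then have "\<alpha> \<in> normal_cone EE (fiber x0) q" "q \<in> fiber x0"
    using \<alpha>(1) by (auto simp: normal_cone_def inner_diff_right)
  then show "\<alpha> \<in> \<Union>(normal_fan EE (fiber x0))" by (auto simp: normal_fan_def)
qed

lemma chamber_subset_dom:
  assumes "x0 \<in> dom"
  shows "chamber \<Q> fst x0 \<subseteq> dom"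
proof -
  obtain F where "F \<in> \<Q>" "x0 \<in> fst ` F" using assms unfolding dom_def by blast
  then show ?thesis unfolding dom_def chamber_def by blast
qed

theorem normal_fan_constant_on_chamber:
  assumes "x0 \<in> dom" "x \<in> rel_interior (chamber \<Q> fst x0)"
  shows "normal_fan EE (fiber x) = normal_fan EE (fiber x0)"
  by (intro face_stratified_eqI[symmetric] face_stratified_fiber normal_fan_chamber_subset
      normal_fan_support_subset empty_notin_normal_fan subspace_EE assms)

lemma optimal_iff_normal_cone:
  assumes "(- c, - 1) \<in> W" "(y, z) \<in> fiber x"
  shows "optimal c x y z \<longleftrightarrow> (- c, - 1) \<in> normal_cone W (fiber x) (y, z)"
  using assms by (auto simp: optimal_def normal_cone_def inner_diff_right algebra_simps)

lemma val_eqI: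
  assumes "optimal c x y z"
  shows "val c x = ereal (c \<bullet> y + z)"
proof (rule antisym)
  have yz: "y \<in> E" "Q x y \<le> ereal z" using assms by (auto simp: optimal_def fiber_def)
  have "val c x \<le> ereal (c \<bullet> y) + Q x y" unfolding val_def using yz(1) by (rule INF_lower)
  also have "\<dots> \<le> ereal (c \<bullet> y) + ereal z" using yz(2) by (rule add_left_mono)
  finally show "val c x \<le> ereal (c \<bullet> y + z)" by simp
  show "ereal (c \<bullet> y + z) \<le> val c x"
    unfolding val_def
  proof (rule INF_greatest)
    fix w assume w: "w \<in> E"
    show "ereal (c \<bullet> y + z) \<le> ereal (c \<bullet> w) + Q x w"
    proof (cases "Q x w")
      case (real \<zeta>)
      then have "(w, \<zeta>) \<in> fiber x" using w by (simp add: fiber_def)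
      then show ?thesis using assms real by (auto simp: optimal_def)
    next
      case MInf
      then show ?thesis using V_not_minf[OF w]
        by (cases "V w") (auto simp: Q_def convex_ind_def split: if_splits)
    qed auto
  qed
qed

lemma val_outside_dom:
  assumes "x \<notin> dom"
  shows "val c x = \<infinity>"
proof -
  have "Q x y = \<infinity>" if "y \<in> E" for y
  proof (rule ccontr)
    assume ne: "Q x y \<noteq> \<infinity>"
    then have "Q x y \<le> ereal (real_of_ereal (Q x y))" by (cases "Q x y") auto
    then have "(y, real_of_ereal (Q x y)) \<in> fiber x" using that by (simp add: fiber_def)
    then show False using assms dom_iff_fiber by blast
  qed
  then have "(\<infinity>::ereal) \<le> val c x" unfolding val_def by (intro INF_greatest) auto
  then show ?thesis by simp
qed

lemma optimal_if_bounded: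
  assumes "x \<in> dom" "\<And>w \<zeta>. (w, \<zeta>) \<in> fiber x \<Longrightarrow> K \<le> c \<bullet> w + \<zeta>"
  shows "\<exists>y z. optimal c x y z"
proof -
  have "fiber x \<noteq> {}" using assms(1) dom_iff_fiber by blast
  moreover have "(- c, - 1) \<bullet> q \<le> - K" if "q \<in> fiber x" for q
    using assms(2)[of "fst q" "snd q"] that by (cases q) auto
  ultimately obtain q where q: "q \<in> fiber x" "\<forall>q'\<in>fiber x. (- c, - 1) \<bullet> q' \<le> (- c, - 1) \<bullet> q"
    using polyhedron_attains_sup[OF polyhedron_fiber] by blast
  then have "optimal c x (fst q) (snd q)"
    by (cases q) (fastforce simp: optimal_def)
  then show ?thesis by blast
qed

lemma optimal_if_has_min:
  assumes "x \<in> dom" "has_min_on (\<lambda>y. ereal (c \<bullet> y) + Q x y) E"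
  shows "\<exists>y z. optimal c x y z"
proof -
  obtain y where y: "y \<in> E" "\<And>w. w \<in> E \<Longrightarrow> ereal (c \<bullet> y) + Q x y \<le> ereal (c \<bullet> w) + Q x w"
    using assms(2) unfolding has_min_on_def by blast
  obtain w0 \<zeta>0 where w0: "(w0, \<zeta>0) \<in> fiber x" using assms(1) dom_iff_fiber by fastforce
  have "Q x y \<noteq> \<infinity>" using y(2)[of w0] w0 by (cases "Q x w0") (auto simp: fiber_def)
  moreover have "Q x y \<noteq> -\<infinity>"
    using V_not_minf[OF y(1)] by (cases "V y") (auto simp: Q_def convex_ind_def)
  ultimately obtain z where z: "Q x y = ereal z" by (cases "Q x y") auto
  have "c \<bullet> y + z \<le> c \<bullet> w + \<zeta>" if "(w, \<zeta>) \<in> fiber x" for w \<zeta>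
  proof -
    have "w \<in> E" "Q x w \<le> ereal \<zeta>" using that by (auto simp: fiber_def)
    then have "ereal (c \<bullet> y) + Q x y \<le> ereal (c \<bullet> w) + ereal \<zeta>"
      using y(2) by (meson add_left_mono order_trans)
    then show ?thesis using z by simp
  qed
  then have "optimal c x y z" using y(1) z by (auto simp: optimal_def fiber_def)
  then show ?thesis by blast
qed

text \<open>The epigraph of the optimal value is a projection of a polyhedron, because the minimum is
  attained.\<close>

lemma polyhedral_val:
  assumes opt: "\<And>x. x \<in> dom \<Longrightarrow> \<exists>y z. optimal c x y z"
  shows "polyhedral_on E' (val c)"
  unfolding polyhedral_on_def
proof
  show "\<forall>x\<in>E'. val c x \<noteq> -\<infinity>"
  proof
    fix x assume "x \<in> E'"
    show "val c x \<noteq> -\<infinity>"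
    proof (cases "x \<in> dom")
      case True
      then show ?thesis using opt val_eqI by fastforce
    qed (simp add: val_outside_dom)
  qed
  have "linear (\<lambda>p::'a \<times> 'b \<times> real. (fst p, c \<bullet> fst (snd p) + snd (snd p)))"
    by (rule linearI) (auto simp: inner_add_right algebra_simps)
  then have "polyhedron ((\<lambda>p. (fst p, c \<bullet> fst (snd p) + snd (snd p))) ` epi)"
    by (rule polyhedron_linear_image[OF _ polyhedron_epi])
  moreover have "(\<lambda>p. (fst p, c \<bullet> fst (snd p) + snd (snd p))) ` epi =
      {(x, z). x \<in> E' \<and> val c x \<le> ereal z}" (is "?L = ?R")
  proof (intro equalityI subsetI)
    fix q assume "q \<in> ?L"
    then obtain x y z where q: "q = (x, c \<bullet> y + z)" "(y, z) \<in> fiber x" by (auto simp: mem_fiber)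
    then have "x \<in> dom" using dom_iff_fiber by blast
    then obtain y' z' where "optimal c x y' z'" using opt by blast
    then have "val c x \<le> ereal (c \<bullet> y + z)"
      using q(2) val_eqI by (auto simp: optimal_def)
    then show "q \<in> ?R" using q(1) dom_subset \<open>x \<in> dom\<close> by auto
  next
    fix q assume "q \<in> ?R"
    then obtain x z where q: "q = (x, z)" "val c x \<le> ereal z" by auto
    then have "x \<in> dom" using val_outside_dom by fastforce
    then obtain y' z' where o: "optimal c x y' z'" using opt by blast
    then have "c \<bullet> y' + z' \<le> z" using q(2) val_eqI by fastforce
    moreover have "(x, y', z') \<in> epi" using o by (simp add: optimal_def mem_fiber)
    ultimately have "(x, y', z - c \<bullet> y') \<in> epi"
      by (auto simp: epi_def elim: order_trans)
    then show "q \<in> ?L" using q(1) by (force intro: rev_image_eqI)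
  qed
  ultimately show "polyhedron {(x, z). x \<in> E' \<and> val c x \<le> ereal z}" by simp
qed

text \<open>A minimizer at the point that defines the chamber lies in the relative interior of a cell that
  projects onto the whole chamber. Its points over the chamber are minimizers too, since normal
  cones only grow within the cell, and the cost is affine there.\<close>

lemma affine_val_chamber:
  assumes x0: "x0 \<in> dom" and opt: "\<exists>y z. optimal c x0 y z"
  shows "affine_along (chamber \<Q> fst x0) (val c)"
proof -
  obtain y0 z where o: "optimal c x0 y0 z" using opt by blast
  then have yz: "(y0, z) \<in> fiber x0" by (simp add: optimal_def)
  obtain F where F: "F \<in> \<Q>" "(x0, y0) \<in> rel_interior F" by (rule cell_at[OF yz])
  then have yF: "(x0, y0) \<in> F" using rel_interior_subset by blast
  obtain \<sigma> h where \<sigma>: "F \<subseteq> P" "\<And>x y. (x, y) \<in> F \<Longrightarrow> y \<in> \<sigma>"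
    "\<And>y. y \<in> \<sigma> \<Longrightarrow> V y = ereal (h y)"
    "\<And>y y' u. y \<in> \<sigma> \<Longrightarrow> y' \<in> \<sigma> \<Longrightarrow> 0 \<le> u \<Longrightarrow> u \<le> 1 \<Longrightarrow>
        h (u *\<^sub>R y + (1 - u) *\<^sub>R y') = u * h y + (1 - u) * h y'"
    by (rule cellE[OF F(1)]) blast
  define \<delta> where "\<delta> = z - h y0"
  have val: "val c x = ereal (c \<bullet> y + h y + \<delta>)" if "(x, y) \<in> F" for x y
  proof -
    have h: "V y0 = ereal (h y0)" "V y = ereal (h y)" using \<sigma>(2,3) yF that by blast+
    define z' where "z' = real_of_ereal (V y) + (z - real_of_ereal (V y0))"
    note m = normal_cone_cell_mono[OF F that yz z'_def]
    have "(- c, - 1) \<in> normal_cone UNIV (fiber x0) (y0, z)"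
      using o optimal_iff_normal_cone[OF UNIV_I yz] by simp
    then have "optimal c x y z'" using m(2) optimal_iff_normal_cone[OF UNIV_I m(1)] by blast
    then show ?thesis using val_eqI h by (simp add: z'_def \<delta>_def add.assoc)
  qed
  have "\<forall>x\<in>chamber \<Q> fst x0. \<exists>y. (x, y) \<in> F" using chamber_subset[OF F(1) yF] by force
  then obtain l where l: "\<And>x. x \<in> chamber \<Q> fst x0 \<Longrightarrow> (x, l x) \<in> F" by metis
  define k where "k x = real_of_ereal (val c x)" for x
  show ?thesis
    unfolding affine_along_def
  proof (intro exI[of _ k] conjI ballI)
    show "val c x = ereal (k x)" if "x \<in> chamber \<Q> fst x0" for x
      using val[OF l[OF that]] by (simp add: k_def)
    fix x x' and u :: real
    assume x: "x \<in> chamber \<Q> fst x0" "x' \<in> chamber \<Q> fst x0" and u: "u \<in> {0..1}"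
    have "u *\<^sub>R (x, l x) + (1 - u) *\<^sub>R (x', l x') \<in> F"
      using stratifiedD(2)[OF stratified_\<Q> F(1)] l x u by (intro convexD) auto
    then have "(u *\<^sub>R x + (1 - u) *\<^sub>R x', u *\<^sub>R l x + (1 - u) *\<^sub>R l x') \<in> F" by simp
    from val[OF this] have "k (u *\<^sub>R x + (1 - u) *\<^sub>R x') =
        c \<bullet> (u *\<^sub>R l x + (1 - u) *\<^sub>R l x') + h (u *\<^sub>R l x + (1 - u) *\<^sub>R l x') + \<delta>"
      by (simp add: k_def)
    also have "h (u *\<^sub>R l x + (1 - u) *\<^sub>R l x') = u * h (l x) + (1 - u) * h (l x')"
      using \<sigma>(2) l x u by (intro \<sigma>(4)) auto
    finally show "k (u *\<^sub>R x + (1 - u) *\<^sub>R x') = u * k x + (1 - u) * k x'"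
      using val[OF l[OF x(1)]] val[OF l[OF x(2)]]
      by (simp add: k_def inner_add_right algebra_simps)
  qed
qed

lemma chamberE:
  assumes "\<sigma> \<in> \<C>"
  obtains x0 where "x0 \<in> dom" "\<sigma> = chamber \<Q> fst x0"
  using assms unfolding chamber_complex_def dom_def by blast

lemma chamber_in_\<C>: "x \<in> dom \<Longrightarrow> chamber \<Q> fst x \<in> \<C>"
  unfolding chamber_complex_def dom_def by blast

text \<open>The common refinement of the reflected normal fans of all chambers.\<close>

context
  fixes fan :: "'a set \<Rightarrow> ('b \<times> real) set set" and \<NN> :: "('b \<times> real) set set"
  assumes fan: "\<And>x0. x0 \<in> dom \<Longrightarrow> fan (chamber \<Q> fst x0) = normal_fan EE (fiber x0)"
    and \<NN>: "\<NN> = big_meet EE \<C> (\<lambda>\<sigma>. {uminus ` N | N. N \<in> fan \<sigma>})"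
begin

lemma face_stratified_refined_fan: "face_stratified \<NN>"
  unfolding \<NN>
proof (intro face_stratified_big_meet stratifiedD(1)[OF stratified_\<C>] subspace_EE
    face_stratified_negations)
  fix \<sigma> assume "\<sigma> \<in> \<C>"
  then obtain x0 where "x0 \<in> dom" "\<sigma> = chamber \<Q> fst x0" by (rule chamberE)
  then show "face_stratified (fan \<sigma>)" using fan face_stratified_fiber by simp
qed

text \<open>A cone of the refinement is contained in a reflected normal cone of the fiber above \<open>x\<close>.\<close>

lemma refined_fan_common_minimizer:
  assumes N: "N \<in> \<NN>" and x: "x \<in> dom"
  shows "\<exists>y z. \<forall>c. (c, 1) \<in> N \<longrightarrow> optimal c x y z"
proof -
  let ?\<sigma> = "chamber \<Q> fst x"
  obtain f where f: "N = EE \<inter> (\<Inter>\<sigma>\<in>\<C>. f \<sigma>)"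
      "\<forall>\<sigma>\<in>\<C>. f \<sigma> \<in> {uminus ` N | N. N \<in> fan \<sigma>}"
    using N unfolding \<NN> big_meet_def by blast
  have "f ?\<sigma> \<in> {uminus ` N | N. N \<in> normal_fan EE (fiber x)}"
    using bspec[OF f(2) chamber_in_\<C>[OF x]] unfolding fan[OF x] .
  then obtain y z where yz: "(y, z) \<in> fiber x" "f ?\<sigma> = uminus ` normal_cone EE (fiber x) (y, z)"
    by (auto simp: normal_fan_def)
  have "optimal c x y z" if "(c, 1) \<in> N" for c
  proof -
    have "(c, 1) \<in> uminus ` normal_cone EE (fiber x) (y, z)"
      using that f(1) chamber_in_\<C>[OF x] yz(2) by blast
    then have mem: "(- c, - 1) \<in> normal_cone EE (fiber x) (y, z)" by auto
    then have "(- c, - 1) \<in> EE" unfolding normal_cone_def by blast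
    then show ?thesis by (rule iffD2[OF optimal_iff_normal_cone[OF _ yz(1)] mem])
  qed
  then show ?thesis by blast
qed

text \<open>One point \<open>x\<close> for each chamber suffices, as the fan depends on the chamber only. This matters
  when existence of a minimum is known almost surely for each \<open>x\<close> separately.\<close>

lemma refined_fan_covers:
  assumes c: "c \<in> E" and X: "X \<subseteq> dom" "\<C> \<subseteq> chamber \<Q> fst ` X"
    and opt: "\<And>x. x \<in> X \<Longrightarrow> \<exists>y z. optimal c x y z"
  shows "(c, 1) \<in> \<Union>\<NN>"
  unfolding \<NN> Union_big_meet
proof (intro IntI INT_I)
  show "(c, 1) \<in> EE" using c by simp
  fix \<sigma> assume "\<sigma> \<in> \<C>"
  then obtain x where x: "x \<in> X" "\<sigma> = chamber \<Q> fst x" using X(2) by blast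
  then obtain y z where o: "optimal c x y z" using opt by blast
  then have yz: "(y, z) \<in> fiber x" by (simp add: optimal_def)
  have "(- c, - 1) \<in> EE" using c subspace_E by (simp add: subspace_neg)
  then have "(- c, - 1) \<in> normal_cone EE (fiber x) (y, z)"
    by (rule iffD1[OF optimal_iff_normal_cone[OF _ yz] o])
  then have "(c, 1) \<in> uminus ` normal_cone EE (fiber x) (y, z)"
    by (rule rev_image_eqI) simp
  moreover have "fan \<sigma> = normal_fan EE (fiber x)" using x X(1) fan by blast
  then have "normal_cone EE (fiber x) (y, z) \<in> fan \<sigma>" using yz by (simp add: normal_fan_def)
  ultimately show "(c, 1) \<in> \<Union>{uminus ` N | N. N \<in> fan \<sigma>}" by blast
qed

end

end

section \<open>Expectations\<close>

lemma uniform_measure_integral: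
  fixes f :: "'w \<Rightarrow> 'b::{banach, second_countable_topology}"
  assumes "finite_measure M" and A: "A \<in> sets M" "measure M A \<noteq> 0" and f: "integrable M f"
  shows "integrable (uniform_measure M A) f"
    and "integral\<^sup>L (uniform_measure M A) f = (1 / measure M A) *\<^sub>R (\<integral>\<omega>. indicator A \<omega> *\<^sub>R f \<omega> \<partial>M)"
proof -
  interpret finite_measure M by fact
  have pos: "measure M A > 0" using A(2) measure_nonneg[of M A] by linarith
  have "indicator A \<omega> / emeasure M A = ennreal (indicator A \<omega> / measure M A)" for \<omega>
    using pos by (cases "\<omega> \<in> A") (auto simp: emeasure_eq_measure divide_ennreal[symmetric])
  then have eq: "uniform_measure M A = density M (\<lambda>\<omega>. ennreal (indicator A \<omega> / measure M A))"
    by (simp add: uniform_measure_def)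
  have ind: "integrable M (\<lambda>\<omega>. indicator A \<omega> *\<^sub>R f \<omega>)"
    using A(1) f by (rule integrable_mult_indicator)
  have sc: "(indicator A \<omega> / measure M A) *\<^sub>R f \<omega> = (1 / measure M A) *\<^sub>R (indicator A \<omega> *\<^sub>R f \<omega>)" for \<omega>
    by simp
  have m: "(\<lambda>\<omega>. indicator A \<omega> / measure M A) \<in> borel_measurable M" using A(1) by measurable
  show "integrable (uniform_measure M A) f"
    unfolding eq using f m ind
    by (subst integrable_density) (auto simp: sc simp del: scaleR_scaleR)
  show "integral\<^sup>L (uniform_measure M A) f = (1 / measure M A) *\<^sub>R (\<integral>\<omega>. indicator A \<omega> *\<^sub>R f \<omega> \<partial>M)"
    unfolding eq using f m
    by (subst integral_density) (auto simp: sc simp del: scaleR_scaleR)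
qed

lemma ereal_expectation_real:
  assumes g: "integrable M g" and eq: "AE \<omega> in M. f \<omega> = ereal (g \<omega>)"
  shows "ereal_expectation M f = ereal (integral\<^sup>L M g)"
proof -
  have pos: "(\<integral>\<^sup>+ \<omega>. e2ennreal (f \<omega>) \<partial>M) = (\<integral>\<^sup>+ \<omega>. ennreal (g \<omega>) \<partial>M)"
    by (rule nn_integral_cong_AE) (use eq in auto)
  have neg: "(\<integral>\<^sup>+ \<omega>. e2ennreal (- f \<omega>) \<partial>M) = (\<integral>\<^sup>+ \<omega>. ennreal (- g \<omega>) \<partial>M)"
    by (rule nn_integral_cong_AE) (use eq in auto)
  have fin: "(\<integral>\<^sup>+ \<omega>. ennreal (g \<omega>) \<partial>M) \<noteq> \<infinity>" "(\<integral>\<^sup>+ \<omega>. ennreal (- g \<omega>) \<partial>M) \<noteq> \<infinity>"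
    using g by (auto simp: real_integrable_def)
  have conv: "enn2ereal a = ereal (enn2real a)" if "a \<noteq> \<infinity>" for a
    using that by (cases a) (auto simp: enn2ereal_ennreal)
  show ?thesis
    unfolding ereal_expectation_def pos neg
    using fin conv g by (simp add: real_lebesgue_integral_def)
qed

lemma ereal_expectation_infinite:
  assumes A: "A \<in> sets M" "emeasure M A \<noteq> 0" and eq: "AE \<omega> in M. \<omega> \<in> A \<longrightarrow> f \<omega> = \<infinity>"
  shows "ereal_expectation M f = \<infinity>"
proof -
  have "(\<integral>\<^sup>+ \<omega>. top * indicator A \<omega> \<partial>M) \<le> (\<integral>\<^sup>+ \<omega>. e2ennreal (f \<omega>) \<partial>M)"
    by (rule nn_integral_mono_AE) (use eq in \<open>auto simp: indicator_def\<close>)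
  moreover have "(\<integral>\<^sup>+ \<omega>. top * indicator A \<omega> \<partial>M) = top"
    using A by (subst nn_integral_cmult_indicator) (auto simp: ennreal_top_mult)
  ultimately have "(\<integral>\<^sup>+ \<omega>. e2ennreal (f \<omega>) \<partial>M) = top" by (simp only: top_unique)
  then show ?thesis by (simp add: ereal_expectation_def)
qed

lemma ereal_not_minf_if_nonneg: "0 \<le> (a::ereal) \<Longrightarrow> a \<noteq> -\<infinity>"
  by auto

lemma borel_rel_interior:
  fixes S :: "'a::euclidean_space set"
  shows "rel_interior S \<in> sets borel"
proof -
  obtain T where "open T" "rel_interior S = affine hull S \<inter> T"
    using openin_rel_interior[of S] unfolding openin_open by blast
  then show ?thesis by auto
qed

lemma sets_cost_in_rel_interior:
  fixes C :: "'w \<Rightarrow> 'b::euclidean_space"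
  assumes "C \<in> borel_measurable M"
  shows "{\<omega> \<in> space M. (C \<omega>, 1::real) \<in> rel_interior N} \<in> sets M"
proof -
  have "(\<lambda>\<omega>. (C \<omega>, 1::real)) \<in> borel_measurable M"
    using assms by (auto intro: borel_measurable_Pair)
  then have "(\<lambda>\<omega>. (C \<omega>, 1::real)) -` rel_interior N \<inter> space M \<in> sets M"
    by (rule measurable_sets[OF _ borel_rel_interior])
  moreover have "(\<lambda>\<omega>. (C \<omega>, 1::real)) -` rel_interior N \<inter> space M =
      {\<omega> \<in> space M. (C \<omega>, 1) \<in> rel_interior N}"
    by auto
  ultimately show ?thesis by simp
qed

section \<open>Quantization of a random cost\<close>

context stage
begin

text \<open>Optimality of a fixed pair \<open>(y, z)\<close> is a family of inequalities that are affine in the cost.\<close>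

lemma optimal_mean:
  assumes "prob_space L" "integrable L C" and opt: "AE \<omega> in L. optimal (C \<omega>) x y z"
  shows "optimal (integral\<^sup>L L C) x y z"
proof -
  interpret prob_space L by fact
  have "(y, z) \<in> fiber x"
  proof -
    have "AE \<omega> in L. (y, z) \<in> fiber x" using opt by eventually_elim (simp add: optimal_def)
    then show ?thesis by simp
  qed
  moreover have "integral\<^sup>L L C \<bullet> y + z \<le> integral\<^sup>L L C \<bullet> w + \<zeta>" if "(w, \<zeta>) \<in> fiber x" for w \<zeta>
  proof -
    have "(\<integral>\<omega>. C \<omega> \<bullet> y + z \<partial>L) \<le> (\<integral>\<omega>. C \<omega> \<bullet> w + \<zeta> \<partial>L)"
    proof (rule integral_mono_AE)
      show "AE \<omega> in L. C \<omega> \<bullet> y + z \<le> C \<omega> \<bullet> w + \<zeta>"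
        using opt by eventually_elim (use that in \<open>auto simp: optimal_def\<close>)
    qed (use assms(2) in auto)
    then show ?thesis using assms(2) by (simp add: prob_space)
  qed
  ultimately show ?thesis by (auto simp: optimal_def)
qed

text \<open>A random cost \<open>C\<close> is observed on an event \<open>A\<close>, on which \<open>(C, 1)\<close> almost surely lies in the
  support of a fan with common minimizers. The conditional means are left unspecified on cones of
  probability zero, where their weight vanishes.\<close>

context
  fixes M :: "'w measure" and C :: "'w \<Rightarrow> 'b" and A :: "'w set"
    and \<NN> :: "('b \<times> real) set set" and U :: "('b \<times> real) set \<Rightarrow> 'w set" and mean :: "('b \<times> real) set \<Rightarrow> 'b"
  assumes M: "prob_space M" and A: "A \<in> sets M" "measure M A \<noteq> 0" and C: "integrable M C"
    and \<NN>: "face_stratified \<NN>"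
    and minimizer: "\<And>N x. N \<in> \<NN> \<Longrightarrow> x \<in> dom \<Longrightarrow> \<exists>y z. \<forall>c. (c, 1) \<in> N \<longrightarrow> optimal c x y z"
    and cover: "AE \<omega> in M. \<omega> \<in> A \<longrightarrow> (C \<omega>, 1) \<in> \<Union>\<NN>"
    and U: "\<And>N. U N = A \<inter> {\<omega> \<in> space M. (C \<omega>, 1) \<in> rel_interior N}"
    and mean: "\<And>N. measure M (U N) \<noteq> 0 \<Longrightarrow> mean N = integral\<^sup>L (uniform_measure M (U N)) C"
begin

lemma sets_U: "U N \<in> sets M"
  using A(1) C sets_cost_in_rel_interior[of C M N] unfolding U by auto

text \<open>The relative interiors of the cones partition the support of the fan.\<close>

lemma sum_over_cones:
  "AE \<omega> in M. \<omega> \<in> A \<longrightarrow> (\<exists>N\<in>\<NN>. \<omega> \<in> U N \<and>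
     (\<forall>k::_ \<Rightarrow> real. (\<Sum>N\<in>\<NN>. indicator (U N) \<omega> * k N) = k N))"
  using cover AE_space
proof eventually_elim
  case (elim \<omega>)
  show ?case
  proof
    assume "\<omega> \<in> A"
    then obtain N where N: "N \<in> \<NN>" "(C \<omega>, 1) \<in> rel_interior N"
      using elim(1) face_stratifiedD(3)[OF \<NN>, of "(C \<omega>, 1)"] by blast
    then have "\<omega> \<in> U N" using \<open>\<omega> \<in> A\<close> elim(2) by (simp add: U)
    moreover have "(\<Sum>N'\<in>\<NN>. indicator (U N') \<omega> * k N') = k N" for k :: "_ \<Rightarrow> real"
    proof -
      have "indicator (U N') \<omega> * k N' = (if N' = N then k N else 0)" if N': "N' \<in> \<NN>" for N'
      proof (cases "\<omega> \<in> U N'")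
        case True
        then have "(C \<omega>, 1) \<in> rel_interior N'" by (simp add: U)
        then have "N' = N" by (rule face_stratified_unique[OF \<NN> N' N(1) _ N(2)])
        then show ?thesis using True by simp
      next
        case False
        then have "N' \<noteq> N" using \<open>\<omega> \<in> U N\<close> by blast
        then show ?thesis using False by simp
      qed
      then have "(\<Sum>N'\<in>\<NN>. indicator (U N') \<omega> * k N') = (\<Sum>N'\<in>\<NN>. if N' = N then k N else 0)"
        by (intro sum.cong) auto
      also have "\<dots> = k N" using N(1) face_stratifiedD(1)[OF \<NN>] by simp
      finally show ?thesis .
    qed
    ultimately show "\<exists>N\<in>\<NN>. \<omega> \<in> U N \<and>
        (\<forall>k::_ \<Rightarrow> real. (\<Sum>N\<in>\<NN>. indicator (U N) \<omega> * k N) = k N)"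
      using N(1) by blast
  qed
qed

lemma prob_space_uniform_U: "measure M (U N) \<noteq> 0 \<Longrightarrow> prob_space (uniform_measure M (U N))"
proof -
  interpret prob_space M by (rule M)
  show "measure M (U N) \<noteq> 0 \<Longrightarrow> prob_space (uniform_measure M (U N))"
    by (intro prob_space_uniform_measure) (auto simp: emeasure_eq_measure)
qed

lemma optimal_cell_mean:
  assumes "\<And>c. (c, 1) \<in> N \<Longrightarrow> optimal c x y z" "measure M (U N) \<noteq> 0"
  shows "optimal (mean N) x y z"
  unfolding mean[OF assms(2)]
proof (rule optimal_mean)
  interpret prob_space M by (rule M)
  show "prob_space (uniform_measure M (U N))" using assms(2) by (rule prob_space_uniform_U)
  show "integrable (uniform_measure M (U N)) C"
    using uniform_measure_integral(1)[OF finite_measure_axioms sets_U assms(2) C] .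
  show "AE \<omega> in uniform_measure M (U N). optimal (C \<omega>) x y z"
  proof (rule AE_uniform_measureI[OF sets_U], rule AE_I2, rule impI)
    fix \<omega> assume "\<omega> \<in> U N"
    then show "optimal (C \<omega>) x y z" using assms(1) rel_interior_subset unfolding U by blast
  qed
qed

lemma integral_over_U:
  "integrable M (\<lambda>\<omega>. indicator (U N) \<omega> * (C \<omega> \<bullet> y + z))"
  "(\<integral>\<omega>. indicator (U N) \<omega> * (C \<omega> \<bullet> y + z) \<partial>M) = measure M (U N) * (mean N \<bullet> y + z)"
proof -
  interpret prob_space M by (rule M)
  let ?f = "\<lambda>\<omega>. C \<omega> \<bullet> y + z"
  have f: "integrable M ?f" using C by auto
  show "integrable M (\<lambda>\<omega>. indicator (U N) \<omega> * ?f \<omega>)"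
    using integrable_mult_indicator[OF sets_U f] by simp
  show "(\<integral>\<omega>. indicator (U N) \<omega> * ?f \<omega> \<partial>M) = measure M (U N) * (mean N \<bullet> y + z)"
  proof (cases "measure M (U N) = 0")
    case True
    then have "U N \<in> null_sets M" using sets_U by (simp add: emeasure_eq_measure null_sets_def)
    then have "AE \<omega> in M. \<omega> \<notin> U N" by (rule AE_not_in)
    then have "(\<integral>\<omega>. indicator (U N) \<omega> * ?f \<omega> \<partial>M) = (\<integral>\<omega>. 0 \<partial>M)"
      using \<open>integrable M (\<lambda>\<omega>. indicator (U N) \<omega> * ?f \<omega>)\<close> by (intro integral_cong_AE) auto
    then show ?thesis using True by simp
  next
    case False
    let ?L = "uniform_measure M (U N)"
    interpret L: prob_space ?L using False by (rule prob_space_uniform_U)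
    have "integrable ?L C" using uniform_measure_integral(1)[OF finite_measure_axioms sets_U False C] .
    moreover have "measure ?L (space M) = 1" using L.prob_space by simp
    ultimately have "integral\<^sup>L ?L ?f = mean N \<bullet> y + z" by (simp add: mean[OF False])
    moreover have "integral\<^sup>L ?L ?f = (1 / measure M (U N)) *\<^sub>R (\<integral>\<omega>. indicator (U N) \<omega> *\<^sub>R ?f \<omega> \<partial>M)"
      using uniform_measure_integral(2)[OF finite_measure_axioms sets_U False f] .
    ultimately show ?thesis using False by (simp add: field_simps)
  qed
qed

lemma sum_weights: "(\<Sum>N\<in>\<NN>. measure M (U N)) = measure M A"
proof -
  interpret prob_space M by (rule M)
  have "(\<Sum>N\<in>\<NN>. measure M (U N)) = (\<Sum>N\<in>\<NN>. \<integral>\<omega>. indicator (U N) \<omega> \<partial>M)"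
    using sets_U by simp
  also have "\<dots> = (\<integral>\<omega>. (\<Sum>N\<in>\<NN>. indicator (U N) \<omega> * 1) \<partial>M)"
    using sets_U by (subst Bochner_Integration.integral_sum) (auto simp: emeasure_eq_measure)
  also have "\<dots> = (\<integral>\<omega>. indicator A \<omega> \<partial>M)"
  proof (rule integral_cong_AE)
    show "AE \<omega> in M. (\<Sum>N\<in>\<NN>. indicator (U N) \<omega> * 1) = (indicator A \<omega> :: real)"
      using sum_over_cones
    proof eventually_elim
      case (elim \<omega>)
      show ?case
      proof (cases "\<omega> \<in> A")
        case True
        then obtain N where "\<forall>k::_ \<Rightarrow> real. (\<Sum>N\<in>\<NN>. indicator (U N) \<omega> * k N) = k N"
          using elim by blast
        from this[rule_format, of "\<lambda>_. 1"] show ?thesis using True by simp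
      next
        case False
        then have "indicator (U N) \<omega> = (0::real)" for N by (simp add: U)
        then show ?thesis using False by simp
      qed
    qed
  qed (use sets_U A(1) in measurable)
  also have "\<dots> = measure M A" using A(1) by simp
  finally show ?thesis .
qed

text \<open>The function \<open>g\<close> is the value of the common minimizer of the cone that the cost falls into. Its
  integral is computed on each cone by linearity. It is kept in the statement because the law of
  total expectation integrates it again.\<close>

lemma quantization:
  assumes x: "x \<in> dom"
  shows "\<exists>g. integrable M g \<and> (AE \<omega> in M. \<omega> \<in> A \<longrightarrow> val (C \<omega>) x = ereal (g \<omega>)) \<and>
     ereal ((\<integral>\<omega>. indicator A \<omega> * g \<omega> \<partial>M) / measure M A) =
       (\<Sum>N\<in>\<NN>. ereal (measure M (U N) / measure M A) * val (mean N) x)"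
proof -
  interpret prob_space M by (rule M)
  have "\<forall>N\<in>\<NN>. \<exists>p. \<forall>c. (c, 1) \<in> N \<longrightarrow> optimal c x (fst p) (snd p)"
  proof
    fix N assume "N \<in> \<NN>"
    then obtain y z where "\<forall>c. (c, 1) \<in> N \<longrightarrow> optimal c x y z" using minimizer x by blast
    then show "\<exists>p. \<forall>c. (c, 1) \<in> N \<longrightarrow> optimal c x (fst p) (snd p)"
      by (intro exI[of _ "(y, z)"]) simp
  qed
  from bchoice[OF this] obtain p
    where p: "\<forall>N\<in>\<NN>. \<forall>c. (c, 1) \<in> N \<longrightarrow> optimal c x (fst (p N)) (snd (p N))" ..
  define y z where "y N = fst (p N)" and "z N = snd (p N)" for N
  have yz: "optimal c x (y N) (z N)" if "N \<in> \<NN>" "(c, 1) \<in> N" for N c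
    using p that by (simp add: y_def z_def)
  define k where "k N \<omega> = C \<omega> \<bullet> y N + z N" for N \<omega>
  define g where "g \<omega> = (\<Sum>N\<in>\<NN>. indicator (U N) \<omega> * k N \<omega>)" for \<omega>
  have int: "integrable M g" unfolding g_def k_def by (intro Bochner_Integration.integrable_sum integral_over_U(1))
  have ae: "AE \<omega> in M. \<omega> \<in> A \<longrightarrow> val (C \<omega>) x = ereal (g \<omega>)"
    using sum_over_cones
  proof eventually_elim
    case (elim \<omega>)
    show ?case
    proof
      assume "\<omega> \<in> A"
      then obtain N where N: "N \<in> \<NN>" "\<omega> \<in> U N"
          "\<forall>k::_ \<Rightarrow> real. (\<Sum>N\<in>\<NN>. indicator (U N) \<omega> * k N) = k N"
        using elim by blast
      have "(C \<omega>, 1) \<in> N" using N(2) rel_interior_subset unfolding U by blast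
      then have "val (C \<omega>) x = ereal (k N \<omega>)" using val_eqI[OF yz[OF N(1)]] by (simp add: k_def)
      moreover have "g \<omega> = k N \<omega>"
        unfolding g_def using N(3)[rule_format, of "\<lambda>N. k N \<omega>"] .
      ultimately show "val (C \<omega>) x = ereal (g \<omega>)" by simp
    qed
  qed
  have "indicator A \<omega> * g \<omega> = g \<omega>" for \<omega>
    by (cases "\<omega> \<in> A") (auto simp: g_def U)
  then have "(\<integral>\<omega>. indicator A \<omega> * g \<omega> \<partial>M) = integral\<^sup>L M g" by (simp only:)
  also have "\<dots> = (\<Sum>N\<in>\<NN>. measure M (U N) * (mean N \<bullet> y N + z N))"
    unfolding g_def k_def
    by (subst Bochner_Integration.integral_sum) (auto simp: integral_over_U)
  finally have "(\<integral>\<omega>. indicator A \<omega> * g \<omega> \<partial>M) / measure M A =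
      (\<Sum>N\<in>\<NN>. measure M (U N) / measure M A * (mean N \<bullet> y N + z N))"
    by (simp add: sum_divide_distrib)
  then have "ereal ((\<integral>\<omega>. indicator A \<omega> * g \<omega> \<partial>M) / measure M A) =
      (\<Sum>N\<in>\<NN>. ereal (measure M (U N) / measure M A * (mean N \<bullet> y N + z N)))"
    by (simp add: sum_ereal)
  also have "\<dots> = (\<Sum>N\<in>\<NN>. ereal (measure M (U N) / measure M A) * val (mean N) x)"
  proof (rule sum.cong[OF refl])
    fix N assume N: "N \<in> \<NN>"
    show "ereal (measure M (U N) / measure M A * (mean N \<bullet> y N + z N)) =
        ereal (measure M (U N) / measure M A) * val (mean N) x"
    proof (cases "measure M (U N) = 0")
      case False
      then have "val (mean N) x = ereal (mean N \<bullet> y N + z N)"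
        using val_eqI[OF optimal_cell_mean[OF yz[OF N]]] by blast
      then show ?thesis by simp
    qed (simp add: zero_ereal_def[symmetric])
  qed
  finally show ?thesis using int ae by blast
qed

lemma quantization_outside_dom:
  assumes "x \<notin> dom"
  shows "(\<Sum>N\<in>\<NN>. ereal (measure M (U N) / measure M A) * val (mean N) x) = \<infinity>"
proof -
  have fin: "finite \<NN>" by (rule face_stratifiedD(1)[OF \<NN>])
  have pos: "measure M A > 0" using A(2) measure_nonneg[of M A] by linarith
  obtain N where N: "N \<in> \<NN>" "measure M (U N) \<noteq> 0"
  proof (rule ccontr)
    assume "\<not> thesis"
    then have "\<forall>N\<in>\<NN>. measure M (U N) = 0" using that by blast
    then have "(\<Sum>N\<in>\<NN>. measure M (U N)) = 0" by (rule sum.neutral)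
    then show False using sum_weights A(2) by simp
  qed
  have "measure M (U N) > 0" using N(2) measure_nonneg[of M "U N"] by linarith
  then have inf: "ereal (measure M (U N) / measure M A) * val (mean N) x = \<infinity>"
    using pos by (simp add: val_outside_dom[OF assms])
  have nonneg: "0 \<le> ereal (measure M (U N') / measure M A) * val (mean N') x" for N'
    by (intro ereal_0_le_mult) (simp_all add: val_outside_dom[OF assms])
  have "ereal (measure M (U N') / measure M A) * val (mean N') x \<noteq> -\<infinity>" for N'
    by (rule ereal_not_minf_if_nonneg[OF nonneg])
  show ?thesis using inf N(1) fin by (auto simp: sum_Pinfty)
qed

end

end

section \<open>The constraints\<close>

lemma subspace_coord_space: "subspace (coord_space I)"
  by (auto simp: coord_space_def subspace_def)

lemma polyhedron_le_vector: "polyhedron {w::real^'q. w \<le> b}"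
proof -
  have "{w. w \<le> b} = \<Inter>((\<lambda>j. {w. axis j 1 \<bullet> w \<le> b $ j}) ` UNIV)"
    by (auto simp: less_eq_vec_def inner_axis' )
  then show ?thesis by (auto simp: polyhedron_halfspace_le)
qed

lemma mem_coupling_polyhedron:
  "(x, y) \<in> coupling_polyhedron I t s \<longleftrightarrow>
     x \<in> coord_space (I (t - 1)) \<and> y \<in> coord_space (I t) \<and> satisfies s x y"
  by (simp add: coupling_polyhedron_def)

lemma polyhedron_coupling:
  fixes s :: "('n::finite, 'q::finite) constr"
  shows "polyhedron (coupling_polyhedron I t s)"
proof -
  obtain A B b where s: "s = (A, B, b)" by (cases s)
  have lin: "linear (\<lambda>p. A *v snd p + B *v fst p)"
    by (rule linearI) (auto simp: matrix_vector_right_distrib scaleR_matrix_vector_assoc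
        matrix_vector_mult_scaleR algebra_simps)
  have "coupling_polyhedron I t s = (coord_space (I (t - 1)) \<times> coord_space (I t)) \<inter>
      {p. A *v snd p + B *v fst p \<in> {w. w \<le> b}}"
    by (auto simp: coupling_polyhedron_def s)
  moreover have "polyhedron (coord_space (I (t - 1)))" "polyhedron (coord_space (I t))"
    by (intro affine_imp_polyhedron subspace_imp_affine subspace_coord_space)+
  ultimately show ?thesis
    by (simp only: polyhedron_Int polyhedron_Times polyhedron_linear_preimage[OF lin] polyhedron_le_vector)
qed

text \<open>Weak duality: a nonnegative combination of the rows of \<open>A\<close> is bounded above where \<open>A w\<close> is.\<close>

lemma row_cone_bounded_above:
  fixes A :: "real^'n^'q" and v b :: "real^'q"
  assumes "a \<in> convex_cone hull (columns (transpose A))"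
  shows "\<exists>K. \<forall>w. A *v w + v \<le> b \<longrightarrow> a \<bullet> w \<le> K"
proof -
  let ?W = "{a. \<exists>K. \<forall>w. A *v w + v \<le> b \<longrightarrow> a \<bullet> w \<le> K}"
  have "convex_cone ?W"
    unfolding convex_cone_iff
  proof (intro conjI ballI allI impI)
    show "0 \<in> ?W" by auto
    fix x y assume "x \<in> ?W" "y \<in> ?W"
    then obtain K L where "\<forall>w. A *v w + v \<le> b \<longrightarrow> x \<bullet> w \<le> K" "\<forall>w. A *v w + v \<le> b \<longrightarrow> y \<bullet> w \<le> L"
      by blast
    then have "\<forall>w. A *v w + v \<le> b \<longrightarrow> (x + y) \<bullet> w \<le> K + L"
      by (simp add: inner_add_left add_mono)
    then show "x + y \<in> ?W" by blast
  next
    fix x and r :: real assume "x \<in> ?W" "0 \<le> r"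
    then obtain K where "\<forall>w. A *v w + v \<le> b \<longrightarrow> x \<bullet> w \<le> K" by blast
    then have "\<forall>w. A *v w + v \<le> b \<longrightarrow> (r *\<^sub>R x) \<bullet> w \<le> r * K"
      using \<open>0 \<le> r\<close> by (simp add: mult_left_mono)
    then show "r *\<^sub>R x \<in> ?W" by blast
  qed
  moreover have "columns (transpose A) \<subseteq> ?W"
  proof
    fix r assume "r \<in> columns (transpose A)"
    then obtain j where j: "r = row j A"
      unfolding columns_def by (auto simp: column_transpose)
    have "r \<bullet> w = (A *v w) $ j" for w
      unfolding j by (simp add: matrix_vector_mul_component row_def)
    then have "\<forall>w. A *v w + v \<le> b \<longrightarrow> r \<bullet> w \<le> b $ j - v $ j"
      by (auto simp: less_eq_vec_def algebra_simps)
    then show "r \<in> ?W" by blast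
  qed
  ultimately have "convex_cone hull (columns (transpose A)) \<subseteq> ?W" by (rule hull_minimal[rotated])
  then show ?thesis using assms by blast
qed

section \<open>The multistage recursion\<close>

locale multistage = prob_space M for M :: "'w measure" +
  fixes T :: nat and I :: "nat \<Rightarrow> 'n::finite set" and c :: "nat \<Rightarrow> 'w \<Rightarrow> real^'n"
    and \<xi> :: "nat \<Rightarrow> 'w \<Rightarrow> ('n, 'q::finite) constr"
  assumes xi_meas: "\<And>t. t \<in> {2..T} \<Longrightarrow> \<xi> t \<in> borel_measurable M"
    and xi_finite: "\<And>t. t \<in> {2..T} \<Longrightarrow> finitely_supported M (\<xi> t)"
    and c_space: "\<And>t \<omega>. t \<in> {2..T} \<Longrightarrow> \<omega> \<in> space M \<Longrightarrow> c t \<omega> \<in> coord_space (I t)"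
    and c_L1: "\<And>t. t \<in> {2..T} \<Longrightarrow> integrable M (c t)"
    and c_cone: "\<And>t. t \<in> {2..T} \<Longrightarrow>
        AE \<omega> in M. c t \<omega> \<in> uminus ` (convex_cone hull (columns (transpose (fst (\<xi> t \<omega>)))))"
    and min_exists: "\<And>t x. t \<in> {2..<T} \<Longrightarrow> x \<in> coord_space (I (t - 1)) \<Longrightarrow>
        AE \<omega> in M. has_min_on
          (\<lambda>y. ereal (c t \<omega> \<bullet> y) + stage_Q M T I c \<xi> t (\<xi> t \<omega>) x y) (coord_space (I t))"
begin

abbreviation "V \<equiv> value_fn M T I c \<xi>"

text \<open>The invariant of the backward recursion.\<close>

definition regular :: "nat \<Rightarrow> bool" where
  "regular t \<longleftrightarrow> piecewise_affine (coord_space (I (t - 1))) (V t) (cells M T I \<xi> t)"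

definition event :: "nat \<Rightarrow> ('n, 'q) constr \<Rightarrow> 'w set" where
  "event t s = {\<omega> \<in> space M. \<xi> t \<omega> = s}"

lemma event_sets: "t \<in> {2..T} \<Longrightarrow> event t s \<in> sets M"
proof -
  assume "t \<in> {2..T}"
  then have "\<xi> t -` {s} \<inter> space M \<in> sets M" by (intro measurable_sets[OF xi_meas]) auto
  moreover have "\<xi> t -` {s} \<inter> space M = event t s" by (auto simp: event_def)
  ultimately show ?thesis by simp
qed

lemma atoms_event: "s \<in> atoms M (\<xi> t) \<longleftrightarrow> measure M (event t s) > 0"
  by (simp add: atoms_def event_def)

lemma atoms_finite_AE:
  assumes t: "t \<in> {2..T}"
  shows "finite (atoms M (\<xi> t))" "AE \<omega> in M. \<xi> t \<omega> \<in> atoms M (\<xi> t)"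
proof -
  obtain S where S: "finite S" "AE \<omega> in M. \<xi> t \<omega> \<in> S"
    using xi_finite[OF t] unfolding finitely_supported_def by blast
  have null: "measure M (event t s) = 0 \<longleftrightarrow> (AE \<omega> in M. \<xi> t \<omega> \<noteq> s)" for s
  proof -
    have "(AE \<omega> in M. \<omega> \<notin> event t s) \<longleftrightarrow> (AE \<omega> in M. \<xi> t \<omega> \<noteq> s)"
      by (rule AE_cong) (simp add: event_def)
    then show ?thesis using prob_eq_0[OF event_sets[OF t]] by simp
  qed
  have "atoms M (\<xi> t) \<subseteq> S"
  proof
    fix s assume s: "s \<in> atoms M (\<xi> t)"
    show "s \<in> S"
    proof (rule ccontr)
      assume "s \<notin> S"
      then have "AE \<omega> in M. \<xi> t \<omega> \<noteq> s" using S(2) by (auto elim: eventually_mono)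
      then show False using s null[of s] by (simp add: atoms_event)
    qed
  qed
  then show "finite (atoms M (\<xi> t))" using S(1) finite_subset by blast
  have "AE \<omega> in M. \<forall>s\<in>S - atoms M (\<xi> t). \<xi> t \<omega> \<noteq> s"
  proof (subst AE_finite_all)
    show "finite (S - atoms M (\<xi> t))" using S(1) by simp
    show "\<forall>s\<in>S - atoms M (\<xi> t). AE \<omega> in M. \<xi> t \<omega> \<noteq> s"
    proof
      fix s assume "s \<in> S - atoms M (\<xi> t)"
      then have "measure M (event t s) = 0"
        using measure_nonneg[of M "event t s"] by (simp add: atoms_event)
      then show "AE \<omega> in M. \<xi> t \<omega> \<noteq> s" using null by blast
    qed
  qed
  with S(2) show "AE \<omega> in M. \<xi> t \<omega> \<in> atoms M (\<xi> t)" by eventually_elim blast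
qed

lemma stageI:
  assumes "regular (Suc t)"
  shows "stage (coord_space (I (t - 1))) (coord_space (I t)) (coupling_polyhedron I t s)
    (V (Suc t)) (cells M T I \<xi> (Suc t))"
proof
  show "coupling_polyhedron I t s \<subseteq> coord_space (I (t - 1)) \<times> coord_space (I t)"
    by (auto simp: coupling_polyhedron_def)
qed (use assms in \<open>simp_all add: regular_def subspace_coord_space polyhedron_coupling\<close>)

text \<open>The integrand in the definition of \<open>V t\<close>.\<close>

definition opt_value :: "nat \<Rightarrow> real^'n \<Rightarrow> 'w \<Rightarrow> ereal" where
  "opt_value t x \<omega> = (INF y \<in> {y \<in> coord_space (I t). satisfies (\<xi> t \<omega>) x y}.
     ereal (c t \<omega> \<bullet> y) + V (Suc t) y)"

context
  fixes t :: nat and s :: "('n, 'q) constr"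
  assumes t: "t \<in> {2..T}" and regular: "regular (Suc t)" and s: "s \<in> atoms M (\<xi> t)"
begin

interpretation st: stage "coord_space (I (t - 1))" "coord_space (I t)" "coupling_polyhedron I t s"
  "V (Suc t)" "cells M T I \<xi> (Suc t)"
  using regular by (rule stageI)

abbreviation "E' \<equiv> coord_space (I (t - 1))"
abbreviation "A \<equiv> event t s"

lemma A_sets: "A \<in> sets M" by (rule event_sets[OF t])

lemma A_pos: "measure M A > 0" using s by (simp add: atoms_event)

lemma cond_on_eq: "cond_on M (\<xi> t) s = uniform_measure M A"
  by (simp add: cond_on_def event_def)

lemma Q_eq: "x \<in> E' \<Longrightarrow> y \<in> coord_space (I t) \<Longrightarrow> stage_Q M T I c \<xi> t s x y = st.Q x y"
  unfolding stage_Q_def st.Q_def by (simp add: mem_coupling_polyhedron)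

lemma val_eq:
  "x \<in> E' \<Longrightarrow> (INF y\<in>coord_space (I t). ereal (b \<bullet> y) + stage_Q M T I c \<xi> t s x y) = st.val b x"
  unfolding st.val_def by (intro INF_cong refl) (simp add: Q_eq)

lemma opt_value_eq:
  assumes x: "x \<in> E'" and \<omega>: "\<omega> \<in> A"
  shows "opt_value t x \<omega> = st.val (c t \<omega>) x"
proof (rule antisym)
  have \<xi>: "\<xi> t \<omega> = s" using \<omega> by (simp add: event_def)
  have Q: "st.Q x y = (if satisfies s x y then V (Suc t) y else \<infinity>)" if "y \<in> coord_space (I t)" for y
    using that x st.V_not_minf[OF that]
    unfolding st.Q_def by (cases "V (Suc t) y") (auto simp: mem_coupling_polyhedron convex_ind_def)
  show "opt_value t x \<omega> \<le> st.val (c t \<omega>) x"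
    unfolding st.val_def
  proof (rule INF_greatest)
    fix y assume y: "y \<in> coord_space (I t)"
    show "opt_value t x \<omega> \<le> ereal (c t \<omega> \<bullet> y) + st.Q x y"
    proof (cases "satisfies s x y")
      case True
      then show ?thesis unfolding opt_value_def \<xi> using y Q[OF y] by (auto intro: INF_lower2)
    qed (simp add: Q[OF y])
  qed
  show "st.val (c t \<omega>) x \<le> opt_value t x \<omega>"
    unfolding opt_value_def \<xi>
  proof (rule INF_greatest)
    fix y assume y: "y \<in> {y \<in> coord_space (I t). satisfies s x y}"
    then have "st.val (c t \<omega>) x \<le> ereal (c t \<omega> \<bullet> y) + st.Q x y"
      unfolding st.val_def by (intro INF_lower) auto
    then show "st.val (c t \<omega>) x \<le> ereal (c t \<omega> \<bullet> y) + V (Suc t) y" using Q[of y] y by simp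
  qed
qed

lemma cond_cells_eq: "cond_cells M T I \<xi> t s = st.\<C>"
  unfolding cond_cells_def cell_step_def st.\<Q>_def ..

lemma fiber_eq: "x \<in> E' \<Longrightarrow> epi_fiber M T I c \<xi> t s x = st.fiber x"
  by (auto simp: epi_fiber_def st.fiber_def Q_eq)

lemma cell_fan_eq:
  assumes x0: "x0 \<in> st.dom"
  shows "cell_fan M T I c \<xi> t s (chamber st.\<Q> fst x0) = normal_fan st.EE (st.fiber x0)"
proof -
  let ?\<sigma> = "chamber st.\<Q> fst x0"
  have eq: "normal_fan st.EE (epi_fiber M T I c \<xi> t s x) = normal_fan st.EE (st.fiber x0)"
    if x: "x \<in> rel_interior ?\<sigma>" for x
  proof -
    have "x \<in> E'"
      using x rel_interior_subset st.chamber_subset_dom[OF x0] st.dom_subset by blast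
    then show ?thesis using st.normal_fan_constant_on_chamber[OF x0 x] fiber_eq by simp
  qed
  obtain x where "x \<in> rel_interior ?\<sigma>"
    using st.convex_chamber st.mem_chamber[OF x0] rel_interior_eq_empty by blast
  then show ?thesis
    unfolding cell_fan_def using eq by (intro the_equality) auto
qed

text \<open>At the last stage the value function of the next stage is zero, and the cone condition on the
  costs bounds the objective from below.\<close>

lemma minimum_attained:
  assumes x: "x \<in> st.dom"
  shows "AE \<omega> in M. \<omega> \<in> A \<longrightarrow> (\<exists>y z. st.optimal (c t \<omega>) x y z)"
proof (cases "t < T")
  case True
  have xE: "x \<in> E'" using x st.dom_subset by blast
  have "t \<in> {2..<T}" using True t by simp
  from min_exists[OF this xE] show ?thesis
  proof eventually_elim
    case (elim \<omega>)
    show ?case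
    proof
      assume "\<omega> \<in> A"
      then have "has_min_on (\<lambda>y. ereal (c t \<omega> \<bullet> y) + st.Q x y) (coord_space (I t))"
        using elim Q_eq[OF xE] unfolding has_min_on_def event_def by auto
      then show "\<exists>y z. st.optimal (c t \<omega>) x y z" using st.optimal_if_has_min[OF x] by blast
    qed
  qed
next
  case False
  then have tT: "T < Suc t" by simp
  have V0: "V (Suc t) y = 0" for y by (subst value_fn.simps) (simp add: tT)
  obtain G B b where sb: "s = (G, B, b)" by (cases s)
  from c_cone[OF t] show ?thesis
  proof eventually_elim
    case (elim \<omega>)
    show ?case
    proof
      assume "\<omega> \<in> A"
      then have "\<xi> t \<omega> = s" by (simp add: event_def)
      then obtain a where a: "c t \<omega> = - a" "a \<in> convex_cone hull (columns (transpose G))"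
        using elim sb by auto
      obtain K where K: "\<And>w. G *v w + B *v x \<le> b \<Longrightarrow> a \<bullet> w \<le> K"
        using row_cone_bounded_above[OF a(2)] by blast
      have "- K \<le> c t \<omega> \<bullet> w + \<zeta>" if "(w, \<zeta>) \<in> st.fiber x" for w \<zeta>
      proof -
        have "(x, w, \<zeta>) \<in> st.epi" using that st.mem_fiber by blast
        then have "G *v w + B *v x \<le> b" "0 \<le> \<zeta>"
          unfolding st.epi_def by (auto simp: V0 mem_coupling_polyhedron sb)
        then show ?thesis using K[of w] a(1) by simp
      qed
      then show "\<exists>y z. st.optimal (c t \<omega>) x y z" by (rule st.optimal_if_bounded[OF x])
    qed
  qed
qed

abbreviation "\<NN> \<equiv> quant_fan M T I c \<xi> t s"

definition "U N = A \<inter> {\<omega> \<in> space M. (c t \<omega>, 1) \<in> rel_interior N}"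

lemma quant_fan_eq:
  "\<NN> = big_meet st.EE st.\<C> (\<lambda>\<sigma>. {uminus ` N | N. N \<in> cell_fan M T I c \<xi> t s \<sigma>})"
  by (simp add: quant_fan_def cond_cells_eq)

lemma face_stratified_quant_fan: "face_stratified \<NN>"
  by (rule st.face_stratified_refined_fan[OF cell_fan_eq quant_fan_eq])

lemma common_minimizer:
  "N \<in> \<NN> \<Longrightarrow> x \<in> st.dom \<Longrightarrow> \<exists>y z. \<forall>b. (b, 1) \<in> N \<longrightarrow> st.optimal b x y z"
  by (rule st.refined_fan_common_minimizer[OF cell_fan_eq quant_fan_eq])

text \<open>Attainment holds almost surely at each point; a finite set of points that represent the
  chambers makes the exceptional null set independent of the point.\<close>

lemma quant_fan_covers: "AE \<omega> in M. \<omega> \<in> A \<longrightarrow> (c t \<omega>, 1) \<in> \<Union>\<NN>"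
proof -
  have "st.\<C> = chamber st.\<Q> fst ` st.dom" unfolding chamber_complex_def st.dom_def ..
  then obtain X where X: "X \<subseteq> st.dom" "finite X" "st.\<C> = chamber st.\<Q> fst ` X"
    using finite_subset_image[OF stratifiedD(1)[OF st.stratified_\<C>], of "chamber st.\<Q> fst" st.dom]
    by auto
  have "AE \<omega> in M. \<forall>x\<in>X. \<omega> \<in> A \<longrightarrow> (\<exists>y z. st.optimal (c t \<omega>) x y z)"
    using X(1) minimum_attained by (subst AE_finite_all[OF X(2)]) blast
  then show ?thesis
    using AE_space
  proof eventually_elim
    case (elim \<omega>)
    show ?case
    proof
      assume "\<omega> \<in> A"
      then show "(c t \<omega>, 1) \<in> \<Union>\<NN>"
        using elim X
        by (intro st.refined_fan_covers[OF cell_fan_eq quant_fan_eq c_space[OF t]]) auto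
    qed
  qed
qed

lemma quant_cost_U:
  "measure M (U N) \<noteq> 0 \<Longrightarrow> quant_cost M c \<xi> t s N = integral\<^sup>L (uniform_measure M (U N)) (c t)"
proof -
  have "U N = {\<omega> \<in> space M. \<xi> t \<omega> = s \<and> (c t \<omega>, 1) \<in> rel_interior N}"
    by (auto simp: U_def event_def)
  then show "measure M (U N) \<noteq> 0 \<Longrightarrow> quant_cost M c \<xi> t s N = integral\<^sup>L (uniform_measure M (U N)) (c t)"
    unfolding quant_cost_def Let_def by simp
qed

lemmas quantization_premises = prob_space_axioms A_sets A_pos[THEN less_imp_neq, THEN not_sym]
  c_L1[OF t] face_stratified_quant_fan common_minimizer quant_fan_covers U_def quant_cost_U

lemma quant_prob_U: "quant_prob M c \<xi> t s N = measure M (U N) / measure M A"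
proof -
  have "{\<omega> \<in> space M. (c t \<omega>, 1) \<in> rel_interior N} \<in> sets M"
    using c_L1[OF t] by (intro sets_cost_in_rel_interior) auto
  moreover have "emeasure M A \<noteq> 0" using A_pos by (simp add: emeasure_eq_measure)
  ultimately show ?thesis
    unfolding quant_prob_def cond_on_eq U_def by (subst measure_uniform_measure) auto
qed

definition quantized :: "real^'n \<Rightarrow> ereal" where
  "quantized x = (\<Sum>N\<in>\<NN>. ereal (quant_prob M c \<xi> t s N) * st.val (quant_cost M c \<xi> t s N) x)"

lemma quantized_dom:
  assumes x: "x \<in> st.dom"
  shows "\<exists>g. integrable M g \<and> (AE \<omega> in M. \<omega> \<in> A \<longrightarrow> st.val (c t \<omega>) x = ereal (g \<omega>)) \<and>
     ereal ((\<integral>\<omega>. indicator A \<omega> * g \<omega> \<partial>M) / measure M A) = quantized x"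
  unfolding quantized_def quant_prob_U by (rule st.quantization[OF quantization_premises x])

lemma quantized_outside_dom: "x \<notin> st.dom \<Longrightarrow> quantized x = \<infinity>"
  unfolding quantized_def quant_prob_U
  by (rule st.quantization_outside_dom[OF quantization_premises])

lemma cond_value_eq:
  assumes x: "x \<in> E'"
  shows "cond_value M T I c \<xi> t x s = quantized x"
proof -
  let ?L = "uniform_measure M A"
  have eA: "emeasure M A \<noteq> 0" using A_pos by (simp add: emeasure_eq_measure)
  have cv: "cond_value M T I c \<xi> t x s = ereal_expectation ?L (\<lambda>\<omega>. st.val (c t \<omega>) x)"
    unfolding cond_value_def cond_on_eq val_eq[OF x] ..
  show ?thesis
  proof (cases "x \<in> st.dom")
    case True
    then obtain g where g: "integrable M g" "AE \<omega> in M. \<omega> \<in> A \<longrightarrow> st.val (c t \<omega>) x = ereal (g \<omega>)"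
        "ereal ((\<integral>\<omega>. indicator A \<omega> * g \<omega> \<partial>M) / measure M A) = quantized x"
      using quantized_dom by blast
    note L = uniform_measure_integral[OF finite_measure_axioms A_sets
        A_pos[THEN less_imp_neq, THEN not_sym] g(1)]
    have "ereal_expectation ?L (\<lambda>\<omega>. st.val (c t \<omega>) x) = ereal (integral\<^sup>L ?L g)"
      using L(1) AE_uniform_measureI[OF A_sets g(2)] by (rule ereal_expectation_real)
    then show ?thesis unfolding cv using L(2) g(3) by simp
  next
    case False
    interpret L: prob_space ?L by (rule prob_space_uniform_measure) (use eA in auto)
    have "ereal_expectation ?L (\<lambda>\<omega>. st.val (c t \<omega>) x) = \<infinity>"
      by (rule ereal_expectation_infinite[of "space ?L"])
         (use st.val_outside_dom[OF False] L.emeasure_space_1 in auto)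
    then show ?thesis unfolding cv using quantized_outside_dom[OF False] by simp
  qed
qed

lemma piecewise_affine_quantized: "piecewise_affine E' quantized (cond_cells M T I \<xi> t s)"
  unfolding piecewise_affine_def cond_cells_eq
proof (intro conjI ballI)
  have fin: "finite \<NN>" by (rule face_stratifiedD(1)[OF face_stratified_quant_fan])
  have opt: "\<exists>y z. st.optimal (quant_cost M c \<xi> t s N) x y z"
    if "N \<in> \<NN>" "measure M (U N) \<noteq> 0" "x \<in> st.dom" for N x
    using common_minimizer[OF that(1,3)] st.optimal_cell_mean[OF quantization_premises _ that(2)]
    by blast
  have zero: "(\<lambda>x. ereal (quant_prob M c \<xi> t s N) * st.val (quant_cost M c \<xi> t s N) x) = (\<lambda>_. 0)"
    if "measure M (U N) = 0" for N
    using that by (simp add: quant_prob_U zero_ereal_def[symmetric])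
  show "polyhedral_on E' quantized"
    unfolding quantized_def
  proof (intro polyhedral_on_sum fin subspace_coord_space)
    fix N assume N: "N \<in> \<NN>"
    show "polyhedral_on E' (\<lambda>x. ereal (quant_prob M c \<xi> t s N) * st.val (quant_cost M c \<xi> t s N) x)"
    proof (cases "measure M (U N) = 0")
      case True
      show ?thesis unfolding zero[OF True] by (rule polyhedral_on_zero[OF subspace_coord_space])
    next
      case False
      then have "quant_prob M c \<xi> t s N > 0"
        using A_pos measure_nonneg[of M "U N"] by (simp add: quant_prob_U less_le)
      then show ?thesis using opt[OF N False] by (intro polyhedral_on_cmult st.polyhedral_val) auto
    qed
  qed
  show "stratified st.\<C>" by (rule st.stratified_\<C>)
  have "quantized x \<noteq> \<infinity>" if "x \<in> st.dom" for x using quantized_dom[OF that] by force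
  then show "\<Union>st.\<C> = {x\<in>E'. quantized x \<noteq> \<infinity>}"
    unfolding st.Union_\<C> using quantized_outside_dom st.dom_subset by blast
  fix \<sigma> assume "\<sigma> \<in> st.\<C>"
  then obtain x0 where x0: "x0 \<in> st.dom" "\<sigma> = chamber st.\<Q> fst x0" by (rule st.chamberE)
  show "affine_along \<sigma> quantized"
    unfolding quantized_def
  proof (intro affine_along_sum fin)
    fix N assume N: "N \<in> \<NN>"
    show "affine_along \<sigma> (\<lambda>x. ereal (quant_prob M c \<xi> t s N) * st.val (quant_cost M c \<xi> t s N) x)"
    proof (cases "measure M (U N) = 0")
      case True
      show ?thesis unfolding zero[OF True] by (rule affine_along_zero)
    next
      case False
      then show ?thesis unfolding x0(2)
        using opt[OF N False x0(1)] by (intro affine_along_cmult st.affine_val_chamber x0(1))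
    qed
  qed
qed

lemma conditional_quantization:
  "x \<in> E' \<Longrightarrow> cond_value M T I c \<xi> t x s =
     (\<Sum>N\<in>\<NN>. ereal (quant_prob M c \<xi> t s N) *
        (INF y\<in>coord_space (I t). ereal (quant_cost M c \<xi> t s N \<bullet> y) + stage_Q M T I c \<xi> t s x y))"
  by (simp add: cond_value_eq quantized_def val_eq)

lemma piecewise_affine_cond_value:
  "piecewise_affine E' (\<lambda>x. cond_value M T I c \<xi> t x s) (cond_cells M T I \<xi> t s)"
  by (rule piecewise_affine_cong[OF _ piecewise_affine_quantized]) (simp add: cond_value_eq)

text \<open>The form in which the law of total expectation uses the stage: conditional expectations of the
  extended real optimal value are either infinite or integrals of a real function.\<close>

lemma opt_value_integrable_or_infinite:
  assumes x: "x \<in> E'"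
  shows "if cond_value M T I c \<xi> t x s = \<infinity> then \<forall>\<omega>\<in>A. opt_value t x \<omega> = \<infinity>
    else \<exists>g. integrable M g \<and> (AE \<omega> in M. \<omega> \<in> A \<longrightarrow> opt_value t x \<omega> = ereal (g \<omega>)) \<and>
      cond_value M T I c \<xi> t x s = ereal ((\<integral>\<omega>. indicator A \<omega> * g \<omega> \<partial>M) / measure M A)"
proof (cases "x \<in> st.dom")
  case True
  then obtain g where g: "integrable M g" "AE \<omega> in M. \<omega> \<in> A \<longrightarrow> st.val (c t \<omega>) x = ereal (g \<omega>)"
      "ereal ((\<integral>\<omega>. indicator A \<omega> * g \<omega> \<partial>M) / measure M A) = quantized x"
    using quantized_dom by blast
  have "AE \<omega> in M. \<omega> \<in> A \<longrightarrow> opt_value t x \<omega> = ereal (g \<omega>)"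
    using g(2) by eventually_elim (simp add: opt_value_eq[OF x])
  moreover have cv: "cond_value M T I c \<xi> t x s = ereal ((\<integral>\<omega>. indicator A \<omega> * g \<omega> \<partial>M) / measure M A)"
    unfolding cond_value_eq[OF x] g(3) ..
  ultimately have "\<exists>g. integrable M g \<and> (AE \<omega> in M. \<omega> \<in> A \<longrightarrow> opt_value t x \<omega> = ereal (g \<omega>)) \<and>
      cond_value M T I c \<xi> t x s = ereal ((\<integral>\<omega>. indicator A \<omega> * g \<omega> \<partial>M) / measure M A)"
    using g(1) by blast
  moreover have "cond_value M T I c \<xi> t x s \<noteq> \<infinity>" unfolding cv by simp
  ultimately show ?thesis by (simp only: if_False)
next
  case False
  then show ?thesis
    using quantized_outside_dom cond_value_eq[OF x] opt_value_eq[OF x] st.val_outside_dom by simp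
qed

end

text \<open>The law of total expectation. If some atom makes the problem infeasible, then both sides are
  infinite; otherwise all integrands agree almost surely with integrable real functions.\<close>

lemma value_fn_eq_sum:
  assumes t: "t \<in> {2..T}" and regular: "regular (Suc t)" and x: "x \<in> coord_space (I (t - 1))"
  shows "V t x = (\<Sum>s\<in>atoms M (\<xi> t). ereal (measure M (event t s)) * cond_value M T I c \<xi> t x s)"
proof -
  let ?S = "atoms M (\<xi> t)" and ?p = "\<lambda>s. measure M (event t s)"
  let ?cv = "\<lambda>s. cond_value M T I c \<xi> t x s"
  have fin: "finite ?S" and ae: "AE \<omega> in M. \<xi> t \<omega> \<in> ?S" using atoms_finite_AE[OF t] by auto
  have V: "V t x = ereal_expectation M (opt_value t x)"
    unfolding opt_value_def using t by (subst value_fn.simps) simp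
  note dich = opt_value_integrable_or_infinite[OF t regular _ x]
  show ?thesis
  proof (cases "\<exists>s\<in>?S. ?cv s = \<infinity>")
    case True
    then obtain s where s: "s \<in> ?S" "?cv s = \<infinity>" by blast
    have ps: "?p s > 0" using s(1) by (simp add: atoms_event)
    have "V t x = \<infinity>"
      unfolding V
    proof (rule ereal_expectation_infinite[OF event_sets[OF t, of s]])
      show "emeasure M (event t s) \<noteq> 0" using ps by (simp add: emeasure_eq_measure)
      show "AE \<omega> in M. \<omega> \<in> event t s \<longrightarrow> opt_value t x \<omega> = \<infinity>" using dich[OF s(1)] s(2) by simp
    qed
    moreover have "(\<Sum>s\<in>?S. ereal (?p s) * ?cv s) = \<infinity>"
      using ps s fin by (auto simp: sum_Pinfty intro!: bexI[of _ s])
    ultimately show ?thesis by simp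
  next
    case False
    have "\<forall>s\<in>?S. \<exists>g. integrable M g \<and> (AE \<omega> in M. \<omega> \<in> event t s \<longrightarrow> opt_value t x \<omega> = ereal (g \<omega>)) \<and>
        ?cv s = ereal ((\<integral>\<omega>. indicator (event t s) \<omega> * g \<omega> \<partial>M) / ?p s)"
    proof
      fix s assume s: "s \<in> ?S"
      then have "?cv s \<noteq> \<infinity>" using False by blast
      then show "\<exists>g. integrable M g \<and> (AE \<omega> in M. \<omega> \<in> event t s \<longrightarrow> opt_value t x \<omega> = ereal (g \<omega>)) \<and>
          ?cv s = ereal ((\<integral>\<omega>. indicator (event t s) \<omega> * g \<omega> \<partial>M) / ?p s)"
        using dich[OF s] by (simp only: if_False)
    qed
    from bchoice[OF this] obtain g where
      g: "\<And>s. s \<in> ?S \<Longrightarrow> integrable M (g s)"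
         "\<And>s. s \<in> ?S \<Longrightarrow> AE \<omega> in M. \<omega> \<in> event t s \<longrightarrow> opt_value t x \<omega> = ereal (g s \<omega>)"
         "\<And>s. s \<in> ?S \<Longrightarrow> ?cv s = ereal ((\<integral>\<omega>. indicator (event t s) \<omega> * g s \<omega> \<partial>M) / ?p s)"
      by blast
    define h where "h \<omega> = (\<Sum>s\<in>?S. indicator (event t s) \<omega> * g s \<omega>)" for \<omega>
    have int: "integrable M (\<lambda>\<omega>. indicator (event t s) \<omega> * g s \<omega>)" if "s \<in> ?S" for s
      using integrable_mult_indicator[OF event_sets[OF t] g(1)[OF that]] by simp
    have "AE \<omega> in M. \<forall>s\<in>?S. \<omega> \<in> event t s \<longrightarrow> opt_value t x \<omega> = ereal (g s \<omega>)"
      using g(2) by (subst AE_finite_all[OF fin]) blast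
    then have "AE \<omega> in M. opt_value t x \<omega> = ereal (h \<omega>)"
      using ae AE_space
    proof eventually_elim
      case (elim \<omega>)
      have "h \<omega> = (\<Sum>s\<in>?S. if s = \<xi> t \<omega> then g s \<omega> else 0)"
        unfolding h_def using elim(3) by (intro sum.cong) (auto simp: event_def indicator_def)
      also have "\<dots> = g (\<xi> t \<omega>) \<omega>" using fin elim(2) by simp
      finally show ?case using elim by (simp add: event_def)
    qed
    moreover have "integrable M h" unfolding h_def by (intro Bochner_Integration.integrable_sum int)
    ultimately have "V t x = ereal (integral\<^sup>L M h)" unfolding V by (intro ereal_expectation_real)
    also have "integral\<^sup>L M h = (\<Sum>s\<in>?S. \<integral>\<omega>. indicator (event t s) \<omega> * g s \<omega> \<partial>M)"
      unfolding h_def by (rule Bochner_Integration.integral_sum) (rule int)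
    also have "ereal \<dots> = (\<Sum>s\<in>?S. ereal (\<integral>\<omega>. indicator (event t s) \<omega> * g s \<omega> \<partial>M))"
      by simp
    also have "\<dots> = (\<Sum>s\<in>?S. ereal (?p s) * ?cv s)"
    proof (rule sum.cong[OF refl])
      fix s assume s: "s \<in> ?S"
      then have "?p s \<noteq> 0" by (simp add: atoms_event)
      then show "ereal (\<integral>\<omega>. indicator (event t s) \<omega> * g s \<omega> \<partial>M) = ereal (?p s) * ?cv s"
        using g(3)[OF s] by simp
    qed
    finally show ?thesis .
  qed
qed

lemma value_fn_piecewise_affine_step:
  assumes t: "t \<in> {2..T}" and regular: "regular (Suc t)"
  shows "regular t"
proof -
  let ?E = "coord_space (I (t - 1))" and ?S = "atoms M (\<xi> t)"
  have "piecewise_affine ?E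
      (\<lambda>x. \<Sum>s\<in>?S. ereal (measure M (event t s)) * cond_value M T I c \<xi> t x s)
      (big_meet ?E ?S (cond_cells M T I \<xi> t))"
    using atoms_finite_AE(1)[OF t] piecewise_affine_cond_value[OF t regular]
    by (intro piecewise_affine_weighted_sum subspace_coord_space) (auto simp: atoms_event)
  moreover have "cells M T I \<xi> t = big_meet ?E ?S (cond_cells M T I \<xi> t)"
  proof -
    have "cond_cells M T I \<xi> t = cell_step I t (cells M T I \<xi> (Suc t))"
      by (rule ext) (simp add: cond_cells_def)
    then show ?thesis using t by (subst cells.simps) simp
  qed
  ultimately show ?thesis
    unfolding regular_def
    by (simp only:) (rule piecewise_affine_cong[rotated], assumption, simp add: value_fn_eq_sum[OF t regular])
qed

lemma value_fn_piecewise_affine_final: "regular (Suc T)"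
proof -
  have V: "V (Suc T) = (\<lambda>_. 0)" by (rule ext, subst value_fn.simps) simp
  have "cells M T I \<xi> (Suc T) = {coord_space (I T)}" by (subst cells.simps) simp
  moreover have "stratified {coord_space (I T)}"
    using subspace_coord_space[of "I T"] unfolding stratified_def
    by (auto simp: subspace_imp_convex subspace_imp_affine rel_interior_affine)
  ultimately show ?thesis
    unfolding regular_def piecewise_affine_def V
    by (auto simp: polyhedral_on_zero subspace_coord_space affine_along_zero)
qed

lemma value_fn_piecewise_affine:
  assumes "t \<in> {2..T}"
  shows "regular (Suc t)"
proof -
  have "2 \<le> t" "t \<le> T" using assms by auto
  from \<open>t \<le> T\<close> show ?thesis
  proof (induction rule: inc_induct)
    case base
    show ?case by (rule value_fn_piecewise_affine_final)
  next
    case (step k)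
    then have "Suc k \<in> {2..T}" using \<open>2 \<le> t\<close> by simp
    then show ?case using step.IH by (rule value_fn_piecewise_affine_step)
  qed
qed

theorem exact_quantization:
  assumes "t \<in> {2..T}" "x \<in> coord_space (I (t - 1))" "s \<in> atoms M (\<xi> t)"
  shows "cond_value M T I c \<xi> t x s =
     (\<Sum>N\<in>quant_fan M T I c \<xi> t s. ereal (quant_prob M c \<xi> t s N) *
        (INF y\<in>coord_space (I t). ereal (quant_cost M c \<xi> t s N \<bullet> y) + stage_Q M T I c \<xi> t s x y))"
  using conditional_quantization[OF assms(1) value_fn_piecewise_affine[OF assms(1)] assms(3,2)] .

end

theorem theorem18:
  fixes M :: "'w measure" and T :: nat
    and I :: "nat \<Rightarrow> 'n::finite set" and J :: "nat \<Rightarrow> 'q::finite set"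
    and c :: "nat \<Rightarrow> 'w \<Rightarrow> real^'n"
    and \<xi> :: "nat \<Rightarrow> 'w \<Rightarrow> ('n, 'q) constr"
  assumes prob: "prob_space M"
    and xi_space: "\<And>t \<omega>. t \<in> {1..T} \<Longrightarrow> \<omega> \<in> space M \<Longrightarrow>
                     \<xi> t \<omega> \<in> coord_constrs (J t) (I t) (I (t - 1))"
    and xi_indep: "prob_space.indep_vars M (\<lambda>_. borel) \<xi> {1..T}"
    and xi_finite: "\<And>t. t \<in> {1..T} \<Longrightarrow> finitely_supported M (\<xi> t)"
    and c_space: "\<And>t \<omega>. t \<in> {2..T} \<Longrightarrow> \<omega> \<in> space M \<Longrightarrow> c t \<omega> \<in> coord_space (I t)"
    and c_xi_indep: "prob_space.indep_vars M (\<lambda>_. borel) (\<lambda>t \<omega>. (c t \<omega>, \<xi> t \<omega>)) {2..T}"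
    and c_L1: "\<And>t. t \<in> {2..T} \<Longrightarrow> integrable M (c t)"
    and c_cone: "\<And>t. t \<in> {2..T} \<Longrightarrow>
        AE \<omega> in M. c t \<omega> \<in> uminus ` (convex_cone hull (columns (transpose (fst (\<xi> t \<omega>)))))"
    and min_exists: "\<And>t x. t \<in> {2..<T} \<Longrightarrow> x \<in> coord_space (I (t - 1)) \<Longrightarrow>
        AE \<omega> in M. has_min_on
          (\<lambda>y. ereal (c t \<omega> \<bullet> y) + stage_Q M T I c \<xi> t (\<xi> t \<omega>) x y) (coord_space (I t))"
  shows "\<forall>t \<in> {2..T}. \<forall>x \<in> coord_space (I (t - 1)). \<forall>s \<in> atoms M (\<xi> t).
           cond_value M T I c \<xi> t x s =
           (\<Sum>N \<in> quant_fan M T I c \<xi> t s.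
              ereal (quant_prob M c \<xi> t s N) *
              (INF y \<in> coord_space (I t).
                 ereal (quant_cost M c \<xi> t s N \<bullet> y) + stage_Q M T I c \<xi> t s x y))"
proof -
  interpret prob_space M by (rule prob)
  interpret multistage M T I c \<xi>
  proof
    show "\<xi> t \<in> borel_measurable M" if "t \<in> {2..T}" for t
      using xi_indep that by (simp add: indep_vars_def2)
    show "finitely_supported M (\<xi> t)" if "t \<in> {2..T}" for t
      using that by (intro xi_finite) simp
  qed (fact c_space c_L1 c_cone min_exists)+
  show ?thesis by (intro ballI exact_quantization)
qed

end
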